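(* Let $I\subset\mathbb R$ be an interval and let $a_n(t)=r_n(t)e^{i\alpha_n(t)}$, where $r_n\colon I\to(-1,1)$, $\alpha_n\colon I\to\mathbb R$ are differentiable for $n\in\mathbb N$. For each $t\in I$ let $\mu^t$ be the measure on $\mathbb T$ with Schur parameters $(a_n(t))_{n\in\mathbb N}$, $(\varphi_n^t)_{n\ge0}$ the related orthonormal polynomials and $\rho_n(t)=\sqrt{1-r_n(t)^2}$. Define $$\Gamma_n^t(z):=\frac{2}{\rho_n(t)^2}\,\mathrm{Im}\!\left(e^{-i\alpha_n(t)}z^{2-n}(\varphi_{n-1}^t(z))^2\right),\qquad \Delta_n^t(z):=|\varphi_{n-1}^t(z)|^2-|\varphi_n^t(z)|^2,\qquad n\in\mathbb N.$$ 1. Let $u(t)=e^{i\beta(t)}$ with $\beta\colon I\to\mathbb R$ differentiable, and let $\mu_N^t$ be the finitely supported measure corresponding to the parameters $(a_1(t),\dots,a_{N-1}(t),u(t))$. Then the mass points of $\mu_N^t$ have the form $\lambda(t)=e^{i\theta(t)}$, where $\theta\colon I\to\mathbb R$ is a differentiable function that satisfies $$\theta'(t)=\mu_N^t(\{\lambda(t)\})\left\{\sum_{n=1}^{N-1}\left(r_n'(t)\Gamma_n^t(\lambda(t))+\alpha_n'(t)\Delta_n^t(\lambda(t))\right)+\beta'(t)\,|\varphi_{N-1}^t(\lambda(t))|^2\right\}.$$ 2. Let $r_n$, $\alpha_n$ be twice differentiable for all $n\in\mathbb N$. Assume that $\sup_{n}|r_n'(t)|$, $\sup_{n}|r_n''(t)|$,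 $\sup_{n}|\alpha_n'(t)|$, $\sup_{n}|\alpha_n''(t)|$ are locally bounded on $I$ and that there exists $r<1$ such that $|r_n(t)|<r$ whenever $r_n'(t)\ne0$. Then, if $\lambda_0$ is an isolated mass point of $\mu^{t_0}$, $t_0\in I$, there exists a differentiable function $\lambda\colon J\to\mathbb T$ on a neighbourhood $J$ of $t_0$ such that $\lambda(t)$ is an isolated mass point of $\mu^t$ for $t\in J$ and $\lambda(t_0)=\lambda_0$. Moreover $\lambda(t)=e^{i\theta(t)}$, where $\theta\colon J\to\mathbb R$ is a differentiable function that satisfies $$\theta'(t)=\mu^t(\{\lambda(t)\})\sum_{n=1}^{\infty}\left(r_n'(t)\Gamma_n^t(\lambda(t))+\alpha_n'(t)\Delta_n^t(\lambda(t))\right).$$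
   Context: $\mathbb T=\{|z|=1\}$, $\mathbb D=\{|z|<1\}$; "measure" means Borel probability measure; neighbourhoods of $t_0$ are taken in $I$. For a polynomial $p$ of degree $n$, $p^*(z)=z^n\overline p(z^{-1})$, where $\overline p$ has the conjugate coefficients. For a measure $\mu$ on $\mathbb T$ with infinite support, its orthonormal polynomials $\varphi_n$ ($\deg\varphi_n=n$, positive leading coefficient) satisfy $\varphi_0=1$, $\rho_n\varphi_n(z)=z\varphi_{n-1}(z)+a_n\varphi_{n-1}^*(z)$, $n\ge1$, with Schur parameters $a_n\in\mathbb D$ and $\rho_n=\sqrt{1-|a_n|^2}$; this gives a bijection between measures on $\mathbb T$ with infinite support and sequences $(a_n)_{n\in\mathbb N}$ in $\mathbb D$. For a measure supported on $N$ points of $\mathbb T$, its orthonormal polynomials $\varphi_0,\dots,\varphi_{N-1}$ satisfy the same recurrence with $a_1,\dots,a_{N-1}\in\mathbb D$, and the polynomial $\psi$ vanishing exactly (simply) at the $N$ support points satisfies $\kappa_{N-1}\psi(z)=z\varphi_{N-1}(z)+a_N\varphi_{N-1}^*(z)$ with $a_N\in\mathbb T$, $\psi$ monic and $\kappa_{N-1}$ the leading coefficient of $\varphi_{N-1}$; this gives a bijection between such measures and parameters $(a_1,\dots,a_N)\in\mathbb D^{N-1}\times\mathbb T$. An isolated mass point of $\mu$ is an isolated point of $\mathrm{supp}\,\mu$ (necessarily of positive mass). *)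

theory Defs
  imports "HOL-Probability.Probability" "HOL-Computational_Algebra.Polynomial"
begin

text \<open>A measure on the unit circle is modelled as a Borel probability measure on the complex
  plane that gives full mass to the circle.\<close>

definition circle_measure :: "complex measure \<Rightarrow> bool" where
  "circle_measure M \<longleftrightarrow>
     prob_space M \<and> sets M = sets borel \<and> emeasure M (sphere 0 1) = 1"

definition measure_support :: "'a::topological_space measure \<Rightarrow> 'a set" where
  "measure_support M = {x. \<forall>U. open U \<and> x \<in> U \<longrightarrow> emeasure M U > 0}"

definition mass_points :: "'a measure \<Rightarrow> 'a set" where
  "mass_points M = {x. measure M {x} > 0}"

definition isolated_mass_point :: "'a::topological_space measure \<Rightarrow> 'a \<Rightarrow> bool" where
  "isolated_mass_point M x \<longleftrightarrow> x isolated_in measure_support M"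

text \<open>The index set \<open>K\<close> is \<open>UNIV\<close> for a measure with infinite support
  and \<open>{..<N}\<close> for a measure supported on \<open>N\<close> points.\<close>

definition orthonormal_polynomials ::
    "complex measure \<Rightarrow> nat set \<Rightarrow> (nat \<Rightarrow> complex poly) \<Rightarrow> bool" where
  "orthonormal_polynomials M K \<phi> \<longleftrightarrow>
     (\<forall>n\<in>K. degree (\<phi> n) = n \<and> (\<exists>\<kappa>::real. \<kappa> > 0 \<and> lead_coeff (\<phi> n) = of_real \<kappa>)) \<and>
     (\<forall>m\<in>K. \<forall>n\<in>K. (\<integral>z. poly (\<phi> m) z * cnj (poly (\<phi> n) z) \<partial>M) = (if m = n then 1 else 0))"

text \<open>The degree used in the reversal is the actual degree of the polynomial.\<close>

definition reversed_poly :: "complex poly \<Rightarrow> complex poly" where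
  "reversed_poly p = reflect_poly (map_poly cnj p)"

definition szego_recurrence :: "(nat \<Rightarrow> complex poly) \<Rightarrow> (nat \<Rightarrow> complex) \<Rightarrow> nat \<Rightarrow> bool" where
  "szego_recurrence \<phi> a n \<longleftrightarrow>
     smult (of_real (sqrt (1 - (cmod (a n))\<^sup>2))) (\<phi> n) =
       pCons 0 (\<phi> (n - 1)) + smult (a n) (reversed_poly (\<phi> (n - 1)))"

text \<open>Parameter sequences are indexed from 1; the value at 0 is irrelevant.\<close>

definition has_schur_parameters :: "complex measure \<Rightarrow> (nat \<Rightarrow> complex) \<Rightarrow> bool" where
  "has_schur_parameters M a \<longleftrightarrow>
     circle_measure M \<and> infinite (measure_support M) \<and>
     (\<forall>n\<ge>1. cmod (a n) < 1) \<and>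
     (\<exists>\<phi>. orthonormal_polynomials M UNIV \<phi> \<and> (\<forall>n\<ge>1. szego_recurrence \<phi> a n))"

text \<open>The parameters are \<open>a 1, \<dots>, a N\<close>, the last one being unimodular; the product is the monic
  polynomial vanishing simply at the support points.\<close>

definition has_finite_schur_parameters ::
    "complex measure \<Rightarrow> nat \<Rightarrow> (nat \<Rightarrow> complex) \<Rightarrow> bool" where
  "has_finite_schur_parameters M N a \<longleftrightarrow>
     circle_measure M \<and> N \<ge> 1 \<and> finite (measure_support M) \<and> card (measure_support M) = N \<and>
     (\<forall>n\<in>{1..<N}. cmod (a n) < 1) \<and> cmod (a N) = 1 \<and>
     (\<exists>\<phi>. orthonormal_polynomials M {..<N} \<phi> \<and>
        (\<forall>n\<in>{1..<N}. szego_recurrence \<phi> a n) \<and>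
        smult (lead_coeff (\<phi> (N - 1))) (\<Prod>x\<in>measure_support M. [:- x, 1:]) =
          pCons 0 (\<phi> (N - 1)) + smult (a N) (reversed_poly (\<phi> (N - 1))))"

definition Gamma_term ::
    "(nat \<Rightarrow> real \<Rightarrow> real) \<Rightarrow> (nat \<Rightarrow> real \<Rightarrow> real) \<Rightarrow> (real \<Rightarrow> nat \<Rightarrow> complex poly)
      \<Rightarrow> nat \<Rightarrow> real \<Rightarrow> complex \<Rightarrow> real" where
  "Gamma_term r \<alpha> \<phi> n t z =
     2 / (sqrt (1 - (r n t)\<^sup>2))\<^sup>2 *
       Im (exp (- \<i> * of_real (\<alpha> n t)) * z powi (2 - int n) * (poly (\<phi> t (n - 1)) z)\<^sup>2)"

definition Delta_term :: "(real \<Rightarrow> nat \<Rightarrow> complex poly) \<Rightarrow> nat \<Rightarrow> real \<Rightarrow> complex \<Rightarrow> real" where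
  "Delta_term \<phi> n t z = (cmod (poly (\<phi> t (n - 1)) z))\<^sup>2 - (cmod (poly (\<phi> t n) z))\<^sup>2"

definition locally_bounded_on :: "'a::topological_space set \<Rightarrow> ('a \<Rightarrow> ereal) \<Rightarrow> bool" where
  "locally_bounded_on S f \<longleftrightarrow>
     (\<forall>x\<in>S. \<exists>U. openin (top_of_set S) U \<and> x \<in> U \<and>
        (\<exists>C::real. \<forall>y\<in>U. \<bar>f y\<bar> \<le> ereal C))"

end

theory Submission
  imports Defs
begin

text \<open>
  On the circle, the orthonormal polynomials multiplied by suitable powers of \<open>z\<close> form a CMV basis
  \<open>x\<^sub>n\<close>, in which multiplication by \<open>z\<close> factors into two block-diagonal unitary matrices whose
  \<open>2 \<times> 2\<close> blocks depend on one Schur parameter each. Comparing the blocks of two parameter sequences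
  gives a mixed Christoffel--Darboux formula: for mass points \<open>z\<close>, \<open>w\<close> of the two measures,
  \<open>(z cnj w - 1) (\<Sum>n. x\<^sub>n z cnj (x\<^sub>n' w))\<close> is a sum of terms, each linear in the difference of the two
  \<open>n\<close>-th blocks. Dividing by \<open>t - s\<close> and letting \<open>t\<close> tend to \<open>s\<close> yields the derivative of the angle,
  since \<open>\<Sum>n. (cmod (x\<^sub>n z))\<^sup>2\<close> is the reciprocal of the mass at \<open>z\<close>.

  It remains to follow the mass points continuously. For finite support they solve a strictly
  monotone phase equation. For infinite support, the integral of
  \<open>(cmod (z - w))\<^sup>2 * (cmod (f z))\<^sup>2\<close>, as a quadratic form in the coefficients of \<open>f\<close> in the CMV
  basis, is continuous in the parameters; hence support points persist under perturbation,
  isolated ones do not split, and their masses vary continuously.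
\<close>

section \<open>Szego recursion and the CMV basis\<close>

text \<open>In the basis of the orthonormal polynomials themselves, multiplication by
  \<open>z\<close> mixes all parameters; in the CMV factorization the \<open>n\<close>-th parameter
  enters a single block, so the derivative of the angle becomes a series with one term per
  parameter. Of the eigenvectors only continuity in \<open>t\<close> is available. The mixed formula
  copes with this: it is exact for every pair \<open>t\<close>, \<open>s\<close>, the difference
  quotients fall on the parameters alone, and the vectors merely have to converge. For infinite
  support the series has no fixed summable majorant. Convergence of the sums of squares replaces it,
  that is, continuity of the mass, which must therefore precede differentiability. Different
  measures are compared through finite coefficient vectors: one vector defines a function for each
  measure, with the same norm, and its energy changes by at most a multiple of the largest change of
  a parameter or of its \<open>rho\<close>. Every claim about a support is a test with such vectors,
  so no operators, spectra or weak limits occur.\<close>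

definition rho :: "complex \<Rightarrow> real" where
  "rho a = sqrt (1 - (cmod a)\<^sup>2)"

lemma rho_pos: "cmod a < 1 \<Longrightarrow> rho a > 0"
  by (simp add: rho_def power_less_one_iff abs_square_less_1)

lemma rho_sq: "cmod a \<le> 1 \<Longrightarrow> (rho a)\<^sup>2 = 1 - (cmod a)\<^sup>2"
  by (simp add: rho_def power_le_one)

lemma unimodular_mult_cnj: "cmod z = 1 \<Longrightarrow> z * cnj z = 1"
  by (metis complex_norm_square of_real_1 power_one)

lemma unimodular_power_cnj: "cmod z = 1 \<Longrightarrow> z ^ n * cnj z ^ n = 1"
  by (metis unimodular_mult_cnj power_mult_distrib power_one)

text \<open>On the circle \<open>z ^ n * cnj (szego_val a n z)\<close> is the value of the reversed
  polynomial, so the recursion closes up on values. These depend on the parameters alone and can be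
  compared across measures; off the circle they are in general not polynomial values.\<close>

primrec szego_val :: "(nat \<Rightarrow> complex) \<Rightarrow> nat \<Rightarrow> complex \<Rightarrow> complex" where
  "szego_val a 0 z = 1"
| "szego_val a (Suc n) z =
     (z * szego_val a n z + a (Suc n) * z ^ n * cnj (szego_val a n z)) / of_real (rho (a (Suc n)))"

lemma continuous_on_szego_val [continuous_intros]:
  assumes "\<And>n. n \<ge> 1 \<Longrightarrow> cmod (a n) < 1"
  shows "continuous_on S (szego_val a n)"
proof (induction n)
  case (Suc n)
  have "rho (a (Suc n)) \<noteq> 0" using rho_pos[OF assms[of "Suc n"]] by simp
  then show ?case using Suc by (auto intro!: continuous_intros)
qed simp

text \<open>On the circle, multiplying the values of the orthonormal polynomials by powers of \<open>z\<close> yields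
  the CMV basis \<open>x\<^sub>n\<close>; there the other CMV basis is the complex conjugate of this one.\<close>

definition cmv :: "complex \<Rightarrow> (nat \<Rightarrow> complex) \<Rightarrow> nat \<Rightarrow> complex" where
  "cmv z b n = (if even n then cnj z ^ (n div 2) * b n else z ^ (n div 2) * cnj (b n))"

lemma norm_cmv: "cmod z = 1 \<Longrightarrow> cmod (cmv z b n) = cmod (b n)"
  by (simp add: cmv_def norm_mult norm_power)

text \<open>The block is the symmetric unitary matrix with rows \<open>(- a, \<rho>)\<close> and
  \<open>(\<rho>, cnj a)\<close>. For even \<open>n\<close> it sends the conjugated pair to
  \<open>z\<close> times the pair, for odd \<open>n\<close> the pair to the conjugated pair. With
  \<open>\<rho>\<close> as a separate variable the block is linear in
  \<open>(a, \<rho>)\<close>.\<close>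

definition cmv_step :: "complex \<Rightarrow> real \<Rightarrow> complex \<Rightarrow> nat \<Rightarrow> complex \<Rightarrow> complex \<Rightarrow> bool" where
  "cmv_step a \<rho> z n p q \<longleftrightarrow> (cmod a)\<^sup>2 + \<rho>\<^sup>2 = 1 \<and>
     (if even n
      then z * p = - a * cnj p + of_real \<rho> * cnj q \<and> z * q = of_real \<rho> * cnj p + cnj a * cnj q
      else cnj p = - a * p + of_real \<rho> * q \<and> cnj q = of_real \<rho> * p + cnj a * q)"

text \<open>The recursion is the first row of the block equation. The second row multiplied by
  \<open>\<rho>\<close> follows from the first by unitarity; \<open>\<rho>\<close> can be cancelled
  unless it is 0, and then \<open>zero\<close> makes both sides vanish.\<close>

lemma cmv_stepI:
  assumes z: "cmod z = 1" and u: "(cmod a)\<^sup>2 + \<rho>\<^sup>2 = 1"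
    and rec: "of_real \<rho> * b (Suc n) = z * b n + a * z ^ n * cnj (b n)"
    and zero: "\<rho> = 0 \<Longrightarrow> b (Suc n) = 0"
  shows "cmv_step a \<rho> z n (cmv z b n) (cmv z b (Suc n))"
proof -
  define p q where "p = cmv z b n" and "q = cmv z b (Suc n)"
  define R :: complex where "R = of_real \<rho>"
  have zz: "z * cnj z = 1" by (rule unimodular_mult_cnj[OF z])
  have R2: "R * R = 1 - a * cnj a"
    using u complex_norm_square[of a] unfolding R_def
    by (metis add_diff_cancel_left' of_real_1 of_real_add of_real_mult power2_eq_square)
  have q0: "q = 0" if "R = 0" using zero that by (simp add: q_def cmv_def R_def)
  have cR: "cnj R = R" by (simp add: R_def)
  show ?thesis
  proof (cases "even n")
    case True
    then obtain k where n: "n = 2 * k" by blast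
    have k: "cnj z ^ k * (z ^ k * z ^ k) = z ^ k"
      using unimodular_power_cnj[OF z, of k] by (simp add: mult_ac)
    have zn: "z ^ n = z ^ k * z ^ k" by (simp add: n mult_2 power_add)
    have "R * cnj q = cnj z ^ k * (R * b (Suc n))" by (simp add: q_def cmv_def n)
    also have "\<dots> = z * (cnj z ^ k * b n) + a * (cnj z ^ k * (z ^ k * z ^ k)) * cnj (b n)"
      unfolding R_def rec zn by (simp add: algebra_simps)
    also have "\<dots> = z * p + a * cnj p" unfolding k by (simp add: p_def cmv_def n)
    finally have e: "R * cnj q = z * p + a * cnj p" .
    have "R * q = cnj (R * cnj q)" by (simp add: cR)
    then have rq: "R * q = cnj z * cnj p + cnj a * p" unfolding e by simp
    have "R * (z * q) = z * (R * q)" by simp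
    also have "\<dots> = (z * cnj z) * cnj p + cnj a * (z * p)" unfolding rq by (simp add: algebra_simps)
    also have "\<dots> = (R * R) * cnj p + cnj a * (R * cnj q)" unfolding e R2 zz by (simp add: algebra_simps)
    finally have "R * (z * q) = R * (R * cnj p + cnj a * cnj q)" by (simp add: algebra_simps)
    then have "R = 0 \<or> z * q = R * cnj p + cnj a * cnj q" by simp
    then have "z * q = R * cnj p + cnj a * cnj q" using q0 by auto
    then show ?thesis using True u e by (simp add: cmv_step_def p_def q_def R_def)
  next
    case False
    then obtain k where n: "n = 2 * k + 1" using oddE by blast
    have k: "cnj z ^ k * (z ^ k * z ^ k) = z ^ k"
      using unimodular_power_cnj[OF z, of k] by (simp add: mult_ac)
    have zn: "z ^ n = z * (z ^ k * z ^ k)" by (simp add: n mult_2 power_add)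
    have "R * q = cnj z * cnj z ^ k * (R * b (Suc n))" by (simp add: q_def cmv_def n)
    also have "\<dots> = (z * cnj z) * (cnj z ^ k * b n) + a * (z * cnj z) * (cnj z ^ k * (z ^ k * z ^ k)) * cnj (b n)"
      unfolding R_def rec zn by (simp add: algebra_simps)
    also have "\<dots> = cnj p + a * p" unfolding k zz by (simp add: p_def cmv_def n)
    finally have e: "R * q = cnj p + a * p" .
    have "R * cnj q = cnj (R * q)" by (simp add: cR)
    also have "\<dots> = (R * R) * p + cnj a * (R * q)" unfolding e R2 by (simp add: algebra_simps)
    finally have "R * cnj q = R * (R * p + cnj a * q)" by (simp add: algebra_simps)
    then have "R = 0 \<or> cnj q = R * p + cnj a * q" by simp
    then have "cnj q = R * p + cnj a * q" using q0 by auto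
    then show ?thesis using False u e by (simp add: cmv_step_def p_def q_def R_def)
  qed
qed

section \<open>Comparison of the blocks of two parameter sequences\<close>

definition block_form :: "complex \<Rightarrow> real \<Rightarrow> complex \<Rightarrow> complex \<Rightarrow> complex \<Rightarrow> complex \<Rightarrow> complex" where
  "block_form a \<rho> p q p' q' = (- a * p + of_real \<rho> * q) * p' + (of_real \<rho> * p + cnj a * q) * q'"

text \<open>A bilinear pairing of the block, applied to the first pair, with the second pair. The
  conjugations and the factor \<open>w\<close> are placed so that in both parities the step equation
  of either pair can be inserted.\<close>

definition cmv_block ::
    "complex \<Rightarrow> real \<Rightarrow> nat \<Rightarrow> complex \<Rightarrow> complex \<Rightarrow> complex \<Rightarrow> complex \<Rightarrow> complex \<Rightarrow> complex" where
  "cmv_block a \<rho> n p q w p' q' =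
     (if even n then block_form a \<rho> (cnj p) (cnj q) (cnj (w * p')) (cnj (w * q'))
      else block_form a \<rho> p q p' q')"

text \<open>Linear in the size of the block and quadratic in the vectors: this provides the
  majorants when the series is differentiated.\<close>

lemma norm_cmv_block_le:
  assumes "cmod a \<le> e" "\<bar>\<rho>\<bar> \<le> e" "cmod w = 1"
  shows "cmod (cmv_block a \<rho> n p q w p' q')
    \<le> e * ((cmod p)\<^sup>2 + (cmod q)\<^sup>2 + (cmod p')\<^sup>2 + (cmod q')\<^sup>2)"
proof -
  have *: "cmod (block_form a \<rho> p q p' q')
      \<le> e * ((cmod p)\<^sup>2 + (cmod q)\<^sup>2 + (cmod p')\<^sup>2 + (cmod q')\<^sup>2)" for p q p' q'
  proof -
    have e: "e \<ge> 0" using assms(1) norm_ge_zero order_trans by blast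
    have 1: "cmod (- a * p + of_real \<rho> * q) \<le> e * (cmod p + cmod q)"
      using norm_triangle_ineq[of "- a * p" "of_real \<rho> * q"]
        mult_right_mono[OF assms(1), of "cmod p"] mult_right_mono[OF assms(2), of "cmod q"]
      by (simp add: norm_mult algebra_simps)
    have 2: "cmod (of_real \<rho> * p + cnj a * q) \<le> e * (cmod p + cmod q)"
      using norm_triangle_ineq[of "of_real \<rho> * p" "cnj a * q"]
        mult_right_mono[OF assms(1), of "cmod q"] mult_right_mono[OF assms(2), of "cmod p"]
      by (simp add: norm_mult algebra_simps)
    have "cmod (block_form a \<rho> p q p' q')
        \<le> e * (cmod p + cmod q) * cmod p' + e * (cmod p + cmod q) * cmod q'"
      unfolding block_form_def
      using norm_triangle_ineq mult_right_mono[OF 1, of "cmod p'"] mult_right_mono[OF 2, of "cmod q'"]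
      by (smt (verit) norm_ge_zero norm_mult)
    also have "\<dots> = e * ((cmod p + cmod q) * (cmod p' + cmod q'))" by (simp add: algebra_simps)
    also have "\<dots> \<le> e * ((cmod p)\<^sup>2 + (cmod q)\<^sup>2 + (cmod p')\<^sup>2 + (cmod q')\<^sup>2)"
    proof (intro mult_left_mono e)
      have "2 * ((cmod p + cmod q) * (cmod p' + cmod q'))
          \<le> (cmod p + cmod q)\<^sup>2 + (cmod p' + cmod q')\<^sup>2"
        using sum_squares_bound[of "cmod p + cmod q" "cmod p' + cmod q'"] by (simp only: mult.assoc)
      moreover have "(x + y)\<^sup>2 \<le> 2 * x\<^sup>2 + 2 * y\<^sup>2" for x y :: real
        using sum_squares_bound[of x y] by (simp add: power2_sum)
      ultimately show "(cmod p + cmod q) * (cmod p' + cmod q')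
          \<le> (cmod p)\<^sup>2 + (cmod q)\<^sup>2 + (cmod p')\<^sup>2 + (cmod q')\<^sup>2"
        by (smt (verit))
    qed
    finally show ?thesis .
  qed
  show ?thesis
    using *[of p q p' q'] *[of "cnj p" "cnj q" "cnj (w * p')" "cnj (w * q')"] assms(3)
    by (simp add: cmv_block_def norm_mult)
qed

text \<open>By linearity the pairing is evaluated for each of the two blocks. With the block of the
  first pair, the step equation of that pair applies; with the block of the second pair, the step
  equation of the latter puts this block on both sides, and unitarity (\<open>iso\<close>) removes
  it.\<close>

lemma cmv_block_diff:
  assumes s: "cmv_step a \<rho> z n p q" and s': "cmv_step a' \<rho>' w n p' q'"
  shows "cmv_block (a - a') (\<rho> - \<rho>') n p q w p' q' =
     (if even n then z * cnj w * (p * cnj p' + q * cnj q') - cnj (p * cnj p' + q * cnj q')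
      else cnj (p * cnj p' + q * cnj q') - (p * cnj p' + q * cnj q'))"
proof -
  have u: "block_form (a - a') (\<rho> - \<rho>') p q p' q'
      = block_form a \<rho> p q p' q' - block_form a' \<rho>' p q p' q'" for p q p' q'
    by (simp add: block_form_def algebra_simps)
  have r2: "of_real \<rho>' * of_real \<rho>' + a' * cnj a' = (1 :: complex)"
    using s' unfolding cmv_step_def
    by (metis add.commute complex_norm_square of_real_1 of_real_add of_real_mult power2_eq_square)
  have iso: "(- a' * p + of_real \<rho>' * q) * cnj (- a' * p' + of_real \<rho>' * q')
      + (of_real \<rho>' * p + cnj a' * q) * cnj (of_real \<rho>' * p' + cnj a' * q')
      = p * cnj p' + q * cnj q'" for p q p' q'
  proof -
    have "(- a' * p + of_real \<rho>' * q) * cnj (- a' * p' + of_real \<rho>' * q')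
      + (of_real \<rho>' * p + cnj a' * q) * cnj (of_real \<rho>' * p' + cnj a' * q')
      = (of_real \<rho>' * of_real \<rho>' + a' * cnj a') * (p * cnj p' + q * cnj q')"
      by (simp add: algebra_simps)
    then show ?thesis by (simp add: r2)
  qed
  show ?thesis
  proof (cases "even n")
    case True
    then have e: "z * p = - a * cnj p + of_real \<rho> * cnj q" "z * q = of_real \<rho> * cnj p + cnj a * cnj q"
      "w * p' = - a' * cnj p' + of_real \<rho>' * cnj q'" "w * q' = of_real \<rho>' * cnj p' + cnj a' * cnj q'"
      using s s' by (auto simp: cmv_step_def)
    have "block_form a \<rho> (cnj p) (cnj q) (cnj (w * p')) (cnj (w * q'))
        = (z * p) * cnj (w * p') + (z * q) * cnj (w * q')"
      unfolding block_form_def e(1,2) by simp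
    moreover have "block_form a' \<rho>' (cnj p) (cnj q) (cnj (w * p')) (cnj (w * q'))
        = cnj (p * cnj p' + q * cnj q')"
      unfolding block_form_def e(3,4) using iso[of "cnj p" "cnj q" "cnj p'" "cnj q'"] by simp
    ultimately show ?thesis using True by (simp add: cmv_block_def u algebra_simps)
  next
    case False
    then have e: "cnj p = - a * p + of_real \<rho> * q" "cnj q = of_real \<rho> * p + cnj a * q"
      "cnj p' = - a' * p' + of_real \<rho>' * q'" "cnj q' = of_real \<rho>' * p' + cnj a' * q'"
      using s s' by (auto simp: cmv_step_def)
    have "block_form a \<rho> p q p' q' = cnj p * p' + cnj q * q'"
      unfolding block_form_def e(1,2) by simp
    moreover have "block_form a' \<rho>' p q p' q' = p * cnj p' + q * cnj q'"
    proof -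
      have "p' = cnj (- a' * p' + of_real \<rho>' * q')" "q' = cnj (of_real \<rho>' * p' + cnj a' * q')"
        using e(3,4) complex_cnj_cnj by metis+
      then have "block_form a' \<rho>' p q p' q' =
        (- a' * p + of_real \<rho>' * q) * cnj (- a' * p' + of_real \<rho>' * q')
      + (of_real \<rho>' * p + cnj a' * q) * cnj (of_real \<rho>' * p' + cnj a' * q')"
        unfolding block_form_def by metis
      then show ?thesis using iso by simp
    qed
    ultimately show ?thesis using False by (simp add: cmv_block_def u algebra_simps)
  qed
qed

text \<open>Each product \<open>y n * cnj (y' n)\<close> with \<open>n \<ge> 1\<close> lies in one
  block of either parity. The even block contributes it times \<open>z * cnj w\<close> minus its
  conjugate, the odd block the conjugate minus the product; together this is the factor
  \<open>z * cnj w - 1\<close>. Coordinate 0 lies in an even block only, but there the product is 1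
  and equals its conjugate. The last coordinate leaves a boundary term.\<close>

lemma mixed_christoffel_darboux:
  assumes "y 0 = 1" "y' 0 = 1"
    and "\<And>n. cmv_step (a (Suc n)) (\<rho> (Suc n)) z n (y n) (y (Suc n))"
    and "\<And>n. cmv_step (a' (Suc n)) (\<rho>' (Suc n)) w n (y' n) (y' (Suc n))"
  shows "(\<Sum>n<N. cmv_block (a (Suc n) - a' (Suc n)) (\<rho> (Suc n) - \<rho>' (Suc n)) n
             (y n) (y (Suc n)) w (y' n) (y' (Suc n)))
    = (z * cnj w - 1) * (\<Sum>n<N. y n * cnj (y' n))
      + (if even N then cnj (y N * cnj (y' N)) - y N * cnj (y' N)
         else z * cnj w * (y N * cnj (y' N)) - cnj (y N * cnj (y' N)))"
proof (induction N)
  case (Suc N)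
  show ?case
    unfolding sum.lessThan_Suc[of _ N] Suc
    unfolding cmv_block_diff[OF assms(3,4)] by (simp add: algebra_simps)
qed (simp add: assms)

section \<open>Differentiating an eigenvalue\<close>

lemma norm_suminf_diff_le:
  fixes f :: "nat \<Rightarrow> 'b::banach"
  assumes "\<And>n. norm (f n) \<le> g n" "summable g"
  shows "norm (suminf f - sum f {..<N}) \<le> suminf g - sum g {..<N}"
proof -
  have f: "summable f" using assms by (rule summable_comparison_test'[of g 0, rotated])
  have "norm (\<Sum>n. f (n + N)) \<le> (\<Sum>n. g (n + N))"
    using assms by (intro norm_suminf_le) (auto simp: summable_iff_shift)
  then show ?thesis using f assms(2) by (simp add: suminf_minus_initial_segment)
qed

text \<open>Pratt's form of dominated convergence: the majorants \<open>g t\<close> vary with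
  \<open>t\<close>. Their tails are uniformly small because both their sums and their initial
  segments converge.\<close>

lemma tendsto_suminf_dominated:
  fixes f :: "'a \<Rightarrow> nat \<Rightarrow> 'b::banach"
  assumes f: "\<And>n. ((\<lambda>t. f t n) \<longlongrightarrow> F n) L" and g: "\<And>n. ((\<lambda>t. g t n) \<longlongrightarrow> G n) L"
    and ev: "\<forall>\<^sub>F t in L. (\<forall>n. norm (f t n) \<le> g t n) \<and> summable (g t)"
    and F: "\<And>n. norm (F n) \<le> G n" and G: "summable G"
    and lim: "((\<lambda>t. suminf (g t)) \<longlongrightarrow> suminf G) L"
  shows "((\<lambda>t. suminf (f t)) \<longlongrightarrow> suminf F) L"
proof (rule tendstoI)
  fix e :: real assume e: "e > 0"
  have "(\<lambda>N. suminf G - sum G {..<N}) \<longlonglongrightarrow> suminf G - suminf G"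
    using summable_LIMSEQ[OF G] by (intro tendsto_intros)
  then have "\<forall>\<^sub>F N in sequentially. suminf G - sum G {..<N} < e / 4"
    using e by (intro order_tendstoD(2)[where y = 0]) auto
  then obtain N where N: "suminf G - sum G {..<N} < e / 4"
    using eventually_happens sequentially_bot by blast
  have "((\<lambda>t. suminf (g t) - sum (g t) {..<N}) \<longlongrightarrow> suminf G - sum G {..<N}) L"
    using lim g by (intro tendsto_intros)
  then have 1: "\<forall>\<^sub>F t in L. suminf (g t) - sum (g t) {..<N} < e / 4"
    using N by (rule order_tendstoD(2))
  have "((\<lambda>t. sum (f t) {..<N}) \<longlongrightarrow> sum F {..<N}) L"
    using f by (intro tendsto_intros)
  then have 2: "\<forall>\<^sub>F t in L. dist (sum (f t) {..<N}) (sum F {..<N}) < e / 4"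
    using e by (intro tendstoD) auto
  show "\<forall>\<^sub>F t in L. dist (suminf (f t)) (suminf F) < e"
    using 1 2 ev
  proof eventually_elim
    case (elim t)
    have "norm (suminf (f t) - sum (f t) {..<N}) < e / 4"
      using norm_suminf_diff_le[of "f t" "g t" N] elim by force
    moreover have "norm (suminf F - sum F {..<N}) < e / 4"
      using norm_suminf_diff_le[OF F G, of N] N by simp
    moreover have "suminf (f t) - suminf F = (suminf (f t) - sum (f t) {..<N})
        + (sum (f t) {..<N} - sum F {..<N}) - (suminf F - sum F {..<N})" by simp
    then have "norm (suminf (f t) - suminf F) \<le> norm (suminf (f t) - sum (f t) {..<N})
        + norm (sum (f t) {..<N} - sum F {..<N}) + norm (suminf F - sum F {..<N})"
      by (metis (no_types) norm_triangle_ineq4 norm_triangle_ineq add_right_mono order_trans)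
    ultimately show ?case
      using elim(2) e unfolding dist_norm by linarith
  qed
qed

text \<open>The Christoffel-Darboux formula sees only the chord between two points, hence the sine
  of the angle difference. Continuity keeps that difference within \<open>pi / 2\<close>, where
  \<open>arcsin\<close> inverts the sine, and \<open>arcsin\<close> has derivative 1 at 0.\<close>

lemma has_real_derivative_angle:
  fixes \<theta> :: "real \<Rightarrow> real"
  assumes cont: "(\<theta> \<longlongrightarrow> \<theta> s) (at s within J)"
    and lim: "((\<lambda>t. sin (\<theta> t - \<theta> s) / (t - s)) \<longlongrightarrow> d) (at s within J)"
  shows "(\<theta> has_real_derivative d) (at s within J)"
proof -
  have 1: "((\<lambda>t. sin (\<theta> t - \<theta> s)) has_real_derivative d) (at s within J)"
    using lim by (simp add: has_field_derivative_iff)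
  have "((\<lambda>t. arcsin (sin (\<theta> t - \<theta> s))) has_real_derivative
      inverse (sqrt (1 - (sin (\<theta> s - \<theta> s))\<^sup>2)) * d) (at s within J)"
    by (rule DERIV_chain2[OF DERIV_arcsin 1]) simp_all
  then have 2: "((\<lambda>t. (arcsin (sin (\<theta> t - \<theta> s))) / (t - s)) \<longlongrightarrow> d) (at s within J)"
    by (simp add: has_field_derivative_iff)
  have "\<forall>\<^sub>F t in at s within J. dist (\<theta> t) (\<theta> s) < pi / 2"
    using cont by (rule tendstoD) simp
  then have "\<forall>\<^sub>F t in at s within J.
      arcsin (sin (\<theta> t - \<theta> s)) / (t - s) = (\<theta> t - \<theta> s) / (t - s)"
    by eventually_elim (subst arcsin_sin; force simp: dist_real_def abs_if split: if_splits)
  then show ?thesis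
    unfolding has_field_derivative_iff by (rule Lim_transform_eventually[OF 2])
qed

lemma tendsto_cmv_block:
  assumes "(a \<longlongrightarrow> a') L" "(\<rho> \<longlongrightarrow> \<rho>') L" "(p \<longlongrightarrow> p') L" "(q \<longlongrightarrow> q') L"
  shows "((\<lambda>t. cmv_block (a t) (\<rho> t) n (p t) (q t) w u v) \<longlongrightarrow> cmv_block a' \<rho>' n p' q' w u v) L"
  using assms by (cases "even n") (auto simp: cmv_block_def block_form_def intro!: tendsto_intros)

text \<open>Divide the mixed Christoffel--Darboux formula by \<open>t - s\<close>; dominated convergence is available
  because the squared norms of the eigenvectors \<open>y t\<close> converge.\<close>

lemma has_real_derivative_eigenvalue_angle:
  fixes y :: "real \<Rightarrow> nat \<Rightarrow> complex" and a a' :: "nat \<Rightarrow> real \<Rightarrow> complex"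
    and \<rho> \<rho>' :: "nat \<Rightarrow> real \<Rightarrow> real" and \<theta> :: "real \<Rightarrow> real" and e :: "nat \<Rightarrow> real"
  assumes s: "s \<in> J" and y0: "\<And>t. t \<in> J \<Longrightarrow> y t 0 = 1"
    and step: "\<And>t n. t \<in> J \<Longrightarrow> cmv_step (a (Suc n) t) (\<rho> (Suc n) t) (cis (\<theta> t)) n (y t n) (y t (Suc n))"
    and cont: "(\<theta> \<longlongrightarrow> \<theta> s) (at s within J)"
    and lip: "\<forall>\<^sub>F t in at s within J. \<forall>n. cmod (a (Suc n) t - a (Suc n) s) \<le> C * \<bar>t - s\<bar>
        \<and> \<bar>\<rho> (Suc n) t - \<rho> (Suc n) s\<bar> \<le> C * \<bar>t - s\<bar>"
    and a': "\<And>n. ((\<lambda>t. (a (Suc n) t - a (Suc n) s) / of_real (t - s)) \<longlongrightarrow> a' (Suc n) s) (at s within J)"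
    and \<rho>': "\<And>n. ((\<lambda>t. (\<rho> (Suc n) t - \<rho> (Suc n) s) / (t - s)) \<longlongrightarrow> \<rho>' (Suc n) s) (at s within J)"
    and bound: "\<And>n. cmod (a' (Suc n) s) \<le> C" "\<And>n. \<bar>\<rho>' (Suc n) s\<bar> \<le> C"
    and ylim: "\<And>n. ((\<lambda>t. y t n) \<longlongrightarrow> y s n) (at s within J)"
    and summ: "\<And>t. t \<in> J \<Longrightarrow> summable (\<lambda>n. (cmod (y t n))\<^sup>2)"
    and Klim: "((\<lambda>t. \<Sum>n. (cmod (y t n))\<^sup>2) \<longlongrightarrow> (\<Sum>n. (cmod (y s n))\<^sup>2)) (at s within J)"
    and e: "\<And>n. cmv_block (a' (Suc n) s) (\<rho>' (Suc n) s) n (y s n) (y s (Suc n))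
        (cis (\<theta> s)) (y s n) (y s (Suc n)) = \<i> * of_real (e n)"
  shows "summable e"
    and "(\<theta> has_real_derivative (suminf e / (\<Sum>n. (cmod (y s n))\<^sup>2))) (at s within J)"
proof -
  let ?F = "at s within J"
  define Q where "Q t n = (cmod (y t n))\<^sup>2 + (cmod (y t (Suc n)))\<^sup>2" for t n
  define K where "K t = (\<Sum>n. (cmod (y t n))\<^sup>2)" for t
  define E where "E n = \<i> * complex_of_real (e n)" for n
  define D where "D t n = cmv_block (a (Suc n) t - a (Suc n) s) (\<rho> (Suc n) t - \<rho> (Suc n) s) n
      (y t n) (y t (Suc n)) (cis (\<theta> s)) (y s n) (y s (Suc n))" for t n
  define d where "d t n = D t n / of_real (t - s)" for t n
  define A where "A t n = y t n * cnj (y s n)" for t n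
  \<comment> \<open>\<open>Q t\<close> counts every coordinate twice except coordinate 0, whose
    value is 1; hence \<open>2 * K t - 1\<close>.\<close>
  have sQ: "summable (Q t)" and suminfQ: "suminf (Q t) = 2 * K t - 1" if "t \<in> J" for t
  proof -
    have S: "summable (\<lambda>n. (cmod (y t (Suc n)))\<^sup>2)"
      using summ[OF that] by (simp add: summable_Suc_iff[of "\<lambda>n. (cmod (y t n))\<^sup>2"])
    show "summable (Q t)" unfolding Q_def by (intro summable_add summ that S)
    have "suminf (Q t) = K t + (\<Sum>n. (cmod (y t (Suc n)))\<^sup>2)"
      unfolding Q_def K_def by (rule suminf_add[symmetric]) (intro summ that S)+
    then show "suminf (Q t) = 2 * K t - 1"
      using suminf_split_head[OF summ[OF that]] y0[OF that] by (simp add: K_def)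
  qed
  have Kpos: "K t > 0" if "t \<in> J" for t
  proof -
    have "(cmod (y t 0))\<^sup>2 \<le> K t"
      unfolding K_def using sum_le_suminf[OF summ[OF that], of "{0}"] by simp
    then show ?thesis using y0[OF that] by simp
  qed
  have y2: "((\<lambda>t. (cmod (y t n))\<^sup>2) \<longlongrightarrow> (cmod (y s n))\<^sup>2) ?F" for n
    by (intro tendsto_intros ylim)
  have Qlim: "((\<lambda>t. Q t n) \<longlongrightarrow> Q s n) ?F" for n
    unfolding Q_def by (intro tendsto_intros y2)
  have inJ: "\<forall>\<^sub>F t in ?F. t \<in> J \<and> t \<noteq> s"
    by (simp add: eventually_at_filter)
  have "((\<lambda>t. 2 * K t - 1) \<longlongrightarrow> 2 * K s - 1) ?F"
    using Klim unfolding K_def by (intro tendsto_intros)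
  then have Qslim: "((\<lambda>t. suminf (Q t)) \<longlongrightarrow> suminf (Q s)) ?F"
    unfolding suminfQ[OF s]
    by (rule Lim_transform_eventually) (use inJ in eventually_elim, simp add: suminfQ)
  define g where "g t n = C * (Q t n + Q s n)" for t n
  have sg: "summable (g t)" and suminfg: "suminf (g t) = C * (suminf (Q t) + suminf (Q s))"
    if "t \<in> J" for t
    unfolding g_def using sQ[OF that] sQ[OF s]
    by (auto intro!: summable_mult summable_add simp: suminf_add summable_add suminf_mult)
  have block_div: "cmv_block x u n p q w p' q' / of_real c
      = cmv_block (x / of_real c) (u / c) n p q w p' q'" for x u n p q w p' q' c
    by (cases "c = 0") (auto simp: cmv_block_def block_form_def field_simps)
  have dE: "((\<lambda>t. d t n) \<longlongrightarrow> E n) ?F" for n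
  proof -
    have "((\<lambda>t. cmv_block ((a (Suc n) t - a (Suc n) s) / of_real (t - s))
        ((\<rho> (Suc n) t - \<rho> (Suc n) s) / (t - s)) n
        (y t n) (y t (Suc n)) (cis (\<theta> s)) (y s n) (y s (Suc n))) \<longlongrightarrow>
        cmv_block (a' (Suc n) s) (\<rho>' (Suc n) s) n (y s n) (y s (Suc n))
        (cis (\<theta> s)) (y s n) (y s (Suc n))) ?F"
      by (intro tendsto_cmv_block ylim a' \<rho>')
    then show ?thesis unfolding e E_def d_def D_def block_div .
  qed
  have dbound: "\<forall>\<^sub>F t in ?F. (\<forall>n. norm (d t n) \<le> g t n) \<and> summable (g t)"
    using lip inJ
  proof eventually_elim
    case (elim t)
    have "norm (d t n) \<le> g t n" for n
    proof -
      have "norm (D t n) \<le> C * \<bar>t - s\<bar> * (Q t n + Q s n)"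
        unfolding D_def Q_def using elim norm_cmv_block_le[of "a (Suc n) t - a (Suc n) s" "C * \<bar>t - s\<bar>"
          "\<rho> (Suc n) t - \<rho> (Suc n) s" "cis (\<theta> s)"]
        by (smt (verit, ccfv_SIG) norm_cis)
      then show ?thesis using elim
        by (simp add: d_def g_def norm_divide divide_simps mult_ac flip: of_real_diff)
    qed
    then show ?case using elim sg by auto
  qed
  have Ebound: "norm (E n) \<le> g s n" for n
    unfolding E_def e[symmetric] g_def Q_def
    using norm_cmv_block_le[OF bound(1,2), where w = "cis (\<theta> s)" and n = n and p = "y s n" and q = "y s (Suc n)" and p' = "y s n" and q' = "y s (Suc n)"]
    by (simp add: algebra_simps)
  have E_summ: "summable E"
    using Ebound sg[OF s] by (rule summable_comparison_test'[of "g s" 0, rotated])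
  then have "summable (\<lambda>n. Im (E n))" by (rule summable_Im)
  then show se: "summable e" by (simp add: E_def)
  have suminfE: "suminf E = \<i> * of_real (suminf e)"
    unfolding E_def using se by (simp add: suminf_mult suminf_of_real summable_of_real)
  have lim1: "((\<lambda>t. suminf (d t)) \<longlongrightarrow> suminf E) ?F"
  proof (rule tendsto_suminf_dominated[OF dE _ dbound Ebound sg[OF s]])
    show "((\<lambda>t. g t n) \<longlongrightarrow> g s n) ?F" for n
      unfolding g_def by (intro tendsto_intros Qlim)
    have "((\<lambda>t. C * (suminf (Q t) + suminf (Q s))) \<longlongrightarrow> suminf (g s)) ?F"
      unfolding suminfg[OF s] by (intro tendsto_intros Qslim)
    then show "((\<lambda>t. suminf (g t)) \<longlongrightarrow> suminf (g s)) ?F"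
      by (rule Lim_transform_eventually) (use inJ in eventually_elim, simp add: suminfg)
  qed
  have Abound: "norm (A t n) \<le> (cmod (y t n))\<^sup>2 + (cmod (y s n))\<^sup>2" for t n
  proof -
    have "0 \<le> cmod (y t n) * cmod (y s n)" by simp
    moreover have "2 * (cmod (y t n) * cmod (y s n)) \<le> (cmod (y t n))\<^sup>2 + (cmod (y s n))\<^sup>2"
      using sum_squares_bound[of "cmod (y t n)" "cmod (y s n)"] by (simp only: mult.assoc)
    ultimately show ?thesis unfolding A_def norm_mult complex_mod_cnj by linarith
  qed
  have sA: "summable (A t)" if "t \<in> J" for t
    using Abound summable_add[OF summ[OF that] summ[OF s]]
    by (rule summable_comparison_test'[of _ 0, rotated])
  have As: "suminf (A s) = of_real (K s)"
  proof -
    have "A s n = of_real ((cmod (y s n))\<^sup>2)" for n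
      unfolding A_def by (rule complex_norm_square[symmetric])
    then have "A s = (\<lambda>n. of_real ((cmod (y s n))\<^sup>2))" ..
    then show ?thesis by (simp only: K_def suminf_of_real[OF summ[OF s]])
  qed
  have lim2: "((\<lambda>t. suminf (A t)) \<longlongrightarrow> suminf (A s)) ?F"
  proof (rule tendsto_suminf_dominated)
    show "((\<lambda>t. A t n) \<longlongrightarrow> A s n) ?F" for n
      unfolding A_def by (intro tendsto_intros ylim)
    show "((\<lambda>t. (cmod (y t n))\<^sup>2 + (cmod (y s n))\<^sup>2) \<longlongrightarrow> (cmod (y s n))\<^sup>2 + (cmod (y s n))\<^sup>2) ?F"
      for n by (intro tendsto_intros y2)
    show "\<forall>\<^sub>F t in ?F. (\<forall>n. cmod (A t n) \<le> (cmod (y t n))\<^sup>2 + (cmod (y s n))\<^sup>2)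
        \<and> summable (\<lambda>n. (cmod (y t n))\<^sup>2 + (cmod (y s n))\<^sup>2)"
      using inJ by eventually_elim (auto intro!: Abound summable_add summ s)
    show "norm (A s n) \<le> (cmod (y s n))\<^sup>2 + (cmod (y s n))\<^sup>2" for n by (rule Abound)
    show "summable (\<lambda>n. (cmod (y s n))\<^sup>2 + (cmod (y s n))\<^sup>2)"
      by (intro summable_add summ s)
    have "((\<lambda>t. K t + K s) \<longlongrightarrow> K s + K s) ?F"
      using Klim unfolding K_def by (intro tendsto_intros)
    then have "((\<lambda>t. K t + K s) \<longlongrightarrow> (\<Sum>n. (cmod (y s n))\<^sup>2 + (cmod (y s n))\<^sup>2)) ?F"
      unfolding K_def by (simp add: suminf_add summ[OF s])
    then show "((\<lambda>t. \<Sum>n. (cmod (y t n))\<^sup>2 + (cmod (y s n))\<^sup>2)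
        \<longlongrightarrow> (\<Sum>n. (cmod (y s n))\<^sup>2 + (cmod (y s n))\<^sup>2)) ?F"
      by (rule Lim_transform_eventually)
        (use inJ in eventually_elim, simp add: K_def suminf_add[symmetric] summ s)
  qed
  have key: "suminf (d t) = (cis (\<theta> t - \<theta> s) - 1) / of_real (t - s) * suminf (A t)" 
    if t: "t \<in> J" "t \<noteq> s" for t
  proof -
    define c where "c = cis (\<theta> t) * cnj (cis (\<theta> s))"
    have c: "c = cis (\<theta> t - \<theta> s)" by (simp add: c_def cis_cnj cis_mult)
    \<comment> \<open>The boundary term. It tends to 0 because the products \<open>A t\<close> are
      summable.\<close>
    define B where "B N = (if even N then cnj (A t N) - A t N else c * A t N - cnj (A t N))" for N
    have CD: "(\<Sum>n<N. D t n) = (c - 1) * (\<Sum>n<N. A t n) + B N" for N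
      unfolding D_def A_def B_def c_def
      using mixed_christoffel_darboux[of "y t" "y s" "\<lambda>n. a n t" "\<lambda>n. \<rho> n t" "cis (\<theta> t)"
          "\<lambda>n. a n s" "\<lambda>n. \<rho> n s" "cis (\<theta> s)" N] y0 step t s by auto
    have "norm (B N) \<le> 2 * norm (A t N)" for N
    proof (cases "even N")
      case True then show ?thesis
        using norm_triangle_ineq4[of "cnj (A t N)" "A t N"] by (simp add: B_def)
    next
      case False then show ?thesis
        using norm_triangle_ineq4[of "c * A t N" "cnj (A t N)"] by (simp add: B_def c norm_mult)
    qed
    moreover have "(\<lambda>N. 2 * norm (A t N)) \<longlonglongrightarrow> 2 * norm (0 :: complex)"
      using summable_LIMSEQ_zero[OF sA[OF t(1)]] by (intro tendsto_intros)
    ultimately have "B \<longlonglongrightarrow> 0" by (intro Lim_null_comparison[of B "\<lambda>N. 2 * norm (A t N)"]) auto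
    then have "(\<lambda>N. (c - 1) * (\<Sum>n<N. A t n) + B N) \<longlonglongrightarrow> (c - 1) * suminf (A t) + 0"
      using summable_LIMSEQ[OF sA[OF t(1)]] by (intro tendsto_intros)
    then have "D t sums ((c - 1) * suminf (A t))"
      unfolding sums_def CD by simp
    then have "d t sums ((c - 1) * suminf (A t) / of_real (t - s))"
      unfolding d_def by (rule sums_divide)
    then show ?thesis by (simp add: sums_iff c)
  qed
  \<comment> \<open>The sums of \<open>A t\<close> converge to \<open>K s > 0\<close>, so the
    formula can be solved for the chord quotient. The imaginary part of that quotient is the sine
    quotient.\<close>
  have "((\<lambda>t. suminf (d t) / suminf (A t)) \<longlongrightarrow> suminf E / suminf (A s)) ?F"
    using Kpos[OF s] by (intro tendsto_divide lim1 lim2) (simp add: As)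
  moreover have "\<forall>\<^sub>F t in ?F. suminf (A t) \<noteq> 0"
    using Kpos[OF s] by (intro tendsto_imp_eventually_ne[OF lim2]) (simp add: As)
  then have "\<forall>\<^sub>F t in ?F.
      suminf (d t) / suminf (A t) = (cis (\<theta> t - \<theta> s) - 1) / of_real (t - s)"
    using inJ by eventually_elim (simp add: key)
  ultimately have "((\<lambda>t. (cis (\<theta> t - \<theta> s) - 1) / of_real (t - s)) \<longlongrightarrow> suminf E / suminf (A s)) ?F"
    by (rule Lim_transform_eventually)
  then have "((\<lambda>t. Im ((cis (\<theta> t - \<theta> s) - 1) / of_real (t - s))) \<longlongrightarrow> Im (suminf E / suminf (A s))) ?F"
    by (rule tendsto_Im)
  then have "((\<lambda>t. sin (\<theta> t - \<theta> s) / (t - s)) \<longlongrightarrow> suminf e / K s) ?F"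
    by (simp add: As suminfE Im_divide_of_real)
  then show "(\<theta> has_real_derivative (suminf e / (\<Sum>n. (cmod (y s n))\<^sup>2))) (at s within J)"
    unfolding K_def[symmetric] by (rule has_real_derivative_angle[OF cont])
qed

text \<open>The origin of the terms Gamma and Delta. The two block entries are the derivatives of
  \<open>a\<close> and of \<open>\<rho>\<close> when \<open>r\<close> and the angle of
  \<open>w\<close> move with speeds \<open>r'\<close> and \<open>\<alpha>'\<close>. The second
  coordinate is eliminated by the first row of the step; the coefficient of \<open>r'\<close> is
  then Gamma and that of \<open>\<alpha>'\<close> is Delta.\<close>

lemma cmv_block_derivative:
  fixes r r' \<alpha>' \<rho> :: real
  assumes z: "cmod z = 1" and s: "cmv_step a \<rho> z n (cmv z b n) (cmv z b (Suc n))"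
    and a: "a = of_real r * w" "cmod w = 1" "\<bar>r\<bar> < 1" and \<rho>: "\<rho> = sqrt (1 - r\<^sup>2)"
  shows "cmv_block ((of_real r' + \<i> * of_real (r * \<alpha>')) * w) (- r * r' / \<rho>) n
      (cmv z b n) (cmv z b (Suc n)) z (cmv z b n) (cmv z b (Suc n))
    = \<i> * of_real (r' * (2 / \<rho>\<^sup>2 * Im (cnj w * z powi (2 - int (Suc n)) * (b n)\<^sup>2))
         + \<alpha>' * ((cmod (b n))\<^sup>2 - (cmod (b (Suc n)))\<^sup>2))"
proof -
  define G where "G = cnj (z powi (2 - int (Suc n)) * (b n)\<^sup>2)"
  define h where "h = (cmod (b n))\<^sup>2"
  define a' where "a' = (of_real r' + \<i> * of_real (r * \<alpha>')) * w"
  define p where "p = cmv z b n" define q where "q = cmv z b (Suc n)"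
  have zz: "z * cnj z = 1" by (rule unimodular_mult_cnj[OF z])
  have zinv: "inverse z = cnj z" using zz by (metis inverse_unique)
  have r2: "r\<^sup>2 < 1" using a(3) by (simp add: abs_square_less_1)
  have \<rho>0: "\<rho> > 0" using r2 by (simp add: \<rho>)
  have \<rho>2: "\<rho>\<^sup>2 = 1 - r\<^sup>2" using r2 by (simp add: \<rho>)
  have pp: "p * cnj p = of_real h" "(cmod q)\<^sup>2 = (cmod (b (Suc n)))\<^sup>2"
    using z by (simp_all add: p_def q_def h_def norm_cmv flip: complex_norm_square)
  define R :: complex where "R = of_real \<rho>"
  have R0: "R \<noteq> 0" using \<rho>0 by (simp add: R_def)
  \<comment> \<open>\<open>u\<close>, \<open>v\<close> and \<open>c\<close> absorb the parity: both
    cases lead to the same relation \<open>R * v = c * cnj u + a * u\<close>.\<close>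
  define u where "u = (if even n then cnj p else p)"
  define v where "v = (if even n then cnj q else q)"
  define c where "c = (if even n then z else 1)"
  have cc: "c * cnj c = 1" using zz by (simp add: c_def)
  \<comment> \<open>The exponent in Gamma is exactly the one that turns the squared polynomial value
    into the square of a CMV coordinate, up to \<open>c\<close> and a conjugation.\<close>
  have G: "G = cnj c * u\<^sup>2"
  proof (cases "even n")
    case True
    then obtain k where n: "n = 2 * k" by blast
    have "z powi (2 - int (Suc n)) = z * cnj z ^ k * cnj z ^ k"
    proof -
      have "2 - int (Suc n) = 1 - int (2 * k)" using n by simp
      also have "z powi \<dots> = z powi 1 / z powi (int (2 * k))"
        by (rule power_int_diff) (use z in auto)
      also have "\<dots> = z * inverse z ^ (2 * k)"
        unfolding power_int_of_nat by (simp add: divide_inverse power_inverse)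
      finally show ?thesis by (simp add: zinv mult_2 power_add)
    qed
    then show ?thesis using True by (simp add: G_def n c_def u_def p_def cmv_def power2_eq_square algebra_simps)
  next
    case False
    then obtain k where n: "n = 2 * k + 1" using oddE by blast
    have "z powi (2 - int (Suc n)) = cnj z ^ k * cnj z ^ k"
    proof -
      have "2 - int (Suc n) = - int (2 * k)" using n by simp
      also have "z powi \<dots> = inverse z ^ (2 * k)"
        unfolding power_int_minus power_int_of_nat by (simp add: power_inverse)
      finally show ?thesis by (simp add: zinv mult_2 power_add)
    qed
    then show ?thesis using False by (simp add: G_def n c_def u_def p_def cmv_def power2_eq_square algebra_simps)
  qed
  have uu: "u * cnj u = of_real h" using pp by (auto simp: u_def mult.commute)
  have vv: "(cmod v)\<^sup>2 = (cmod (b (Suc n)))\<^sup>2" using pp by (simp add: v_def)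
  have Rv: "R * v = c * cnj u + a * u"
    using s by (auto simp: cmv_step_def R_def v_def u_def c_def p_def q_def split: if_splits)
  have cG: "cnj G = c * (cnj u)\<^sup>2" by (simp add: G)
  have Ruv: "R * (cnj c * u * v) = of_real h + a * G"
  proof -
    have "R * (cnj c * u * v) = cnj c * u * (R * v)" by simp
    also have "\<dots> = (c * cnj c) * (u * cnj u) + a * (cnj c * u\<^sup>2)"
      unfolding Rv by (simp add: algebra_simps power2_eq_square)
    finally show ?thesis by (simp add: uu cc G)
  qed
  have Rvv: "R\<^sup>2 * (cnj c * v\<^sup>2) = cnj G + 2 * a * of_real h + a\<^sup>2 * G"
  proof -
    have "R\<^sup>2 * (cnj c * v\<^sup>2) = cnj c * (R * v)\<^sup>2" by (simp add: power_mult_distrib)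
    also have "\<dots> = (c * cnj c) * (c * (cnj u)\<^sup>2) + 2 * a * (c * cnj c) * (u * cnj u) + a\<^sup>2 * (cnj c * u\<^sup>2)"
      unfolding Rv by (simp add: algebra_simps power2_eq_square)
    finally show ?thesis by (simp add: uu cc G)
  qed
  \<comment> \<open>\<open>X\<close> is quadratic in \<open>u\<close> and \<open>v\<close>.
    Multiplication by \<open>R\<^sup>2\<close> lets every \<open>v\<close> appear as
    \<open>R * v\<close>, so that only \<open>G\<close> and \<open>h\<close> remain.\<close>
  define X where "X = cmv_block a' (- r * r' / \<rho>) n p q z p q"
  have X: "X = - a' * G + 2 * of_real (- r * r' / \<rho>) * (cnj c * u * v) + cnj a' * (cnj c * v\<^sup>2)"
    by (auto simp: X_def cmv_block_def block_form_def G u_def v_def c_def algebra_simps power2_eq_square)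
  have "R\<^sup>2 * X = - a' * R\<^sup>2 * G + 2 * of_real (- r * r') * (R * (cnj c * u * v)) + cnj a' * (R\<^sup>2 * (cnj c * v\<^sup>2))"
    using R0 unfolding X by (simp add: R_def field_simps power2_eq_square)
  also have "\<dots> = - a' * R\<^sup>2 * G - 2 * of_real (r * r') * (of_real h + a * G)
      + cnj a' * (cnj G + 2 * a * of_real h + a\<^sup>2 * G)"
    unfolding Ruv Rvv by simp
  also have "R\<^sup>2 = 1 - (of_real r)\<^sup>2" by (simp add: R_def \<rho>2 flip: of_real_power)
  finally have RX: "R\<^sup>2 * X = - a' * (1 - (of_real r)\<^sup>2) * G - 2 * of_real (r * r') * (of_real h + a * G)
      + cnj a' * (cnj G + 2 * a * of_real h + a\<^sup>2 * G)" 
    by (simp add: R_def \<rho>2 flip: of_real_power)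
  define g where "g = w * G"
  have ww: "w * cnj w = 1" by (rule unimodular_mult_cnj[OF a(2)])
  have "R\<^sup>2 * X = of_real r' * (cnj g - g) - \<i> * of_real (r * \<alpha>') * (g + cnj g + 2 * of_real (r * h))"
  proof -
    have e1: "a' * G = (of_real r' + \<i> * of_real (r * \<alpha>')) * g" by (simp add: a'_def g_def)
    have e2: "a * G = of_real r * g" by (simp add: a g_def)
    have ca': "cnj a' = (of_real r' - \<i> * of_real (r * \<alpha>')) * cnj w" by (simp add: a'_def algebra_simps)
    have e3: "cnj a' * cnj G = (of_real r' - \<i> * of_real (r * \<alpha>')) * cnj g" by (simp add: ca' g_def)
    have e4: "cnj a' * a = (of_real r' - \<i> * of_real (r * \<alpha>')) * of_real r * (w * cnj w)" by (simp add: ca' a)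
    have "R\<^sup>2 * X = - (a' * G) * (1 - (of_real r)\<^sup>2) - 2 * of_real (r * r') * (of_real h + a * G)
      + (cnj a' * cnj G + 2 * (cnj a' * a) * of_real h + (cnj a' * a) * (a * G))"
      unfolding RX by (simp add: algebra_simps power2_eq_square)
    then show ?thesis unfolding e1 e2 e3 e4 ww by (simp add: algebra_simps power2_eq_square)
  qed
  also have "cnj g - g = - 2 * \<i> * of_real (Im g)"
    by (auto simp: complex_eq_iff)
  also have "g + cnj g = 2 * of_real (Re g)"
    by (auto simp: complex_eq_iff)
  finally have RX2: "R\<^sup>2 * X = \<i> * of_real (r' * (- 2 * Im g) - \<alpha>' * (2 * r * Re g + 2 * r\<^sup>2 * h))"
    by (simp add: algebra_simps power2_eq_square)
  \<comment> \<open>Squared moduli in \<open>R * v = c * cnj u + a * u\<close> give the norm of the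
    next coordinate; its cross term is the one that multiplies \<open>\<alpha>'\<close> in
    \<open>RX2\<close>.\<close>
  have \<Delta>: "\<rho>\<^sup>2 * (h - (cmod (b (Suc n)))\<^sup>2) = - (2 * r * Re g + 2 * r\<^sup>2 * h)"
  proof -
    have "of_real (\<rho>\<^sup>2 * (cmod v)\<^sup>2) = of_real (\<rho>\<^sup>2) * (v * cnj v)"
      by (simp only: of_real_mult complex_norm_square)
    also have "\<dots> = (R * v) * cnj (R * v)"
      by (simp add: R_def power2_eq_square)
    also have "\<dots> = (c * cnj c) * (u * cnj u) + (a * cnj a) * (u * cnj u) + (a * (cnj c * u\<^sup>2) + cnj (a * (cnj c * u\<^sup>2)))"
      unfolding Rv by (simp add: algebra_simps power2_eq_square)
    also have "\<dots> = of_real h + of_real (r\<^sup>2) * (w * cnj w) * of_real h + (of_real r * g + cnj (of_real r * g))"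
      unfolding cc uu G[symmetric] g_def a by (simp add: algebra_simps power2_eq_square)
    also have "of_real r * g + cnj (of_real r * g) = of_real (2 * r * Re g)"
      by (auto simp: complex_eq_iff)
    finally have "complex_of_real (\<rho>\<^sup>2 * (cmod v)\<^sup>2) = of_real (h + r\<^sup>2 * h + 2 * r * Re g)"
      by (simp add: ww)
    then have "\<rho>\<^sup>2 * (cmod v)\<^sup>2 = h + r\<^sup>2 * h + 2 * r * Re g" by (simp only: of_real_eq_iff)
    moreover have "\<rho>\<^sup>2 * h = h - r\<^sup>2 * h" by (simp add: \<rho>2 algebra_simps)
    ultimately show ?thesis by (simp only: vv right_diff_distrib)
  qed
  have "R\<^sup>2 * X = R\<^sup>2 * (\<i> * of_real (r' * (2 / \<rho>\<^sup>2 * (- Im g)) + \<alpha>' * (h - (cmod (b (Suc n)))\<^sup>2)))"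
  proof -
    have "\<rho>\<^sup>2 * (r' * (2 / \<rho>\<^sup>2 * (- Im g)) + \<alpha>' * (h - (cmod (b (Suc n)))\<^sup>2))
      = r' * (- 2 * Im g) + \<alpha>' * (\<rho>\<^sup>2 * (h - (cmod (b (Suc n)))\<^sup>2))"
      using \<rho>0 by (simp add: field_simps)
    then have "\<rho>\<^sup>2 * (r' * (2 / \<rho>\<^sup>2 * (- Im g)) + \<alpha>' * (h - (cmod (b (Suc n)))\<^sup>2))
      = r' * (- 2 * Im g) - \<alpha>' * (2 * r * Re g + 2 * r\<^sup>2 * h)" 
      unfolding \<Delta> by (simp only: mult_minus_right add_uminus_conv_diff)
    then have "R\<^sup>2 * X = \<i> * of_real (\<rho>\<^sup>2 * (r' * (2 / \<rho>\<^sup>2 * (- Im g)) + \<alpha>' * (h - (cmod (b (Suc n)))\<^sup>2)))"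
      by (simp only: RX2)
    then show ?thesis by (simp only: R_def of_real_mult of_real_power mult.left_commute mult.assoc)
  qed
  then have "X = \<i> * of_real (r' * (2 / \<rho>\<^sup>2 * (- Im g)) + \<alpha>' * (h - (cmod (b (Suc n)))\<^sup>2))"
    using R0 by simp
  moreover have "- Im g = Im (cnj w * z powi (2 - int (Suc n)) * (b n)\<^sup>2)"
  proof -
    have "cnj g = cnj w * z powi (2 - int (Suc n)) * (b n)\<^sup>2"
      by (simp add: g_def G_def algebra_simps)
    then show ?thesis by (metis cnj.simps(2))
  qed
  ultimately show ?thesis by (simp add: X_def a'_def p_def q_def h_def)
qed

section \<open>Measures on the circle and orthonormal polynomials\<close>

lemma circle_measureD:
  assumes "circle_measure M"
  shows "prob_space M" "sets M = sets borel" "space M = UNIV" "AE z in M. cmod z = 1"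
proof -
  show p: "prob_space M" and s: "sets M = sets borel"
    using assms by (auto simp: circle_measure_def)
  show "space M = UNIV" using sets_eq_imp_space_eq[OF s] by simp
  interpret prob_space M by (rule p)
  have "measure M (sphere 0 1) = 1"
    using assms by (simp add: circle_measure_def measure_def)
  then have "AE z in M. z \<in> sphere 0 1" by (rule AE_prob_1)
  then show "AE z in M. cmod z = 1" by simp
qed

text \<open>The complement of the support is the union of all open null sets, and by second
  countability countably many of them suffice.\<close>

lemma AE_measure_support:
  fixes M :: "'a::second_countable_topology measure"
  assumes sets: "sets M = sets borel"
  shows "AE x in M. x \<in> measure_support M"
proof -
  define F where "F = {U. open U \<and> emeasure M U = 0}"
  obtain F' where F': "F' \<subseteq> F" "countable F'" "\<Union>F' = \<Union>F"
    using Lindelof[of F] unfolding F_def by auto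
  have "(\<Union>U\<in>F'. U) \<in> null_sets M"
    using F'(1,2) by (intro null_sets_UN') (auto simp: F_def null_sets_def sets)
  then have "\<Union>F \<in> null_sets M" using F'(3) by simp
  moreover have "\<Union>F = - measure_support M"
    by (auto simp: F_def measure_support_def)
  ultimately have "- measure_support M \<in> null_sets M" by simp
  from AE_not_in[OF this] show ?thesis by simp
qed

lemma measure_support_subset_circle:
  assumes "circle_measure M"
  shows "measure_support M \<subseteq> sphere 0 1"
proof
  fix x assume x: "x \<in> measure_support M"
  show "x \<in> sphere 0 1"
  proof (rule ccontr)
    assume "x \<notin> sphere 0 1"
    moreover have "open (- sphere 0 1 :: complex set)"
      using closed_sphere by (simp add: open_closed)
    ultimately have "emeasure M (- sphere 0 1) > 0"
      using x unfolding measure_support_def by blast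
    moreover have "AE z in M. \<not> z \<in> - sphere 0 1"
      using circle_measureD(4)[OF assms] by simp
    then have "emeasure M {z \<in> space M. z \<in> - sphere 0 1} = 0"
      by (rule emeasure_eq_0_AE)
    then have "emeasure M (- sphere 0 1) = 0"
      using circle_measureD(3)[OF assms] by (simp only: UNIV_I simp_thms Collect_mem_eq)
    ultimately show False by simp
  qed
qed

lemma mass_points_subset_support:
  assumes "finite_measure M" "sets M = sets borel"
  shows "mass_points M \<subseteq> measure_support M"
proof
  fix x assume "x \<in> mass_points M"
  then have "emeasure M {x} > 0"
    by (simp add: mass_points_def measure_def enn2real_positive_iff)
  moreover have "emeasure M {x} \<le> emeasure M U" if "open U" "x \<in> U" for U
    using that assms(2) by (intro emeasure_mono) auto
  ultimately show "x \<in> measure_support M"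
    unfolding measure_support_def using less_le_trans by blast
qed

lemma integrable_circle:
  fixes f :: "complex \<Rightarrow> 'b::{banach, second_countable_topology}"
  assumes M: "circle_measure M" and f: "continuous_on UNIV f"
  shows "integrable M f"
proof -
  interpret prob_space M by (rule circle_measureD[OF M])
  have "bounded (f ` sphere 0 1)"
    by (intro compact_imp_bounded compact_continuous_image continuous_on_subset[OF f]) auto
  then obtain B where B: "\<And>z. z \<in> sphere 0 1 \<Longrightarrow> norm (f z) \<le> B"
    unfolding bounded_iff by blast
  have "f \<in> borel_measurable M"
    unfolding measurable_cong_sets[OF circle_measureD(2)[OF M] refl]
    by (rule borel_measurable_continuous_onI[OF f])
  moreover have "AE z in M. norm (f z) \<le> B"
    using circle_measureD(4)[OF M] by eventually_elim (simp add: B)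
  ultimately show ?thesis by (intro integrable_const_bound)
qed

lemma integral_cong_circle:
  fixes f g :: "complex \<Rightarrow> 'b::{banach, second_countable_topology}"
  assumes M: "circle_measure M" and "continuous_on UNIV f" "continuous_on UNIV g"
    and eq: "\<And>z. cmod z = 1 \<Longrightarrow> f z = g z"
  shows "integral\<^sup>L M f = integral\<^sup>L M g"
proof (rule integral_cong_AE)
  show "f \<in> borel_measurable M" "g \<in> borel_measurable M"
    using integrable_circle[OF M] assms(2,3) by (auto intro!: borel_measurable_integrable)
  show "AE z in M. f z = g z"
    using circle_measureD(4)[OF M] by eventually_elim (rule eq)
qed

section \<open>Expansion in orthonormal polynomials\<close>

lemma continuous_on_poly_value [continuous_intros]:
  fixes p :: "complex poly"
  shows "continuous_on S (poly p)"
  by (intro continuous_on_poly continuous_on_id)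

text \<open>The degree bound is expressed by coefficients so that \<open>N = 0\<close> forces
  \<open>p = 0\<close>; a strict bound on \<open>degree\<close> could not say this.\<close>

lemma poly_expansion:
  fixes \<phi> :: "nat \<Rightarrow> 'a::field poly"
  assumes "\<And>k. k < N \<Longrightarrow> degree (\<phi> k) = k \<and> \<phi> k \<noteq> 0"
    and "\<And>k. k \<ge> N \<Longrightarrow> coeff p k = 0"
  shows "\<exists>c. p = (\<Sum>k<N. smult (c k) (\<phi> k))"
  using assms
proof (induction N arbitrary: p)
  case 0
  then show ?case by (auto simp: poly_eq_iff)
next
  case (Suc N)
  define d where "d = coeff p N / coeff (\<phi> N) N"
  have deg: "degree (\<phi> N) = N" "coeff (\<phi> N) N \<noteq> 0"
    using Suc.prems(1)[of N] leading_coeff_0_iff[of "\<phi> N"] by auto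
  have "coeff (p - smult d (\<phi> N)) k = 0" if "k \<ge> N" for k
  proof (cases "k = N")
    case True then show ?thesis using deg by (simp add: d_def)
  next
    case False then show ?thesis using that Suc.prems(2)[of k] deg(1) by (simp add: coeff_eq_0)
  qed
  then obtain c where c: "p - smult d (\<phi> N) = (\<Sum>k<N. smult (c k) (\<phi> k))"
    using Suc.IH[of "p - smult d (\<phi> N)"] Suc.prems(1) by force
  have "p = (\<Sum>k<Suc N. smult ((c(N := d)) k) (\<phi> k))"
    using c by (simp add: diff_eq_eq)
  then show ?case by blast
qed

lemma orthonormalD:
  assumes "orthonormal_polynomials M K \<phi>" "n \<in> K"
  shows "degree (\<phi> n) = n" "\<phi> n \<noteq> 0" 
    "m \<in> K \<Longrightarrow> (\<integral>z. poly (\<phi> m) z * cnj (poly (\<phi> n) z) \<partial>M) = (if m = n then 1 else 0)"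
  using assms unfolding orthonormal_polynomials_def by force+

lemma orthonormal_coefficient:
  assumes M: "circle_measure M" and o: "orthonormal_polynomials M K \<phi>"
    and K: "{..<N} \<subseteq> K" "n \<in> K"
  shows "(\<integral>z. poly (\<Sum>k<N. smult (c k) (\<phi> k)) z * cnj (poly (\<phi> n) z) \<partial>M) = (if n < N then c n else 0)"
proof -
  have "(\<integral>z. poly (\<Sum>k<N. smult (c k) (\<phi> k)) z * cnj (poly (\<phi> n) z) \<partial>M)
      = (\<integral>z. (\<Sum>k<N. c k * (poly (\<phi> k) z * cnj (poly (\<phi> n) z))) \<partial>M)"
    by (simp add: poly_sum sum_distrib_right mult.assoc)
  also have "\<dots> = (\<Sum>k<N. c k * (\<integral>z. poly (\<phi> k) z * cnj (poly (\<phi> n) z) \<partial>M))"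
    by (subst Bochner_Integration.integral_sum)
      (auto intro!: integrable_circle[OF M] continuous_intros)
  also have "\<dots> = (\<Sum>k<N. c k * (if k = n then 1 else 0))"
    using K by (intro sum.cong refl) (simp add: orthonormalD(3)[OF o K(2)] subset_iff)
  also have "\<dots> = (if n < N then c n else 0)" by (simp add: sum.delta if_distrib cong: if_cong)
  finally show ?thesis .
qed

lemma orthogonal_lower_degree:
  assumes M: "circle_measure M" and o: "orthonormal_polynomials M K \<phi>"
    and K: "{..n} \<subseteq> K" and p: "\<And>k. k \<ge> n \<Longrightarrow> coeff p k = 0"
  shows "(\<integral>z. poly p z * cnj (poly (\<phi> n) z) \<partial>M) = 0"
proof -
  obtain c where "p = (\<Sum>k<n. smult (c k) (\<phi> k))"
    using poly_expansion[of n \<phi> p] p orthonormalD(1,2)[OF o] K by (force simp: subset_iff)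
  then show ?thesis using orthonormal_coefficient[OF M o, of n n c] K by (auto simp: subset_iff)
qed

text \<open>Having given Schur parameters only asserts that some orthonormal polynomials satisfy the
  recurrence; this identifies them with a prescribed family. Scaling one polynomial to the leading
  coefficient of the other leaves a difference of lower degree that is orthogonal to all lower
  degrees.\<close>

lemma orthonormal_polynomials_unique:
  assumes M: "circle_measure M" and o: "orthonormal_polynomials M UNIV \<phi>"
    and o': "orthonormal_polynomials M UNIV \<psi>"
  shows "\<phi> n = \<psi> n"
proof -
  obtain \<kappa> \<kappa>' :: real where k: "\<kappa> > 0" "lead_coeff (\<phi> n) = of_real \<kappa>" "\<kappa>' > 0" "lead_coeff (\<psi> n) = of_real \<kappa>'"
    using o o' unfolding orthonormal_polynomials_def by blast
  define c where "c = \<kappa> / \<kappa>'"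
  have c: "c > 0" using k by (simp add: c_def)
  define p where "p = \<phi> n - smult (of_real c) (\<psi> n)"
  have "coeff p k = 0" if "k \<ge> n" for k
  proof (cases "k = n")
    case True then show ?thesis
      using k orthonormalD(1)[OF o, of n] orthonormalD(1)[OF o', of n] by (simp add: p_def c_def)
  next
    case False then show ?thesis
      using that orthonormalD(1)[OF o, of n] orthonormalD(1)[OF o', of n]
      by (simp add: p_def coeff_eq_0)
  qed
  then obtain d where d: "p = (\<Sum>k<n. smult (d k) (\<phi> k))"
    using poly_expansion[of n \<phi> p] orthonormalD(1,2)[OF o] by force
  have "d j = 0" if "j < n" for j
  proof -
    have "d j = (\<integral>z. poly p z * cnj (poly (\<phi> j) z) \<partial>M)"
      using orthonormal_coefficient[OF M o, of n j d] that d by simp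
    also have "\<dots> = (\<integral>z. poly (\<phi> n) z * cnj (poly (\<phi> j) z) - of_real c * cnj (poly (\<phi> j) z * cnj (poly (\<psi> n) z)) \<partial>M)"
      by (simp add: p_def algebra_simps)
    also have "\<dots> = (\<integral>z. poly (\<phi> n) z * cnj (poly (\<phi> j) z) \<partial>M)
        - of_real c * cnj (\<integral>z. poly (\<phi> j) z * cnj (poly (\<psi> n) z) \<partial>M)"
      by (subst Bochner_Integration.integral_diff)
        (auto intro!: integrable_circle[OF M] continuous_intros simp del: complex_cnj_mult complex_cnj_cnj)
    also have "(\<integral>z. poly (\<phi> j) z * cnj (poly (\<psi> n) z) \<partial>M) = 0"
      using that orthonormalD(1)[OF o, of j]
      by (intro orthogonal_lower_degree[OF M o']) (auto intro: coeff_eq_0)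
    also have "(\<integral>z. poly (\<phi> n) z * cnj (poly (\<phi> j) z) \<partial>M) = 0"
      using that by (simp add: orthonormalD(3)[OF o])
    finally show ?thesis by simp
  qed
  then have "p = 0" using d by simp
  then have eq: "\<phi> n = smult (of_real c) (\<psi> n)" by (simp add: p_def)
  have "1 = (\<integral>z. poly (\<phi> n) z * cnj (poly (\<phi> n) z) \<partial>M)"
    by (simp add: orthonormalD(3)[OF o])
  also have "\<dots> = (\<integral>z. of_real (c\<^sup>2) * (poly (\<psi> n) z * cnj (poly (\<psi> n) z)) \<partial>M)"
    by (simp add: eq power2_eq_square mult_ac)
  also have "\<dots> = of_real (c\<^sup>2)" by (simp add: orthonormalD(3)[OF o'])
  finally have "c\<^sup>2 = 1" by (metis of_real_eq_1_iff)
  then have "c = 1" using c by (simp add: power2_eq_1_iff)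
  then show ?thesis using eq by simp
qed

lemma poly_reversed_poly:
  assumes "cmod z = 1"
  shows "poly (reversed_poly p) z = z ^ degree p * cnj (poly p z)"
proof -
  have "z \<noteq> 0" "inverse z = cnj z"
    using assms unimodular_mult_cnj[OF assms] by (auto intro: inverse_unique)
  then show ?thesis
    by (simp add: reversed_poly_def poly_reflect_poly_nz degree_map_poly)
qed

lemma degree_reversed_poly_le: "degree (reversed_poly p) \<le> degree p"
  using degree_reflect_poly_le[of "map_poly cnj p"] by (simp add: reversed_poly_def degree_map_poly)

text \<open>In degree 0 the unit total mass and the positive leading coefficient force the constant
  1; from there on the recurrence for polynomials is the one for values.\<close>

lemma poly_eq_szego_val:
  assumes M: "circle_measure M" and o: "orthonormal_polynomials M K \<phi>"
    and K: "{..n} \<subseteq> K" and a: "\<And>m. 1 \<le> m \<Longrightarrow> m \<le> n \<Longrightarrow> cmod (a m) < 1"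
    and rec: "\<And>m. 1 \<le> m \<Longrightarrow> m \<le> n \<Longrightarrow> szego_recurrence \<phi> a m" and z: "cmod z = 1"
  shows "poly (\<phi> n) z = szego_val a n z"
  using K a rec
proof (induction n)
  case 0
  interpret prob_space M by (rule circle_measureD[OF M])
  obtain \<kappa> :: real where k: "\<kappa> > 0" "lead_coeff (\<phi> 0) = of_real \<kappa>" "degree (\<phi> 0) = 0"
    using o 0 unfolding orthonormal_polynomials_def by auto
  then have \<phi>0: "\<phi> 0 = [:of_real \<kappa>:]" by (metis degree_eq_zeroE lead_coeff_pCons(2) pCons_0_0)
  have "(\<integral>z. poly (\<phi> 0) z * cnj (poly (\<phi> 0) z) \<partial>M) = 1"
    using orthonormalD(3)[OF o, of 0 0] 0 by simp
  then have "complex_of_real (\<kappa> * \<kappa>) = 1" by (simp add: \<phi>0 prob_space)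
  then have "\<kappa> * \<kappa> = 1" by (metis of_real_eq_1_iff)
  then have "\<kappa> = 1" using k(1) by (auto simp: square_eq_1_iff)
  then show ?case by (simp add: \<phi>0)
next
  case (Suc n)
  have IH: "poly (\<phi> n) z = szego_val a n z" using Suc.prems by (intro Suc.IH) auto
  have deg: "degree (\<phi> n) = n" using orthonormalD(1)[OF o, of n] Suc.prems(1) by (auto simp: subset_iff)
  have "poly (smult (of_real (rho (a (Suc n)))) (\<phi> (Suc n))) z =
      poly (pCons 0 (\<phi> n) + smult (a (Suc n)) (reversed_poly (\<phi> n))) z"
    using Suc.prems(3)[of "Suc n"] by (simp add: szego_recurrence_def rho_def)
  then have "of_real (rho (a (Suc n))) * poly (\<phi> (Suc n)) z
      = z * szego_val a n z + a (Suc n) * z ^ n * cnj (szego_val a n z)"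
    by (simp add: poly_reversed_poly[OF z] deg IH mult.assoc)
  then show ?case using rho_pos[OF Suc.prems(2)[of "Suc n"]] by (simp add: field_simps)
qed

section \<open>Orthonormality of the CMV functions\<close>

definition cmv_val :: "(nat \<Rightarrow> complex) \<Rightarrow> nat \<Rightarrow> complex \<Rightarrow> complex" where
  "cmv_val a n z = cmv z (\<lambda>n. szego_val a n z) n"

lemma continuous_on_cmv_val [continuous_intros]:
  assumes "\<And>n. n \<ge> 1 \<Longrightarrow> cmod (a n) < 1"
  shows "continuous_on S (cmv_val a n)"
  unfolding cmv_val_def cmv_def
  by (cases "even n") (auto intro!: continuous_intros assms)

text \<open>For \<open>m < n\<close>, moving the power of \<open>z\<close> in the
  \<open>n\<close>-th function to the other factor, after a conjugation if \<open>n\<close> is odd,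
  leaves a polynomial of degree less than \<open>n\<close> against the conjugate of
  \<open>\<phi> n\<close>.\<close>

lemma cmv_val_orthonormal:
  assumes M: "has_schur_parameters M a"
  shows "(\<integral>z. cmv_val a m z * cnj (cmv_val a n z) \<partial>M) = (if m = n then 1 else 0)"
proof -
  obtain \<phi> where \<phi>: "orthonormal_polynomials M UNIV \<phi>" "\<And>n. n \<ge> 1 \<Longrightarrow> szego_recurrence \<phi> a n"
    and C: "circle_measure M" and a: "\<And>n. n \<ge> 1 \<Longrightarrow> cmod (a n) < 1"
    using M by (auto simp: has_schur_parameters_def)
  have val: "szego_val a n z = poly (\<phi> n) z" if "cmod z = 1" for n z
    using poly_eq_szego_val[OF C \<phi>(1), of n a z] a \<phi>(2) that by auto
  note cont = continuous_intros a
  have low: "(\<integral>z. z ^ e * poly q z * cnj (poly (\<phi> n) z) \<partial>M) = 0"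
    if "degree q \<le> m" "e + m < n" for e m n q
  proof -
    have "(\<integral>z. poly (monom 1 e * q) z * cnj (poly (\<phi> n) z) \<partial>M) = 0"
    proof (rule orthogonal_lower_degree[OF C \<phi>(1)])
      fix k assume "n \<le> k"
      moreover have "degree (monom 1 e * q) \<le> e + m"
        using degree_mult_le[of "monom 1 e" q] that(1) degree_monom_le[of "1::complex" e] by linarith
      ultimately show "coeff (monom 1 e * q) k = 0" using that by (intro coeff_eq_0) linarith
    qed simp
    then show ?thesis by (simp add: poly_monom)
  qed
  have less: "(\<integral>z. cmv_val a m z * cnj (cmv_val a n z) \<partial>M) = 0" if mn: "m < n" for m n
  proof -
    define k where "k = n div 2" define j where "j = m div 2"
    define q where "q = (if even m = even n then \<phi> m else reversed_poly (\<phi> m))"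
    \<comment> \<open>If the parities differ, the conjugate of \<open>\<phi> m\<close> appears;
      reversing it consumes \<open>z ^ m\<close>, leaving the exponent \<open>j + k - m\<close>.
      This is \<open>k - j - 1\<close> for odd \<open>m = 2 * j + 1\<close> and \<open>k - j\<close>
      for even \<open>m = 2 * j\<close>.\<close>
    define e where "e = (if even n \<and> odd m then k - j - 1 else k - j)"
    have dq: "degree q \<le> m"
      using degree_reversed_poly_le[of "\<phi> m"] orthonormalD(1)[OF \<phi>(1), of m] by (simp add: q_def)
    have em: "e + m < n"
      using mn unfolding e_def k_def j_def by (auto elim!: evenE oddE)
    have jk: "j \<le> k" using mn by (simp add: j_def k_def div_le_mono)
    have eqp: "(if even n then cmv_val a m z else cnj (cmv_val a m z)) * z ^ k = z ^ e * poly q z"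
      if z: "cmod z = 1" for z
    proof -
      have dm: "degree (\<phi> m) = m" using orthonormalD(1)[OF \<phi>(1), of m] by simp
      have kj: "cnj z ^ j * z ^ k = z ^ (k - j)"
      proof -
        have "z ^ k = z ^ j * z ^ (k - j)" using jk by (simp flip: power_add)
        then show ?thesis using unimodular_power_cnj[OF z, of j] by (simp add: mult_ac)
      qed
      consider "even n" "even m" | "even n" "odd m" | "odd n" "even m" | "odd n" "odd m" by blast
      then show ?thesis
      proof cases
        case 1
        then have "cmv_val a m z * z ^ k = (cnj z ^ j * z ^ k) * poly (\<phi> m) z"
          by (simp add: cmv_val_def cmv_def val z j_def)
        then show ?thesis unfolding kj using 1 by (simp add: q_def e_def)
      next
        case 2
        have "j < k" using 2 mn unfolding j_def k_def by (auto elim!: evenE oddE)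
        then have "e + m = j + k" using 2 mn unfolding e_def j_def k_def by (auto elim!: evenE oddE)
        then have "z ^ e * z ^ m = z ^ j * z ^ k" by (simp flip: power_add)
        then show ?thesis using 2 by (simp add: cmv_val_def cmv_def val z j_def q_def poly_reversed_poly dm mult_ac)
      next
        case 3
        have "e + m = j + k" using 3 mn unfolding e_def j_def k_def by (auto elim!: evenE oddE)
        then have "z ^ e * z ^ m = z ^ j * z ^ k" by (simp flip: power_add)
        then show ?thesis using 3 by (simp add: cmv_val_def cmv_def val z j_def q_def poly_reversed_poly dm mult_ac)
      next
        case 4
        then have "cnj (cmv_val a m z) * z ^ k = (cnj z ^ j * z ^ k) * poly (\<phi> m) z"
          by (simp add: cmv_val_def cmv_def val z j_def)
        then show ?thesis unfolding kj using 4 by (simp add: q_def e_def)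
      qed
    qed
    show ?thesis
    proof (cases "even n")
      case True
      have "(\<integral>z. cmv_val a m z * cnj (cmv_val a n z) \<partial>M)
          = (\<integral>z. z ^ e * poly q z * cnj (poly (\<phi> n) z) \<partial>M)"
      proof (rule integral_cong_circle[OF C])
        fix z :: complex assume z: "cmod z = 1"
        have "cmv_val a m z * cnj (cmv_val a n z) = (cmv_val a m z * z ^ k) * cnj (poly (\<phi> n) z)"
          using True z by (simp add: cmv_val_def cmv_def[of z _ n] val k_def)
        moreover have "cmv_val a m z * z ^ k = z ^ e * poly q z" using eqp[OF z] True by simp
        ultimately show "cmv_val a m z * cnj (cmv_val a n z) = z ^ e * poly q z * cnj (poly (\<phi> n) z)"
          by (simp only:)
      qed (auto intro!: cont)
      then show ?thesis using low[OF dq em] by simp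
    next
      case False
      have "(\<integral>z. cmv_val a m z * cnj (cmv_val a n z) \<partial>M)
          = (\<integral>z. cnj (z ^ e * poly q z * cnj (poly (\<phi> n) z)) \<partial>M)"
      proof (rule integral_cong_circle[OF C])
        fix z :: complex assume z: "cmod z = 1"
        have "cnj (cmv_val a m z * cnj (cmv_val a n z)) = (cnj (cmv_val a m z) * z ^ k) * cnj (poly (\<phi> n) z)"
          using False z by (simp add: cmv_val_def cmv_def[of z _ n] val k_def)
        also have "\<dots> = z ^ e * poly q z * cnj (poly (\<phi> n) z)"
          using eqp[OF z] False by simp
        finally show "cmv_val a m z * cnj (cmv_val a n z) = cnj (z ^ e * poly q z * cnj (poly (\<phi> n) z))"
          by (metis complex_cnj_cnj)
      qed (auto intro!: cont)
      then show ?thesis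
        using low[OF dq em] Bochner_Integration.integral_cnj[of M "\<lambda>z. z ^ e * poly q z * cnj (poly (\<phi> n) z)"] mn
        by (simp only: complex_cnj_zero less_irrefl if_False)
    qed
  qed
  consider "m < n" | "n < m" | "m = n" by linarith
  then show ?thesis
  proof cases
    case 1 then show ?thesis using less by simp
  next
    case 2
    have "(\<integral>z. cmv_val a m z * cnj (cmv_val a n z) \<partial>M)
        = (\<integral>z. cnj (cmv_val a n z * cnj (cmv_val a m z)) \<partial>M)" by (simp add: mult.commute)
    also have "\<dots> = cnj (\<integral>z. cmv_val a n z * cnj (cmv_val a m z) \<partial>M)" by (rule Bochner_Integration.integral_cnj)
    finally show ?thesis using 2 less[OF 2] by simp
  next
    case 3
    have "(\<integral>z. cmv_val a m z * cnj (cmv_val a n z) \<partial>M)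
        = (\<integral>z. poly (\<phi> n) z * cnj (poly (\<phi> n) z) \<partial>M)"
    proof (rule integral_cong_circle[OF C])
      fix z :: complex assume z: "cmod z = 1"
      show "cmv_val a m z * cnj (cmv_val a n z) = poly (\<phi> n) z * cnj (poly (\<phi> n) z)"
        using z 3 by (simp add: cmv_val_def norm_cmv val flip: complex_norm_square)
    qed (auto intro!: cont)
    then show ?thesis using 3 orthonormalD(3)[OF \<phi>(1), of n n] by simp
  qed
qed

text \<open>The finite data in terms of \<open>szego_val\<close>. Christoffel's formula for the
  masses shows that no support point is massless, and the zeros of the closing polynomial are the
  support points by definition.\<close>

lemma has_finite_schur_parametersD:
  assumes fin: "has_finite_schur_parameters M N a"
  defines "b \<equiv> \<lambda>n z. szego_val a n z"
  shows "N \<ge> 1" "mass_points M = measure_support M" "finite (mass_points M)" "card (mass_points M) = N"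
    and "\<And>z. z \<in> mass_points M \<Longrightarrow> measure M {z} * (\<Sum>n<N. (cmod (b n z))\<^sup>2) = 1"
    and "\<And>z. cmod z = 1 \<Longrightarrow> z * b (N - 1) z + a N * z ^ (N - 1) * cnj (b (N - 1) z) = 0 \<Longrightarrow>
      z \<in> mass_points M"
proof -
  let ?S = "measure_support M"
  obtain \<phi> where C: "circle_measure M" and N: "N \<ge> 1" and S: "finite ?S" "card ?S = N"
    and a: "\<And>n. n \<in> {1..<N} \<Longrightarrow> cmod (a n) < 1"
    and o: "orthonormal_polynomials M {..<N} \<phi>"
    and rec: "\<And>n. n \<in> {1..<N} \<Longrightarrow> szego_recurrence \<phi> a n"
    and \<psi>: "smult (lead_coeff (\<phi> (N - 1))) (\<Prod>x\<in>?S. [:- x, 1:]) =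
          pCons 0 (\<phi> (N - 1)) + smult (a N) (reversed_poly (\<phi> (N - 1)))"
    using fin by (auto simp: has_finite_schur_parameters_def)
  interpret prob_space M by (rule circle_measureD[OF C])
  have val: "poly (\<phi> n) z = b n z" if "cmod z = 1" "n < N" for n z
    unfolding b_def
    by (rule poly_eq_szego_val[OF C o]) (use that a rec in auto)
  have sub: "mass_points M \<subseteq> ?S"
    using circle_measureD[OF C] by (intro mass_points_subset_support) unfold_locales
  have christoffel: "measure M {z} * (\<Sum>n<N. (cmod (b n z))\<^sup>2) = 1" if z: "z \<in> ?S" for z
  proof -
    \<comment> \<open>\<open>p\<close> vanishes at all support points except \<open>z\<close>, so
      each of its Fourier coefficients is a single value at \<open>z\<close> times the mass there.
      Evaluating the expansion at \<open>z\<close> and cancelling \<open>poly p z\<close> gives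
      Christoffel's formula.\<close>
    define p where "p = (\<Prod>x\<in>?S - {z}. [:- x, 1:])"
    have z1: "cmod z = 1" using measure_support_subset_circle[OF C] z by auto
    have "degree p \<le> (\<Sum>x\<in>?S - {z}. degree [:- x, 1:])"
      using degree_prod_sum_le[of "?S - {z}" "\<lambda>x. [:- x, 1:]"] S by (simp add: p_def o_def)
    also have "\<dots> = N - 1" using S z by simp
    finally have degp: "degree p \<le> N - 1" .
    have "coeff p k = 0" if "k \<ge> N" for k
      using that degp N by (intro coeff_eq_0) linarith
    then obtain c where c: "p = (\<Sum>k<N. smult (c k) (\<phi> k))"
      using poly_expansion[of N \<phi> p] orthonormalD(1,2)[OF o] by force
    have pz: "poly p z \<noteq> 0" using S by (auto simp: p_def poly_prod)
    have cj: "c j = measure M {z} * (poly p z * cnj (b j z))" if j: "j < N" for j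
    proof -
      have "c j = (\<integral>x. poly p x * cnj (poly (\<phi> j) x) \<partial>M)"
        using orthonormal_coefficient[OF C o, of N j c] j c by simp
      also have "\<dots> = (\<integral>x. indicator {z} x *\<^sub>R (poly p z * cnj (poly (\<phi> j) z)) \<partial>M)"
      proof (rule integral_cong_AE)
        show "(\<lambda>x. poly p x * cnj (poly (\<phi> j) x)) \<in> borel_measurable M"
          by (intro borel_measurable_integrable integrable_circle[OF C] continuous_intros)
        show "(\<lambda>x. indicator {z} x *\<^sub>R (poly p z * cnj (poly (\<phi> j) z))) \<in> borel_measurable M"
          using circle_measureD(2)[OF C] by (intro borel_measurable_scaleR borel_measurable_indicator) auto
        show "AE x in M. poly p x * cnj (poly (\<phi> j) x)
            = indicator {z} x *\<^sub>R (poly p z * cnj (poly (\<phi> j) z))"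
          using AE_measure_support[OF circle_measureD(2)[OF C]]
        proof eventually_elim
          case (elim x)
          then show ?case using S by (cases "x = z") (auto simp: p_def poly_prod)
        qed
      qed
      also have "\<dots> = measure M {z} * (poly p z * cnj (b j z))"
        using circle_measureD(2)[OF C] val[OF z1 j] by (simp add: scaleR_conv_of_real)
      finally show ?thesis .
    qed
    have "poly p z = (\<Sum>j<N. c j * b j z)"
      by (subst c) (simp add: poly_sum val[OF z1])
    also have "\<dots> = poly p z * of_real (measure M {z} * (\<Sum>n<N. (cmod (b n z))\<^sup>2))"
      by (simp add: cj sum_distrib_left complex_norm_square mult_ac del: of_real_power)
    finally have "complex_of_real (measure M {z} * (\<Sum>n<N. (cmod (b n z))\<^sup>2)) = 1"
      using pz by (simp add: mult_cancel_left1 del: of_real_mult of_real_sum)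
    then show ?thesis by (simp only: of_real_eq_1_iff)
  qed
  have sup: "?S \<subseteq> mass_points M"
  proof
    fix z assume "z \<in> ?S"
    then have "measure M {z} \<noteq> 0" using christoffel[of z] by auto
    then show "z \<in> mass_points M" by (simp add: mass_points_def zero_less_measure_iff)
  qed
  show "N \<ge> 1" by (rule N)
  show eqS: "mass_points M = ?S" using sub sup by blast
  show "finite (mass_points M)" "card (mass_points M) = N" using S eqS by auto
  show "measure M {z} * (\<Sum>n<N. (cmod (b n z))\<^sup>2) = 1" if "z \<in> mass_points M" for z
    using that christoffel eqS by simp
  show "z \<in> mass_points M"
    if z: "cmod z = 1" and e: "z * b (N - 1) z + a N * z ^ (N - 1) * cnj (b (N - 1) z) = 0" for z
  proof -
    have d: "degree (\<phi> (N - 1)) = N - 1" "\<phi> (N - 1) \<noteq> 0" using orthonormalD(1,2)[OF o] N by auto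
    have "poly (smult (lead_coeff (\<phi> (N - 1))) (\<Prod>x\<in>?S. [:- x, 1:])) z = 0"
      unfolding \<psi> using e N d(1) by (simp add: poly_reversed_poly[OF z] val[OF z] mult.assoc)
    then have "poly (\<Prod>x\<in>?S. [:- x, 1:]) z = 0" using d by simp
    then show ?thesis using S eqS by (auto simp: poly_prod)
  qed
qed

section \<open>Multiplication by the variable in the CMV basis\<close>

text \<open>The operator \<open>block_op True\<close> acts on the coordinate pairs \<open>(2k, 2k + 1)\<close> and \<open>block_op False\<close> on the
  pairs \<open>(2k - 1, 2k)\<close>, fixing coordinate \<open>0\<close>.\<close>

definition block_op :: "bool \<Rightarrow> (nat \<Rightarrow> complex) \<Rightarrow> (nat \<Rightarrow> complex) \<Rightarrow> nat \<Rightarrow> complex" where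
  "block_op e a c n =
     (if even n = e then - a (Suc n) * c n + of_real (rho (a (Suc n))) * c (Suc n)
      else if n = 0 then c 0
      else of_real (rho (a n)) * c (n - 1) + cnj (a n) * c n)"

text \<open>An even number of coordinates, so that no pair \<open>(2k, 2k + 1)\<close> is
  cut.\<close>

abbreviation coeff_sq :: "(nat \<Rightarrow> complex) \<Rightarrow> nat \<Rightarrow> real" where
  "coeff_sq c N \<equiv> (\<Sum>n<2 * N. (cmod (c n))\<^sup>2)"

abbreviation integral_sq :: "complex measure \<Rightarrow> (complex \<Rightarrow> complex) \<Rightarrow> real" where
  "integral_sq M f \<equiv> (\<integral>z. (cmod (f z))\<^sup>2 \<partial>M)"

abbreviation energy :: "complex measure \<Rightarrow> complex \<Rightarrow> (complex \<Rightarrow> complex) \<Rightarrow> real" where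
  "energy M w f \<equiv> (\<integral>z. (cmod (z - w))\<^sup>2 * (cmod (f z))\<^sup>2 \<partial>M)"

text \<open>The integral of \<open>z\<close> times the squared modulus of the combination with
  coefficients \<open>c\<close>, written without the measure. The two block factors act on opposite
  sides of the pairing, so their product is never formed.\<close>

definition cmv_form :: "(nat \<Rightarrow> complex) \<Rightarrow> (nat \<Rightarrow> complex) \<Rightarrow> nat \<Rightarrow> complex" where
  "cmv_form a c N = (\<Sum>n<2 * N. block_op True a c n * block_op False a (\<lambda>k. cnj (c k)) n)"

lemma cmv_val_step:
  assumes "cmod z = 1" "\<And>n. n \<ge> 1 \<Longrightarrow> cmod (a n) < 1"
  shows "cmv_step (a (Suc n)) (rho (a (Suc n))) z n (cmv_val a n z) (cmv_val a (Suc n) z)"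
proof -
  have a: "cmod (a (Suc n)) < 1" using assms(2)[of "Suc n"] by simp
  then show ?thesis
    using rho_pos[OF a] rho_sq[of "a (Suc n)"] unfolding cmv_val_def
    by (intro cmv_stepI assms(1)) auto
qed

text \<open>The blocks are symmetric, so the matrix acting on a pair of basis functions acts in the
  same way on the pair of coefficients. The pairs \<open>(2k, 2k + 1)\<close> carry the odd-numbered
  parameters.\<close>

lemma sum_block_odd:
  assumes z: "cmod z = 1" and a: "\<And>n. n \<ge> 1 \<Longrightarrow> cmod (a n) < 1"
  shows "z * (\<Sum>n<2 * N. c n * cmv_val a n z) = (\<Sum>n<2 * N. block_op True a c n * cnj (cmv_val a n z))"
proof (induction N)
  case (Suc N)
  have "z * cmv_val a (2 * N) z = - a (Suc (2 * N)) * cnj (cmv_val a (2 * N) z)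
        + of_real (rho (a (Suc (2 * N)))) * cnj (cmv_val a (Suc (2 * N)) z)"
    "z * cmv_val a (Suc (2 * N)) z = of_real (rho (a (Suc (2 * N)))) * cnj (cmv_val a (2 * N) z)
        + cnj (a (Suc (2 * N))) * cnj (cmv_val a (Suc (2 * N)) z)"
    using cmv_val_step[OF z a, where n = "2 * N"] by (auto simp: cmv_step_def)
  then have "c (2 * N) * (z * cmv_val a (2 * N) z) + c (Suc (2 * N)) * (z * cmv_val a (Suc (2 * N)) z)
      = block_op True a c (2 * N) * cnj (cmv_val a (2 * N) z)
        + block_op True a c (Suc (2 * N)) * cnj (cmv_val a (Suc (2 * N)) z)"
    by (simp only: block_op_def) (simp add: algebra_simps)
  then show ?case using Suc by (simp add: algebra_simps)
qed simp

text \<open>The same symmetry for the even-numbered parameters. Coordinate 0 stands alone and the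
  pairs \<open>(2k - 1, 2k)\<close> follow, hence the odd length.\<close>

lemma sum_block_even:
  assumes z: "cmod z = 1" and a: "\<And>n. n \<ge> 1 \<Longrightarrow> cmod (a n) < 1"
  shows "(\<Sum>n<Suc (2 * N). c n * cnj (cmv_val a n z)) = (\<Sum>n<Suc (2 * N). block_op False a c n * cmv_val a n z)"
proof (induction N)
  case 0
  then show ?case by (simp add: block_op_def cmv_val_def cmv_def)
next
  case (Suc N)
  let ?n = "Suc (2 * N)"
  have "cnj (cmv_val a ?n z) = - a (Suc ?n) * cmv_val a ?n z
        + of_real (rho (a (Suc ?n))) * cmv_val a (Suc ?n) z"
    "cnj (cmv_val a (Suc ?n) z) = of_real (rho (a (Suc ?n))) * cmv_val a ?n z
        + cnj (a (Suc ?n)) * cmv_val a (Suc ?n) z"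
    using cmv_val_step[OF z a, where n = ?n] by (auto simp: cmv_step_def)
  then have "c ?n * cnj (cmv_val a ?n z) + c (Suc ?n) * cnj (cmv_val a (Suc ?n) z)
      = block_op False a c ?n * cmv_val a ?n z + block_op False a c (Suc ?n) * cmv_val a (Suc ?n) z"
    by (simp only: block_op_def) (simp add: algebra_simps)
  moreover have "Suc (2 * Suc N) = Suc (Suc ?n)" by simp
  ultimately show ?case using Suc by (simp only: sum.lessThan_Suc) (simp add: add.assoc)
qed

lemma norm_two_terms_le:
  assumes "cmod x \<le> t" "cmod y \<le> t"
  shows "cmod (x * u + y * v) \<le> t * (cmod u + cmod v)"
  using norm_triangle_ineq[of "x * u" "y * v"] mult_right_mono[OF assms(1), of "cmod u"]
    mult_right_mono[OF assms(2), of "cmod v"] by (simp add: norm_mult algebra_simps)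

text \<open>At \<open>n = 0\<close> the truncated \<open>n - 1\<close> repeats \<open>c 0\<close>,
  which only enlarges this upper bound.\<close>

definition neighbours :: "(nat \<Rightarrow> complex) \<Rightarrow> nat \<Rightarrow> real" where
  "neighbours c n = cmod (c (n - 1)) + cmod (c n) + cmod (c (Suc n))"

lemma neighbours_ge:
  assumes "t \<ge> 0"
  shows "t * (cmod (c n) + cmod (c (Suc n))) \<le> t * neighbours c n"
    and "t * (cmod (c (n - 1)) + cmod (c n)) \<le> t * neighbours c n"
    and "t * cmod (c n) \<le> t * neighbours c n"
  by (intro mult_left_mono assms; simp add: neighbours_def)+

lemma norm_block_op_le:
  assumes a: "\<And>n. n \<ge> 1 \<Longrightarrow> cmod (a n) \<le> 1"
  shows "cmod (block_op e a c n) \<le> neighbours c n"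
proof -
  have rho: "\<bar>rho (a m)\<bar> \<le> 1" if "m \<ge> 1" for m
    using a[OF that] by (simp add: rho_def power_le_one)
  consider "even n = e" | "even n \<noteq> e" "n = 0" | "even n \<noteq> e" "n \<ge> 1" by linarith
  then show ?thesis
  proof cases
    case 1
    then show ?thesis
      using order_trans[OF norm_two_terms_le[of "- a (Suc n)" 1 "of_real (rho (a (Suc n)))"] neighbours_ge(1)[of 1 c n]]
        a[of "Suc n"] rho[of "Suc n"] by (simp add: block_op_def)
  next
    case 2
    then show ?thesis using neighbours_ge(3)[of 1 c 0] by (simp add: block_op_def)
  next
    case 3
    then show ?thesis
      using order_trans[OF norm_two_terms_le[of "of_real (rho (a n))" 1 "cnj (a n)"] neighbours_ge(2)[of 1 c n]]
        a[of n] rho[of n] by (simp add: block_op_def)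
  qed
qed

lemma norm_block_op_diff_le:
  assumes d: "\<And>n. n \<ge> 1 \<Longrightarrow> cmod (a n - a' n) \<le> \<eta>"
    and r: "\<And>n. n \<ge> 1 \<Longrightarrow> \<bar>rho (a n) - rho (a' n)\<bar> \<le> \<eta>"
  shows "cmod (block_op e a c n - block_op e a' c n) \<le> \<eta> * neighbours c n"
proof -
  have \<eta>: "\<eta> \<ge> 0" using r[of 1] by linarith
  consider "even n = e" | "even n \<noteq> e" "n = 0" | "even n \<noteq> e" "n \<ge> 1" by linarith
  then show ?thesis
  proof cases
    case 1
    then have "block_op e a c n - block_op e a' c n =
        (- (a (Suc n) - a' (Suc n))) * c n + of_real (rho (a (Suc n)) - rho (a' (Suc n))) * c (Suc n)"
      by (simp add: block_op_def algebra_simps)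
    then show ?thesis
      using order_trans[OF norm_two_terms_le[of "- (a (Suc n) - a' (Suc n))" \<eta>
          "of_real (rho (a (Suc n)) - rho (a' (Suc n)))"] neighbours_ge(1)[OF \<eta>, of c n]]
        d[of "Suc n"] r[of "Suc n"] by (simp only: norm_minus_cancel norm_of_real)
  next
    case 2
    then show ?thesis
      using mult_nonneg_nonneg[OF \<eta>, of "neighbours c 0"] by (simp add: block_op_def neighbours_def)
  next
    case 3
    then have "block_op e a c n - block_op e a' c n =
        of_real (rho (a n) - rho (a' n)) * c (n - 1) + cnj (a n - a' n) * c n"
      by (simp add: block_op_def algebra_simps)
    then show ?thesis
      using order_trans[OF norm_two_terms_le[of "of_real (rho (a n) - rho (a' n))" \<eta> "cnj (a n - a' n)"]
          neighbours_ge(2)[OF \<eta>, of c n]] d[OF 3(2)] r[OF 3(2)] by (simp only: complex_mod_cnj norm_of_real)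
  qed
qed

text \<open>Only neighbouring coordinates interact, which makes the estimate uniform in the vector.\<close>

lemma cmv_form_diff_le:
  assumes a: "\<And>n. n \<ge> 1 \<Longrightarrow> cmod (a n) \<le> 1" and a': "\<And>n. n \<ge> 1 \<Longrightarrow> cmod (a' n) \<le> 1"
    and d: "\<And>n. n \<ge> 1 \<Longrightarrow> cmod (a n - a' n) \<le> \<eta>"
    and e: "\<And>n. n \<ge> 1 \<Longrightarrow> \<bar>rho (a n) - rho (a' n)\<bar> \<le> \<eta>"
    and c: "\<And>n. n \<ge> 2 * N \<Longrightarrow> c n = 0"
  shows "cmod (cmv_form a c N - cmv_form a' c N) \<le> 24 * \<eta> * coeff_sq c N"
proof -
  have \<eta>: "\<eta> \<ge> 0" using e[of 1] by linarith
  define s where "s = neighbours c"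
  have s0: "s n \<ge> 0" for n by (simp add: s_def neighbours_def)
  have s': "neighbours (\<lambda>k. cnj (c k)) = s" by (simp add: s_def neighbours_def fun_eq_iff)
  note L = norm_block_op_le[OF a', where e = True and c = c, folded s_def]
    and E = norm_block_op_le[OF a, where e = False and c = "\<lambda>k. cnj (c k)", unfolded s']
    and LD = norm_block_op_diff_le[OF d e, where e = True and c = c, folded s_def]
    and ED = norm_block_op_diff_le[OF d e, where e = False and c = "\<lambda>k. cnj (c k)", unfolded s']
  \<comment> \<open>Product rule: each factor is at most \<open>s n\<close>, each difference at most
    \<open>\<eta> * s n\<close>. The square of a sum of three terms costs a further factor 3, hence
    6.\<close>
  have entry: "cmod (block_op True a c n * block_op False a (\<lambda>k. cnj (c k)) n
      - block_op True a' c n * block_op False a' (\<lambda>k. cnj (c k)) n) \<le> 6 * \<eta> * ((cmod (c (n - 1)))\<^sup>2 + (cmod (c n))\<^sup>2 + (cmod (c (Suc n)))\<^sup>2)" for n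
  proof -
    let ?L = "block_op True a c n" and ?L' = "block_op True a' c n"
    let ?E = "block_op False a (\<lambda>k. cnj (c k)) n" and ?E' = "block_op False a' (\<lambda>k. cnj (c k)) n"
    have "?L * ?E - ?L' * ?E' = (?L - ?L') * ?E + ?L' * (?E - ?E')" by (simp add: algebra_simps)
    then have "cmod (?L * ?E - ?L' * ?E') \<le> cmod (?L - ?L') * cmod ?E + cmod ?L' * cmod (?E - ?E')"
      using norm_triangle_ineq[of "(?L - ?L') * ?E" "?L' * (?E - ?E')"] by (simp add: norm_mult)
    also have "\<dots> \<le> (\<eta> * s n) * s n + s n * (\<eta> * s n)"
      by (intro add_mono mult_mono LD E L ED mult_nonneg_nonneg \<eta> s0) auto
    also have "\<dots> = 2 * \<eta> * (s n)\<^sup>2" by (simp add: power2_eq_square)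
    also have "(s n)\<^sup>2 \<le> 3 * ((cmod (c (n - 1)))\<^sup>2 + (cmod (c n))\<^sup>2 + (cmod (c (Suc n)))\<^sup>2)"
    proof -
      have "(x + y + w)\<^sup>2 \<le> 3 * (x\<^sup>2 + y\<^sup>2 + w\<^sup>2)" for x y w :: real
      proof -
        have "0 \<le> (x - y)\<^sup>2 + (y - w)\<^sup>2 + (x - w)\<^sup>2" by simp
        also have "\<dots> = 3 * (x\<^sup>2 + y\<^sup>2 + w\<^sup>2) - (x + y + w)\<^sup>2"
          by (simp add: power2_eq_square algebra_simps)
        finally show ?thesis by simp
      qed
      then show ?thesis by (simp add: s_def neighbours_def)
    qed
    then have "2 * \<eta> * (s n)\<^sup>2 \<le> 2 * \<eta> * (3 * ((cmod (c (n - 1)))\<^sup>2 + (cmod (c n))\<^sup>2 + (cmod (c (Suc n)))\<^sup>2))"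
      using \<eta> by (intro mult_left_mono) auto
    finally show ?thesis by (simp add: algebra_simps)
  qed
  define S where "S = coeff_sq c N"
  have Sle: "(\<Sum>n<m. (cmod (c n))\<^sup>2) \<le> S" for m
  proof -
    have "(\<Sum>n<m. (cmod (c n))\<^sup>2) = (\<Sum>n<min m (2 * N). (cmod (c n))\<^sup>2)"
      by (rule sum.mono_neutral_right) (auto simp: c)
    also have "\<dots> \<le> S" unfolding S_def by (intro sum_mono2) auto
    finally show ?thesis .
  qed
  have S1: "(\<Sum>n<2 * N. (cmod (c (Suc n)))\<^sup>2) \<le> S"
    using Sle[of "Suc (2 * N)"] unfolding sum.lessThan_Suc_shift by (smt (verit) zero_le_power2)
  \<comment> \<open>The truncated \<open>n - 1\<close> counts \<open>c 0\<close> twice, hence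
    \<open>2 * S\<close>. The three shifted sums add up to at most \<open>4 * S\<close>, which turns
    6 into 24.\<close>
  have S2: "(\<Sum>n<2 * N. (cmod (c (n - 1)))\<^sup>2) \<le> 2 * S"
  proof (cases N)
    case (Suc k)
    have "(\<Sum>n<2 * N. (cmod (c (n - 1)))\<^sup>2) = (cmod (c 0))\<^sup>2 + (\<Sum>n<Suc (2 * k). (cmod (c n))\<^sup>2)"
      using sum.lessThan_Suc_shift[of "\<lambda>n. (cmod (c (n - 1)))\<^sup>2" "Suc (2 * k)"] by (simp add: Suc)
    then show ?thesis using Sle[of 1] Sle[of "Suc (2 * k)"] by simp
  qed (simp add: S_def)
  have "cmod (cmv_form a c N - cmv_form a' c N)
      \<le> (\<Sum>n<2 * N. 6 * \<eta> * ((cmod (c (n - 1)))\<^sup>2 + (cmod (c n))\<^sup>2 + (cmod (c (Suc n)))\<^sup>2))"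
    unfolding cmv_form_def sum_subtractf[symmetric] by (intro sum_norm_le entry)
  also have "\<dots> = 6 * \<eta> * ((\<Sum>n<2 * N. (cmod (c (n - 1)))\<^sup>2) + S + (\<Sum>n<2 * N. (cmod (c (Suc n)))\<^sup>2))"
    by (simp only: sum_distrib_left[symmetric] sum.distrib S_def)
  also have "\<dots> \<le> 6 * \<eta> * (4 * S)" using S1 S2 \<eta> by (intro mult_left_mono) auto
  finally show ?thesis by (simp add: S_def)
qed

section \<open>Norms and energies of finite combinations\<close>

definition cmv_comb :: "(nat \<Rightarrow> complex) \<Rightarrow> (nat \<Rightarrow> complex) \<Rightarrow> nat \<Rightarrow> complex \<Rightarrow> complex" where
  "cmv_comb a c N z = (\<Sum>n<2 * N. c n * cmv_val a n z)"

text \<open>The CMV functions depend on the parameters alone, so orthonormality is the link between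
  the parameters and the measure; the perturbation argument speaks only about combinations of these
  functions.\<close>

locale cmv_measure =
  fixes M :: "complex measure" and a :: "nat \<Rightarrow> complex"
  assumes circle: "circle_measure M" and params: "\<And>n. n \<ge> 1 \<Longrightarrow> cmod (a n) < 1"
    and ortho: "\<And>m n. (\<integral>z. cmv_val a m z * cnj (cmv_val a n z) \<partial>M) = (if m = n then 1 else 0)"
begin

sublocale prob_space M by (rule circle_measureD(1)[OF circle])

lemmas integrable = integrable_circle[OF circle]
lemmas AE_circle = circle_measureD(4)[OF circle]
lemmas sets_borel = circle_measureD(2)[OF circle]
lemmas AE_support = AE_measure_support[OF sets_borel]

lemma cont_val: "continuous_on S (cmv_val a n)"
  by (intro continuous_on_cmv_val params)

lemma cont_comb: "continuous_on S (cmv_comb a c N)"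
  unfolding cmv_comb_def by (intro continuous_intros cont_val)

lemma integral_lincomb:
  fixes f g :: "complex \<Rightarrow> real"
  assumes "continuous_on UNIV f" "continuous_on UNIV g"
  shows "(\<integral>z. x * f z + y * g z \<partial>M) = x * (\<integral>z. f z \<partial>M) + y * (\<integral>z. g z \<partial>M)"
  by (subst Bochner_Integration.integral_add) (auto intro!: integrable continuous_intros assms)

lemma integral_comb_cnj:
  "(\<integral>z. (\<Sum>m<K. c m * cmv_val a m z) * (\<Sum>n<L. d n * cnj (cmv_val a n z)) \<partial>M)
    = (\<Sum>m<K. if m < L then c m * d m else 0)"
proof -
  have "(\<integral>z. (\<Sum>m<K. c m * cmv_val a m z) * (\<Sum>n<L. d n * cnj (cmv_val a n z)) \<partial>M)
      = (\<integral>z. (\<Sum>m<K. \<Sum>n<L. (c m * d n) * (cmv_val a m z * cnj (cmv_val a n z))) \<partial>M)"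
    by (simp add: sum_product mult_ac)
  also have "\<dots> = (\<Sum>m<K. \<Sum>n<L. (c m * d n) * (\<integral>z. cmv_val a m z * cnj (cmv_val a n z) \<partial>M))"
    by (subst Bochner_Integration.integral_sum, (intro integrable continuous_intros cont_val)[1],
        subst Bochner_Integration.integral_sum, (intro integrable continuous_intros cont_val)[1]) simp
  also have "\<dots> = (\<Sum>m<K. \<Sum>n<L. if n = m then c m * d m else 0)"
    unfolding ortho by (intro sum.cong refl) auto
  also have "\<dots> = (\<Sum>m<K. if m < L then c m * d m else 0)"
    by (intro sum.cong refl) (auto simp: sum.delta)
  finally show ?thesis .
qed

lemma integral_norm_comb: "integral_sq M (cmv_comb a c N) = coeff_sq c N"
proof -
  have "complex_of_real (integral_sq M (cmv_comb a c N))
      = (\<integral>z. complex_of_real ((cmod (cmv_comb a c N z))\<^sup>2) \<partial>M)" by (rule integral_complex_of_real[symmetric])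
  also have "\<dots> = (\<integral>z. (\<Sum>m<2*N. c m * cmv_val a m z) * (\<Sum>n<2*N. cnj (c n) * cnj (cmv_val a n z)) \<partial>M)"
    by (simp only: complex_norm_square cmv_comb_def cnj_sum complex_cnj_mult)
  also have "\<dots> = (\<Sum>n<2 * N. complex_of_real ((cmod (c n))\<^sup>2))"
    unfolding integral_comb_cnj complex_norm_square by (intro sum.cong) auto
  finally show ?thesis by (metis of_real_eq_iff of_real_sum)
qed

text \<open>The blocks on \<open>(2k, 2k + 1)\<close> absorb the factor \<open>z\<close> and leave
  conjugated basis functions; the other blocks turn the conjugate of the combination into
  unconjugated ones. The product then has the form to which orthonormality applies.\<close>

lemma integral_mult_comb:
  assumes c: "\<And>n. n \<ge> 2 * N \<Longrightarrow> c n = 0"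
  shows "(\<integral>z. z * cmv_comb a c N z * cnj (cmv_comb a c N z) \<partial>M) = cmv_form a c N"
proof -
  have "(\<integral>z. z * cmv_comb a c N z * cnj (cmv_comb a c N z) \<partial>M)
      = (\<integral>z. (\<Sum>m<Suc (2*N). block_op False a (\<lambda>k. cnj (c k)) m * cmv_val a m z)
            * (\<Sum>n<2*N. block_op True a c n * cnj (cmv_val a n z)) \<partial>M)"
  proof (rule integral_cong_circle[OF circle])
    fix z :: complex assume z: "cmod z = 1"
    \<comment> \<open>The vanishing coefficient \<open>c (2 * N)\<close> pads the sum to the odd
      length needed by the blocks on \<open>(2k - 1, 2k)\<close>.\<close>
    have "cnj (cmv_comb a c N z) = (\<Sum>n<Suc (2 * N). cnj (c n) * cnj (cmv_val a n z))"
      by (simp add: cmv_comb_def c)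
    then show "z * cmv_comb a c N z * cnj (cmv_comb a c N z)
      = (\<Sum>m<Suc (2*N). block_op False a (\<lambda>k. cnj (c k)) m * cmv_val a m z)
            * (\<Sum>n<2*N. block_op True a c n * cnj (cmv_val a n z))"
      using sum_block_odd[OF z params, where N = N and c = c] sum_block_even[OF z params, where c = "\<lambda>n. cnj (c n)" and N = N]
      by (simp only: cmv_comb_def mult.commute)
  qed (intro continuous_intros cont_comb cont_val)+
  also have "\<dots> = cmv_form a c N"
    unfolding integral_comb_cnj by (simp add: cmv_form_def mult.commute)
  finally show ?thesis .
qed

text \<open>On the circle \<open>(cmod (z - w))\<^sup>2 = 2 - 2 * Re (cnj w * z)\<close>. The
  right-hand side contains parameters and coefficients but no measure, which makes energies for
  different measures comparable.\<close>

lemma integral_dist_comb: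
  assumes c: "\<And>n. n \<ge> 2 * N \<Longrightarrow> c n = 0" and w: "cmod w = 1"
  shows "energy M w (cmv_comb a c N)
    = 2 * coeff_sq c N - 2 * Re (cnj w * cmv_form a c N)"
proof -
  let ?f = "cmv_comb a c N"
  have "energy M w ?f
      = (\<integral>z. 2 * (cmod (?f z))\<^sup>2 - 2 * Re (cnj w * (z * ?f z * cnj (?f z))) \<partial>M)"
  proof (rule integral_cong_circle[OF circle])
    fix z :: complex assume z: "cmod z = 1"
    have "(cmod (z - w))\<^sup>2 = 2 - 2 * Re (cnj w * z)"
      using cmod_power2[of "z - w"] cmod_power2[of z] cmod_power2[of w]
      by (simp add: z w power2_eq_square algebra_simps)
    moreover have "cnj w * (z * ?f z * cnj (?f z)) = (cnj w * z) * complex_of_real ((cmod (?f z))\<^sup>2)"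
      by (simp only: complex_norm_square mult.assoc)
    then have "Re (cnj w * (z * ?f z * cnj (?f z))) = Re (cnj w * z) * (cmod (?f z))\<^sup>2"
      by (simp only: times_complex.sel Re_complex_of_real Im_complex_of_real mult_zero_right diff_zero)
    ultimately show "(cmod (z - w))\<^sup>2 * (cmod (?f z))\<^sup>2 = 2 * (cmod (?f z))\<^sup>2 - 2 * Re (cnj w * (z * ?f z * cnj (?f z)))"
      by (simp only: left_diff_distrib mult.assoc)
  qed (intro continuous_intros cont_comb)+
  also have "\<dots> = 2 * integral_sq M ?f - 2 * Re (cnj w * (\<integral>z. z * ?f z * cnj (?f z) \<partial>M))"
  proof -
    have i: "integrable M (\<lambda>z. cnj w * (z * ?f z * cnj (?f z)))"
      by (intro integrable continuous_intros cont_comb)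
    have "(\<integral>z. Re (cnj w * (z * ?f z * cnj (?f z))) \<partial>M) = Re (cnj w * (\<integral>z. z * ?f z * cnj (?f z) \<partial>M))"
      by (subst integral_Re[OF i]) simp
    moreover have "integrable M (\<lambda>z. 2 * (cmod (?f z))\<^sup>2)" "integrable M (\<lambda>z. 2 * Re (cnj w * (z * ?f z * cnj (?f z))))"
      by (intro integrable continuous_intros cont_comb)+
    ultimately show ?thesis
      by (simp only: Bochner_Integration.integral_diff integral_mult_right_zero)
  qed
  finally show ?thesis by (simp only: integral_norm_comb integral_mult_comb[OF c])
qed

text \<open>The blocks on \<open>(2k, 2k + 1)\<close> preserve the length, the others reach one
  coordinate further; padding to even length gives \<open>Suc N\<close>.\<close>

lemma comb_mult_linear:
  assumes c: "\<And>n. n \<ge> 2 * N \<Longrightarrow> c n = 0"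
  obtains c' where "\<And>n. n \<ge> 2 * Suc N \<Longrightarrow> c' n = 0"
    and "\<And>z. cmod z = 1 \<Longrightarrow> cmv_comb a c' (Suc N) z = (u + v * z) * cmv_comb a c N z"
proof
  define d where "d n = (if n < 2 * N then block_op True a c n else 0)" for n
  define e where "e n = (if n < Suc (2 * N) then block_op False a d n else 0)" for n
  show "u * c n + v * e n = 0" if "n \<ge> 2 * Suc N" for n using that c by (simp add: e_def)
  fix z :: complex assume z: "cmod z = 1"
  have "z * cmv_comb a c N z = (\<Sum>n<2 * N. d n * cnj (cmv_val a n z))"
    using sum_block_odd[OF z params, where N = N and c = c] by (simp add: cmv_comb_def d_def)
  also have "\<dots> = (\<Sum>n<Suc (2 * N). d n * cnj (cmv_val a n z))" by (simp add: d_def)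
  also have "\<dots> = (\<Sum>n<Suc (2 * N). e n * cmv_val a n z)"
    using sum_block_even[OF z params, where N = N and c = d]
    by (simp add: e_def del: sum.lessThan_Suc)
  also have "\<dots> = (\<Sum>n<2 * Suc N. e n * cmv_val a n z)" by (simp add: e_def)
  finally have e: "z * cmv_comb a c N z = (\<Sum>n<2 * Suc N. e n * cmv_val a n z)" .
  have "cmv_comb a c N z = (\<Sum>n<2 * Suc N. c n * cmv_val a n z)" by (simp add: cmv_comb_def c)
  then have "(u + v * z) * cmv_comb a c N z
      = (\<Sum>n<2 * Suc N. u * (c n * cmv_val a n z) + v * (e n * cmv_val a n z))"
    unfolding distrib_right mult.assoc e by (simp only: sum_distrib_left sum.distrib)
  also have "\<dots> = cmv_comb a (\<lambda>n. u * c n + v * e n) (Suc N) z"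
    unfolding cmv_comb_def by (intro sum.cong) (auto simp: algebra_simps)
  finally show "cmv_comb a (\<lambda>n. u * c n + v * e n) (Suc N) z = (u + v * z) * cmv_comb a c N z" ..
qed

text \<open>Coordinate 0 is the constant 1, so repeated multiplication stays among the finite
  combinations. These powers are the source of all test functions concentrated at a point.\<close>

lemma comb_power:
  obtains N c where "\<And>n. n \<ge> 2 * N \<Longrightarrow> c n = 0"
    and "\<And>z. cmod z = 1 \<Longrightarrow> cmv_comb a c N z = (u + v * z) ^ m"
proof -
  have "\<exists>N c. (\<forall>n\<ge>2 * N. c n = 0) \<and> (\<forall>z. cmod z = 1 \<longrightarrow> cmv_comb a c N z = (u + v * z) ^ m)"
  proof (induction m)
    case 0
    have "cmv_comb a (\<lambda>n. if n = 0 then 1 else 0) 1 z = 1" for z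
      by (simp add: cmv_comb_def cmv_val_def cmv_def eval_nat_numeral)
    then show ?case by (intro exI[of _ 1] exI[of _ "\<lambda>n. if n = 0 then 1 else 0"]) auto
  next
    case (Suc m)
    then obtain N c where "\<And>n. n \<ge> 2 * N \<Longrightarrow> c n = 0" "\<And>z. cmod z = 1 \<Longrightarrow> cmv_comb a c N z = (u + v * z) ^ m"
      by blast
    with comb_mult_linear[of N c u v] show ?case by (metis power_Suc)
  qed
  then show ?thesis using that by blast
qed

end

section \<open>Peaking functions at a point of the circle\<close>

definition bump :: "complex \<Rightarrow> complex \<Rightarrow> real" where
  "bump w z = 1 - (cmod (z - w))\<^sup>2 / 4"

lemma bump_bounds:
  assumes "cmod z = 1" "cmod w = 1"
  shows "0 \<le> bump w z" "bump w z \<le> 1"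
proof -
  have "cmod (z - w) \<le> 2" using norm_triangle_ineq4[of z w] assms by simp
  then have "(cmod (z - w))\<^sup>2 \<le> 2\<^sup>2" by (intro power_mono) auto
  then show "0 \<le> bump w z" by (simp add: bump_def)
qed (simp add: bump_def)

text \<open>The parallelogram law: \<open>bump w z\<close> is the squared modulus of
  \<open>(z + w) / 2\<close>. Hence its powers are squared moduli of powers of a linear
  polynomial.\<close>

lemma bump_eq:
  assumes z: "cmod z = 1" and w: "cmod w = 1"
  shows "bump w z = (cmod (1 / 2 + cnj w / 2 * z))\<^sup>2"
proof -
  have e1: "(Re z)\<^sup>2 + (Im z)\<^sup>2 = 1" "(Re w)\<^sup>2 + (Im w)\<^sup>2 = 1"
    using cmod_power2[of z] cmod_power2[of w] z w by simp_all
  have "1 / 2 + cnj w / 2 * z = (1 / 2) * (1 + cnj w * z)" by simp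
  then have "(cmod (1 / 2 + cnj w / 2 * z))\<^sup>2 = (cmod (1 + cnj w * z))\<^sup>2 / 4"
    by (simp only: norm_mult power_mult_distrib) (simp add: power2_eq_square)
  also have "(cmod (1 + cnj w * z))\<^sup>2 = 1 + 2 * (Re w * Re z + Im w * Im z)
      + ((Re z)\<^sup>2 + (Im z)\<^sup>2) * ((Re w)\<^sup>2 + (Im w)\<^sup>2)"
    unfolding cmod_power2 by (simp add: power2_eq_square algebra_simps)
  also have "\<dots> = 4 - (cmod (z - w))\<^sup>2"
  proof -
    have "(cmod (z - w))\<^sup>2 = ((Re z)\<^sup>2 + (Im z)\<^sup>2) + ((Re w)\<^sup>2 + (Im w)\<^sup>2) - 2 * (Re w * Re z + Im w * Im z)"
      unfolding cmod_power2 by (simp add: power2_eq_square algebra_simps)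
    then show ?thesis using e1 by simp
  qed
  finally show ?thesis by (simp add: bump_def)
qed

lemma isolated_support_point_mass_pos:
  fixes M :: "'a::{second_countable_topology, t1_space} measure"
  assumes M: "finite_measure M" "sets M = sets borel" and B: "open B" "measure_support M \<inter> B = {x}"
  shows "measure M {x} > 0"
proof -
  interpret finite_measure M by (rule M)
  have "emeasure M B > 0" using B by (auto simp: measure_support_def)
  also have "emeasure M B \<le> emeasure M {x}"
  proof (rule emeasure_mono_AE)
    show "AE y in M. y \<in> B \<longrightarrow> y \<in> {x}"
      using AE_measure_support[OF M(2)] by eventually_elim (use B(2) in blast)
  qed (simp add: M(2))
  finally show ?thesis by (simp add: emeasure_eq_measure)
qed

context cmv_measure
begin

lemma continuous_on_bump [continuous_intros]: "continuous_on S (bump w)"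
  unfolding bump_def by (intro continuous_intros) auto

lemma mass_le_integral:
  assumes g: "continuous_on UNIV g" "\<And>z. g z \<ge> (0::real)"
  shows "measure M {x} * g x \<le> (\<integral>z. g z \<partial>M)"
proof -
  have "measure M {x} * g x = (\<integral>z. indicator {x} z * g x \<partial>M)"
    using sets_borel by simp
  also have "\<dots> \<le> (\<integral>z. g z \<partial>M)"
  proof (rule integral_mono_AE)
    show "integrable M (\<lambda>z. indicator {x} z * g x)"
      using sets_borel by (intro integrable_mult_left integrable_real_indicator) (auto simp: emeasure_eq_measure)
    show "AE z in M. indicator {x} z * g x \<le> g z"
      using g(2) by (auto simp: indicator_def)
  qed (rule integrable[OF g(1)])
  finally show ?thesis .
qed

text \<open>Since \<open>(cmod (z - w))\<^sup>2 = 4 * (1 - bump w z)\<close>, the energy of the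
  \<open>m\<close>-th power of the linear polynomial is a difference of consecutive moments of
  \<open>bump w\<close>.\<close>

lemma bump_power_comb:
  assumes w: "cmod w = 1"
  obtains N c where "\<And>n. n \<ge> 2 * N \<Longrightarrow> c n = 0" "cmv_comb a c N w = 1"
    "coeff_sq c N = (\<integral>z. bump w z ^ m \<partial>M)"
    "energy M w (cmv_comb a c N)
      = 4 * ((\<integral>z. bump w z ^ m \<partial>M) - (\<integral>z. bump w z ^ Suc m \<partial>M))"
proof -
  obtain N c where c: "\<And>n. n \<ge> 2 * N \<Longrightarrow> c n = 0"
    and e: "\<And>z. cmod z = 1 \<Longrightarrow> cmv_comb a c N z = (1 / 2 + cnj w / 2 * z) ^ m"
    using comb_power[of "1 / 2" "cnj w / 2" m] by metis
  have n: "(cmod (cmv_comb a c N z))\<^sup>2 = bump w z ^ m" if "cmod z = 1" for z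
    using that by (simp only: e[OF that] norm_power bump_eq[OF that w] power_mult[symmetric] mult.commute)
  have i: "integrable M (\<lambda>z. bump w z ^ k)" for k by (intro integrable continuous_intros)
  show ?thesis
  proof (rule that[of N c])
    show "cmv_comb a c N w = 1"
      using unimodular_mult_cnj[OF w] by (simp add: e[OF w] mult.commute)
    show "coeff_sq c N = (\<integral>z. bump w z ^ m \<partial>M)"
      unfolding integral_norm_comb[symmetric]
      by (rule integral_cong_circle[OF circle]) (auto intro!: continuous_intros cont_comb n)
    have "energy M w (cmv_comb a c N)
        = (\<integral>z. 4 * (bump w z ^ m - bump w z ^ Suc m) \<partial>M)"
    proof (rule integral_cong_circle[OF circle])
      fix z :: complex assume z: "cmod z = 1"
      show "(cmod (z - w))\<^sup>2 * (cmod (cmv_comb a c N z))\<^sup>2 = 4 * (bump w z ^ m - bump w z ^ Suc m)"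
        unfolding n[OF z] by (simp add: bump_def algebra_simps)
    qed (intro continuous_intros cont_comb)+
    also have "\<dots> = 4 * ((\<integral>z. bump w z ^ m \<partial>M) - (\<integral>z. bump w z ^ Suc m \<partial>M))"
      using i[of m] i[of "Suc m"] by (simp only: Bochner_Integration.integral_diff integral_mult_right_zero)
    finally show "energy M w (cmv_comb a c N)
      = 4 * ((\<integral>z. bump w z ^ m \<partial>M) - (\<integral>z. bump w z ^ Suc m \<partial>M))" .
  qed (rule c)
qed

lemma integral_bump_nonneg:
  assumes "cmod w = 1"
  shows "(\<integral>z. bump w z ^ m \<partial>M) \<ge> 0"
  by (rule integral_nonneg_AE, use AE_circle in eventually_elim) (simp add: bump_bounds assms)

text \<open>If no combination were concentrated near the support point \<open>w\<close>, then the integrals of the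
  powers of \<open>bump w\<close> would decay faster than the mass near \<open>w\<close> permits.\<close>

lemma exists_concentrated_comb:
  assumes w: "w \<in> measure_support M" and \<epsilon>: "\<epsilon> > 0"
  obtains N c where "\<And>n. n \<ge> 2 * N \<Longrightarrow> c n = 0" "coeff_sq c N = 1"
    "energy M w (cmv_comb a c N) \<le> \<epsilon>"
proof -
  have w1: "cmod w = 1" using measure_support_subset_circle[OF circle] w by auto
  define A where "A m = (\<integral>z. bump w z ^ m \<partial>M)" for m
  \<comment> \<open>After normalization the energy is \<open>4 * (1 - A (Suc m) / A m)\<close>, at
    most \<open>\<epsilon>\<close> once the quotient exceeds \<open>q\<close>. The number
    \<open>q'\<close> lies strictly between \<open>q\<close> and 1, so the open set where
    \<open>bump w\<close> exceeds \<open>q'\<close> contains \<open>w\<close>.\<close>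
  define q where "q = 1 - \<epsilon> / 4"
  define q' where "q' = 1 - \<epsilon> / 8"
  have A0: "A m \<ge> 0" for m unfolding A_def by (rule integral_bump_nonneg[OF w1])
  have "\<exists>m. A m > 0 \<and> A (Suc m) > q * A m"
  proof (rule ccontr)
    assume "\<not> ?thesis"
    then have step: "A (Suc m) \<le> q * A m" if "A m > 0" for m using that by force
    have step': "A (Suc m) \<le> q * A m" for m
    proof (cases "A m > 0")
      case False
      then have "A m = 0" using A0[of m] by simp
      moreover have "A (Suc m) \<le> A m" unfolding A_def
      proof (rule integral_mono_AE)
        show "AE z in M. bump w z ^ Suc m \<le> bump w z ^ m"
          using AE_circle by eventually_elim (simp add: mult_left_le_one_le bump_bounds w1)
      qed (intro integrable continuous_intros)+
      ultimately show ?thesis by simp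
    qed (rule step)
    have A00: "A 0 = 1" by (simp add: A_def prob_space)
    have q0: "q \<ge> 0" using step'[of 0] A0[of 1] A00 by simp
    have Aq: "A m \<le> q ^ m" for m
    proof (induction m)
      case (Suc m)
      have "A (Suc m) \<le> q * A m" by (rule step')
      also have "\<dots> \<le> q * q ^ m" using Suc q0 by (intro mult_left_mono)
      finally show ?case by simp
    qed (simp add: A00)
    have q': "q' > 0" "q < q'" using q0 \<epsilon> by (auto simp: q_def q'_def)
    define B where "B = {z. bump w z > q'}"
    have B: "open B" unfolding B_def
      by (intro open_Collect_less continuous_intros)
    have "w \<in> B" using \<epsilon> by (simp add: B_def bump_def q'_def)
    then have "emeasure M B > 0" using w B by (auto simp: measure_support_def)
    then have \<beta>: "measure M B > 0" by (simp add: emeasure_eq_measure)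
    have BM: "B \<in> sets M" using B sets_borel by simp
    have "measure M B * q' ^ m \<le> A m" for m
    proof -
      have "measure M B * q' ^ m = (\<integral>z. indicator B z * q' ^ m \<partial>M)" using BM by simp
      also have "\<dots> \<le> A m" unfolding A_def
      proof (rule integral_mono_AE)
        show "integrable M (\<lambda>z. indicator B z * q' ^ m)"
          using BM by (intro integrable_mult_left integrable_real_indicator) (auto simp: emeasure_eq_measure)
        show "AE z in M. indicator B z * q' ^ m \<le> bump w z ^ m"
          using AE_circle
          by eventually_elim (use q' in \<open>auto simp: indicator_def B_def bump_bounds w1 intro!: power_mono\<close>)
      qed (intro integrable continuous_intros)
      finally show ?thesis .
    qed
    then have "measure M B * q' ^ m \<le> q ^ m" for m using Aq order_trans by blast
    then have "measure M B \<le> (q / q') ^ m" for m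
      using q' by (simp add: power_divide pos_le_divide_eq)
    moreover have "(\<lambda>m. (q / q') ^ m) \<longlonglongrightarrow> 0"
      using q' q0 by (intro LIMSEQ_power_zero) simp
    ultimately have "measure M B \<le> 0" by (intro LIMSEQ_le_const) auto
    then show False using \<beta> by simp
  qed
  then obtain m where m: "A m > 0" "A (Suc m) > q * A m" by blast
  obtain N c where c: "\<And>n. n \<ge> 2 * N \<Longrightarrow> c n = 0" 
    and n: "coeff_sq c N = A m"
    and d: "energy M w (cmv_comb a c N) = 4 * (A m - A (Suc m))"
    using bump_power_comb[OF w1, of m, folded A_def] by blast
  define k where "k = 1 / sqrt (A m)"
  have k2: "k\<^sup>2 = 1 / A m" using m(1) by (simp add: k_def power_divide)
  define c' where "c' n = of_real k * c n" for n
  have comb: "cmv_comb a c' N z = of_real k * cmv_comb a c N z" for z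
    by (simp add: cmv_comb_def c'_def sum_distrib_left mult.assoc)
  show ?thesis
  proof (rule that[of N c'])
    show "c' n = 0" if "n \<ge> 2 * N" for n using c[OF that] by (simp add: c'_def)
    have "coeff_sq c' N = k\<^sup>2 * coeff_sq c N"
      by (simp add: c'_def norm_mult power_mult_distrib sum_distrib_left)
    then show "coeff_sq c' N = 1" using m(1) by (simp add: n k2)
    have "energy M w (cmv_comb a c' N)
        = (\<integral>z. k\<^sup>2 * ((cmod (z - w))\<^sup>2 * (cmod (cmv_comb a c N z))\<^sup>2) \<partial>M)"
      by (simp add: comb norm_mult power_mult_distrib mult_ac)
    also have "\<dots> = k\<^sup>2 * (4 * (A m - A (Suc m)))" by (simp only: integral_mult_right_zero d)
    also have "\<dots> \<le> \<epsilon>" using m by (simp add: k2 q_def field_simps)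
    finally show "energy M w (cmv_comb a c' N) \<le> \<epsilon>" .
  qed
qed

text \<open>On the circle \<open>bump w\<close> equals 1 at \<open>w\<close> and lies in
  \<open>[0, 1)\<close> elsewhere, so its powers tend to the indicator of \<open>w\<close>,
  dominated by 1.\<close>

lemma integral_bump_tendsto:
  assumes w: "cmod w = 1"
  shows "(\<lambda>m. \<integral>z. bump w z ^ m \<partial>M) \<longlonglongrightarrow> measure M {w}"
proof -
  have "(\<lambda>m. \<integral>z. bump w z ^ m \<partial>M) \<longlonglongrightarrow> (\<integral>z. indicator {w} z \<partial>M)"
  proof (rule integral_dominated_convergence[where w = "\<lambda>_. 1"])
    show "(\<lambda>z. indicator {w} z :: real) \<in> borel_measurable M"
      using sets_borel by (intro borel_measurable_indicator) simp
    show "(\<lambda>z. bump w z ^ m) \<in> borel_measurable M" for m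
      by (intro borel_measurable_integrable integrable continuous_intros)
    show "AE z in M. (\<lambda>m. bump w z ^ m) \<longlonglongrightarrow> indicator {w} z"
      using AE_circle
    proof eventually_elim
      case (elim z)
      show ?case
      proof (cases "z = w")
        case False
        then have "bump w z < 1" by (simp add: bump_def)
        then show ?thesis using False bump_bounds[OF elim w] by (simp add: LIMSEQ_power_zero)
      qed (simp add: bump_def)
    qed
    show "AE z in M. norm (bump w z ^ m) \<le> 1" for m
      using AE_circle by eventually_elim (simp add: bump_bounds w power_le_one)
  qed simp
  then show ?thesis using sets_borel by simp
qed

text \<open>The moments converge to the mass at \<open>w\<close>; their consecutive differences, and
  with them the energy, tend to 0.\<close>

lemma exists_peak_comb:
  assumes w: "cmod w = 1" and e: "e > 0"
  obtains N c where "\<And>n. n \<ge> 2 * N \<Longrightarrow> c n = 0" "cmv_comb a c N w = 1"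
    "measure M {w} \<le> coeff_sq c N" "coeff_sq c N \<le> measure M {w} + e"
    "energy M w (cmv_comb a c N) \<le> e"
proof -
  define A where "A m = (\<integral>z. bump w z ^ m \<partial>M)" for m
  have A: "A \<longlonglongrightarrow> measure M {w}" unfolding A_def by (rule integral_bump_tendsto[OF w])
  have "(\<lambda>m. 4 * (A m - A (Suc m))) \<longlonglongrightarrow> 4 * (measure M {w} - measure M {w})"
    by (intro tendsto_intros A LIMSEQ_Suc)
  then have "\<forall>\<^sub>F m in sequentially. 4 * (A m - A (Suc m)) < e"
    using e by (intro order_tendstoD(2)) auto
  moreover have "\<forall>\<^sub>F m in sequentially. A m < measure M {w} + e"
    using e by (intro order_tendstoD(2)[OF A]) simp
  ultimately have "\<forall>\<^sub>F m in sequentially. 4 * (A m - A (Suc m)) < e \<and> A m < measure M {w} + e"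
    by eventually_elim simp
  then obtain m where m: "4 * (A m - A (Suc m)) < e" "A m < measure M {w} + e"
    using eventually_happens sequentially_bot by blast
  obtain N c where c: "\<And>n. n \<ge> 2 * N \<Longrightarrow> c n = 0" "cmv_comb a c N w = 1"
    and n: "coeff_sq c N = A m"
    and d: "energy M w (cmv_comb a c N) = 4 * (A m - A (Suc m))"
    using bump_power_comb[OF w, of m, folded A_def] by blast
  have "measure M {w} * (cmod (cmv_comb a c N w))\<^sup>2 \<le> coeff_sq c N"
    unfolding integral_norm_comb[symmetric] by (rule mass_le_integral) (auto intro!: continuous_intros cont_comb)
  then show ?thesis using that[of N c] c n d m by simp
qed

text \<open>One inequality comes from testing with the truncated reproducing kernel at
  \<open>w\<close>. The other is the Cauchy-Schwarz inequality for peaking combinations, which have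
  value 1 at \<open>w\<close> and squared norm close to the mass; no completeness of the CMV
  functions has to be established.\<close>

lemma sums_inverse_mass:
  assumes w: "cmod w = 1" and m: "measure M {w} > 0"
  shows "(\<lambda>n. (cmod (cmv_val a n w))\<^sup>2) sums (1 / measure M {w})"
proof -
  define k where "k N = (\<Sum>n<N. (cmod (cmv_val a n w))\<^sup>2)" for N
  have mono: "k N \<le> k L" if "N \<le> L" for N L
    unfolding k_def using that by (intro sum_mono2) auto
  have up: "k N \<le> 1 / measure M {w}" for N
  proof -
    define L where "L = Suc N"
    \<comment> \<open>The truncated reproducing kernel at \<open>w\<close>: its value at
      \<open>w\<close> and its squared norm are both \<open>k (2 * L)\<close>.\<close>
    define c where "c n = cnj (cmv_val a n w)" for n
    have cw: "cmv_comb a c L w = of_real (k (2 * L))"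
      by (simp add: cmv_comb_def c_def k_def complex_norm_square mult.commute del: of_real_power)
    have "k 1 \<le> k (2 * L)" by (rule mono) (simp add: L_def)
    then have k1: "k (2 * L) \<ge> 1" by (simp add: k_def cmv_val_def cmv_def)
    have "measure M {w} * (cmod (cmv_comb a c L w))\<^sup>2 \<le> coeff_sq c L"
      unfolding integral_norm_comb[symmetric] by (rule mass_le_integral) (auto intro!: continuous_intros cont_comb)
    also have "\<dots> = k (2 * L)" by (simp add: c_def k_def)
    finally have "(measure M {w} * k (2 * L)) * k (2 * L) \<le> 1 * k (2 * L)"
      by (simp add: cw power2_eq_square mult.assoc)
    then have "measure M {w} * k (2 * L) \<le> 1"
      using k1 by (subst (asm) mult_le_cancel_right) auto
    then have "k (2 * L) \<le> 1 / measure M {w}" using m by (simp add: field_simps)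
    then show ?thesis using mono[of N "2 * L"] by (simp add: L_def)
  qed
  have summ: "summable (\<lambda>n. (cmod (cmv_val a n w))\<^sup>2)"
    using up unfolding k_def by (intro summableI_nonneg_bounded) auto
  define K where "K = (\<Sum>n. (cmod (cmv_val a n w))\<^sup>2)"
  have "K \<le> 1 / measure M {w}"
    unfolding K_def using up unfolding k_def by (intro suminf_le_const summ)
  moreover have "1 / measure M {w} \<le> K"
  proof -
    have kK: "k N \<le> K" for N unfolding k_def K_def by (intro sum_le_suminf summ) auto
    then have K0: "K \<ge> 0" by (metis k_def sum.empty lessThan_0)
    have "1 \<le> (measure M {w} + e) * K" if e: "e > 0" for e
    proof -
      obtain N c where c: "cmv_comb a c N w = 1"
        and n: "coeff_sq c N \<le> measure M {w} + e"
        using exists_peak_comb[OF w e] by metis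
      have "1 = (cmod (\<Sum>n<2 * N. c n * cmv_val a n w))\<^sup>2" using c by (simp add: cmv_comb_def)
      also have "\<dots> \<le> (\<Sum>n<2 * N. cmod (c n) * cmod (cmv_val a n w))\<^sup>2"
        by (intro power_mono norm_ge_zero sum_norm_le) (simp add: norm_mult)
      also have "\<dots> \<le> coeff_sq c N * (\<Sum>n<2 * N. (cmod (cmv_val a n w))\<^sup>2)"
        by (rule Cauchy_Schwarz_ineq_sum)
      also have "\<dots> \<le> (measure M {w} + e) * K"
        using kK[of "2 * N"] unfolding k_def by (intro mult_mono n) (auto intro!: sum_nonneg add_nonneg_nonneg less_imp_le[OF e])
      finally show ?thesis .
    qed
    then have "1 \<le> measure M {w} * K + e * K" if "e > 0" for e using that by (simp add: distrib_right)
    moreover have "((\<lambda>e. measure M {w} * K + e * K) \<longlongrightarrow> measure M {w} * K + 0 * K) (at_right 0)"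
      by (intro tendsto_intros)
    ultimately have "1 \<le> measure M {w} * K + 0 * K"
      by (intro tendsto_lowerbound[where F = "at_right 0"]) (auto simp: eventually_at_right_less eventually_at_filter)
    then show ?thesis using m by (simp add: field_simps)
  qed
  ultimately show ?thesis using summ by (simp add: sums_iff K_def)
qed

end

section \<open>Isolated points of the support under perturbation\<close>

text \<open>Distance in the supremum norm. \<open>rho\<close> is not Lipschitz where parameters
  approach the circle, so its closeness is demanded separately.\<close>

definition params_close :: "real \<Rightarrow> (nat \<Rightarrow> complex) \<Rightarrow> (nat \<Rightarrow> complex) \<Rightarrow> bool" where
  "params_close \<eta> a a' \<longleftrightarrow>
     (\<forall>n\<ge>1. cmod (a n - a' n) \<le> \<eta> \<and> \<bar>rho (a n) - rho (a' n)\<bar> \<le> \<eta>)"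

text \<open>The norm terms agree for both measures, which leaves twice the difference of the forms:
  48 is 2 times 24.\<close>

lemma integral_dist_comb_diff:
  assumes M: "cmv_measure M a" and M': "cmv_measure M' a'" and close: "params_close \<eta> a a'"
    and c: "\<And>n. n \<ge> 2 * N \<Longrightarrow> c n = 0" and w: "cmod w = 1"
  shows "\<bar>energy M w (cmv_comb a c N)
      - energy M' w (cmv_comb a' c N)\<bar>
    \<le> 48 * \<eta> * coeff_sq c N"
proof -
  have I: "energy M w (cmv_comb a c N)
      = 2 * coeff_sq c N - 2 * Re (cnj w * cmv_form a c N)"
    by (rule cmv_measure.integral_dist_comb[OF M c w])
  have I': "energy M' w (cmv_comb a' c N)
      = 2 * coeff_sq c N - 2 * Re (cnj w * cmv_form a' c N)"
    by (rule cmv_measure.integral_dist_comb[OF M' c w])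
  have "cmod (cmv_form a c N - cmv_form a' c N) \<le> 24 * \<eta> * coeff_sq c N"
    by (rule cmv_form_diff_le)
      (use close c cmv_measure.params[OF M] cmv_measure.params[OF M'] in
        \<open>auto simp: params_close_def intro: less_imp_le\<close>)
  moreover have "\<bar>Re (cnj w * (cmv_form a c N - cmv_form a' c N))\<bar> \<le> cmod (cmv_form a c N - cmv_form a' c N)"
    using abs_Re_le_cmod[of "cnj w * (cmv_form a c N - cmv_form a' c N)"] w by (simp add: norm_mult)
  moreover have "Re (cnj w * (cmv_form a c N - cmv_form a' c N))
      = Re (cnj w * cmv_form a c N) - Re (cnj w * cmv_form a' c N)"
    by (simp add: algebra_simps)
  ultimately show ?thesis
    unfolding I I' by linarith
qed

text \<open>Without support in the ball every unit vector would have energy at least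
  \<open>\<epsilon>\<^sup>2\<close>. A vector concentrated at \<open>w\<close> has energy at most
  \<open>\<epsilon>\<^sup>2 / 4\<close>, and \<open>\<eta> = \<epsilon>\<^sup>2 / 200\<close> adds
  at most \<open>48 / 200\<close> of \<open>\<epsilon>\<^sup>2\<close>, in total less than half of
  it.\<close>

lemma support_meets_ball:
  assumes M: "cmv_measure M a" and w: "w \<in> measure_support M" and \<epsilon>: "\<epsilon> > 0"
  obtains \<eta> where "\<eta> > 0"
    and "\<And>M' a'. cmv_measure M' a' \<Longrightarrow> params_close \<eta> a a' \<Longrightarrow> measure_support M' \<inter> ball w \<epsilon> \<noteq> {}"
proof
  interpret M: cmv_measure M a by (rule M)
  have w1: "cmod w = 1" using measure_support_subset_circle[OF M.circle] w by auto
  show "\<epsilon>\<^sup>2 / 200 > 0" using \<epsilon> by simp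
  fix M' a' assume M': "cmv_measure M' a'" and close: "params_close (\<epsilon>\<^sup>2 / 200) a a'"
  interpret M': cmv_measure M' a' by (rule M')
  have \<epsilon>4: "\<epsilon>\<^sup>2 / 4 > 0" using \<epsilon> by simp
  obtain N c where c: "\<And>n. n \<ge> 2 * N \<Longrightarrow> c n = 0" and n: "coeff_sq c N = 1"
    and d: "energy M w (cmv_comb a c N) \<le> \<epsilon>\<^sup>2 / 4"
    using M.exists_concentrated_comb[OF w \<epsilon>4] by blast
  have d': "energy M' w (cmv_comb a' c N) < \<epsilon>\<^sup>2"
  proof -
    have "\<bar>energy M w (cmv_comb a c N)
        - energy M' w (cmv_comb a' c N)\<bar>
      \<le> 48 * (\<epsilon>\<^sup>2 / 200) * coeff_sq c N"
      by (rule integral_dist_comb_diff[OF M M' close c w1])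
    moreover have "\<epsilon>\<^sup>2 > 0" using \<epsilon> by simp
    ultimately show ?thesis using d unfolding n by linarith
  qed
  show "measure_support M' \<inter> ball w \<epsilon> \<noteq> {}"
  proof
    assume empty: "measure_support M' \<inter> ball w \<epsilon> = {}"
    have "\<epsilon>\<^sup>2 * 1 = (\<integral>z. \<epsilon>\<^sup>2 * (cmod (cmv_comb a' c N z))\<^sup>2 \<partial>M')"
      by (simp only: integral_mult_right_zero M'.integral_norm_comb n)
    also have "\<dots> \<le> energy M' w (cmv_comb a' c N)"
    proof (rule integral_mono_AE)
      show "AE z in M'. \<epsilon>\<^sup>2 * (cmod (cmv_comb a' c N z))\<^sup>2 \<le> (cmod (z - w))\<^sup>2 * (cmod (cmv_comb a' c N z))\<^sup>2"
        using M'.AE_support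
      proof eventually_elim
        case (elim z)
        then have "\<epsilon> \<le> cmod (z - w)" using empty by (force simp: dist_norm norm_minus_commute)
        then show ?case using \<epsilon> by (intro mult_right_mono power_mono) auto
      qed
    qed (intro M'.integrable continuous_intros M'.cont_comb)+
    finally show False using d' by simp
  qed
qed

lemma norm_add_squared_le: "(norm (x + y))\<^sup>2 \<le> 2 * (norm x)\<^sup>2 + 2 * (norm y)\<^sup>2"
proof -
  have "(norm (x + y))\<^sup>2 \<le> (norm x + norm y)\<^sup>2" by (intro power_mono norm_triangle_ineq) simp
  also have "\<dots> \<le> 2 * (norm x)\<^sup>2 + 2 * (norm y)\<^sup>2"
    using sum_squares_bound[of "norm x" "norm y"] by (simp add: power2_sum)
  finally show ?thesis .
qed

text \<open>\<open>w - w'\<close> is the difference of \<open>z - w'\<close> and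
  \<open>z - w\<close>, and each part is charged to the function concentrated at its own point. The
  weights in \<open>amgm\<close> balance a factor of size \<open>\<epsilon>\<close> against one of
  size 1.\<close>

lemma (in cmv_measure) concentrated_almost_orthogonal:
  assumes f: "continuous_on UNIV f" "integral_sq M f = 1"
      "energy M w f \<le> \<epsilon>\<^sup>2"
    and g: "continuous_on UNIV g" "integral_sq M g = 1"
      "energy M w' g \<le> \<epsilon>\<^sup>2"
    and \<epsilon>: "\<epsilon> > 0"
  shows "cmod (w - w') * cmod (\<integral>z. f z * cnj (g z) \<partial>M) \<le> 2 * \<epsilon>"
proof -
  note ci = continuous_intros f(1) g(1)
  have amgm: "2 * (x * y) \<le> x\<^sup>2 / \<epsilon> + \<epsilon> * y\<^sup>2" for x y :: real
  proof -
    have "0 \<le> (x - \<epsilon> * y)\<^sup>2 / \<epsilon>" using \<epsilon> by simp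
    also have "\<dots> = x\<^sup>2 / \<epsilon> + \<epsilon> * y\<^sup>2 - 2 * (x * y)"
      using \<epsilon> by (simp add: power2_eq_square field_simps)
    finally show ?thesis by simp
  qed
  have "cmod (w - w') * cmod (\<integral>z. f z * cnj (g z) \<partial>M) = cmod (\<integral>z. (w - w') * (f z * cnj (g z)) \<partial>M)"
    by (simp only: integral_mult_right_zero norm_mult)
  also have "\<dots> \<le> (\<integral>z. cmod ((w - w') * (f z * cnj (g z))) \<partial>M)"
    by (rule integral_norm_bound)
  also have "\<dots> \<le> (\<integral>z. ((cmod (z - w))\<^sup>2 * (cmod (f z))\<^sup>2 / \<epsilon> + \<epsilon> * (cmod (g z))\<^sup>2
      + (cmod (z - w'))\<^sup>2 * (cmod (g z))\<^sup>2 / \<epsilon> + \<epsilon> * (cmod (f z))\<^sup>2) / 2 \<partial>M)"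
  proof (rule integral_mono)
    fix z
    have "cmod (w - w') \<le> cmod (z - w) + cmod (z - w')"
      using norm_triangle_ineq4[of "z - w'" "z - w"] by simp
    then have "cmod ((w - w') * (f z * cnj (g z))) \<le> (cmod (z - w) + cmod (z - w')) * (cmod (f z) * cmod (g z))"
      unfolding norm_mult complex_mod_cnj by (intro mult_right_mono) auto
    also have "\<dots> = (cmod (z - w) * cmod (f z)) * cmod (g z) + (cmod (z - w') * cmod (g z)) * cmod (f z)"
      by (simp add: algebra_simps)
    finally show "cmod ((w - w') * (f z * cnj (g z))) \<le>
        ((cmod (z - w))\<^sup>2 * (cmod (f z))\<^sup>2 / \<epsilon> + \<epsilon> * (cmod (g z))\<^sup>2
      + (cmod (z - w'))\<^sup>2 * (cmod (g z))\<^sup>2 / \<epsilon> + \<epsilon> * (cmod (f z))\<^sup>2) / 2"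
      using amgm[of "cmod (z - w) * cmod (f z)" "cmod (g z)"] amgm[of "cmod (z - w') * cmod (g z)" "cmod (f z)"]
      unfolding power_mult_distrib by simp
  qed (use \<epsilon> in \<open>intro integrable ci; simp\<close>)+
  also have "\<dots> = (energy M w f / \<epsilon> + \<epsilon> * integral_sq M g
      + energy M w' g / \<epsilon> + \<epsilon> * integral_sq M f) / 2"
  proof -
    have "integrable M (\<lambda>z. (cmod (z - w))\<^sup>2 * (cmod (f z))\<^sup>2)" "integrable M (\<lambda>z. (cmod (g z))\<^sup>2)"
      "integrable M (\<lambda>z. (cmod (z - w'))\<^sup>2 * (cmod (g z))\<^sup>2)" "integrable M (\<lambda>z. (cmod (f z))\<^sup>2)"
      by (intro integrable ci)+
    then show ?thesis by simp
  qed
  also have "\<dots> \<le> (\<epsilon>\<^sup>2 / \<epsilon> + \<epsilon> * 1 + \<epsilon>\<^sup>2 / \<epsilon> + \<epsilon> * 1) / 2"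
    unfolding f(2) g(2) using \<epsilon> by (intro divide_right_mono add_mono f(3) g(3)) auto
  also have "\<dots> = 2 * \<epsilon>" using \<epsilon> by (simp add: power2_eq_square)
  finally show ?thesis .
qed

text \<open>Two support points near \<open>l\<close> would give a two-dimensional space of vectors concentrated near
  \<open>l\<close>, hence one that, for the original measure, vanishes at the isolated point \<open>l\<close>.\<close>

lemma support_point_near_isolated_unique:
  assumes M: "cmv_measure M a" and l: "cmod l = 1" and \<delta>: "\<delta> > 0" "measure_support M \<inter> ball l \<delta> \<subseteq> {l}"
    and M': "cmv_measure M' a'" and close: "params_close (\<delta>\<^sup>2 / 192) a a'"
    and w: "w \<in> measure_support M' \<inter> ball l (\<delta> / 8)" and w': "w' \<in> measure_support M' \<inter> ball l (\<delta> / 8)"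
  shows "w = w'"
proof (rule ccontr)
  assume ne: "w \<noteq> w'"
  interpret M: cmv_measure M a by (rule M)
  interpret M': cmv_measure M' a' by (rule M')
  \<comment> \<open>The first bound keeps the energies small compared with
    \<open>\<delta>\<^sup>2\<close>; the second makes the inner product of \<open>f\<close> and
    \<open>g\<close> at most \<open>1 / 2\<close>.\<close>
  define \<epsilon> where "\<epsilon> = min (\<delta> / 8) (cmod (w - w') / 4)"
  have \<epsilon>: "\<epsilon> > 0" using \<delta> ne by (simp add: \<epsilon>_def)
  have \<epsilon>2: "\<epsilon>\<^sup>2 > 0" using \<epsilon> by simp
  obtain N1 c where c: "\<And>n. n \<ge> 2 * N1 \<Longrightarrow> c n = 0" "coeff_sq c N1 = 1"
    "energy M' w (cmv_comb a' c N1) \<le> \<epsilon>\<^sup>2"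
    using M'.exists_concentrated_comb[OF _ \<epsilon>2, of w] w by blast
  obtain N2 d where d: "\<And>n. n \<ge> 2 * N2 \<Longrightarrow> d n = 0" "coeff_sq d N2 = 1"
    "energy M' w' (cmv_comb a' d N2) \<le> \<epsilon>\<^sup>2"
    using M'.exists_concentrated_comb[OF _ \<epsilon>2, of w'] w' by blast
  define N where "N = max N1 N2"
  have c0: "c n = 0" and d0: "d n = 0" if "n \<ge> 2 * N" for n
    using c(1)[of n] d(1)[of n] that by (auto simp: N_def)
  have cN: "cmv_comb b c N1 z = cmv_comb b c N z" for b z
    unfolding cmv_comb_def by (rule sum.mono_neutral_left) (auto simp: N_def c(1))
  have dN: "cmv_comb b d N2 z = cmv_comb b d N z" for b z
    unfolding cmv_comb_def by (rule sum.mono_neutral_left) (auto simp: N_def d(1))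
  define f where "f = cmv_comb a' c N"
  define g where "g = cmv_comb a' d N"
  have cont: "continuous_on UNIV f" "continuous_on UNIV g"
    unfolding f_def g_def by (rule M'.cont_comb)+
  have f: "integral_sq M' f = 1" "energy M' w f \<le> \<epsilon>\<^sup>2"
    using M'.integral_norm_comb[of c N1] c(2,3) by (simp_all add: f_def cN)
  have g: "integral_sq M' g = 1" "energy M' w' g \<le> \<epsilon>\<^sup>2"
    using M'.integral_norm_comb[of d N2] d(2,3) by (simp_all add: g_def dN)
  note ci = continuous_intros cont
  have ortho: "cmod (\<integral>z. f z * cnj (g z) \<partial>M') \<le> 1 / 2"
  proof -
    have "cmod (w - w') * cmod (\<integral>z. f z * cnj (g z) \<partial>M') \<le> 2 * \<epsilon>"
      by (rule M'.concentrated_almost_orthogonal[OF cont(1) f cont(2) g \<epsilon>])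
    also have "\<dots> \<le> cmod (w - w') * (1 / 2)" by (simp add: \<epsilon>_def)
    finally show ?thesis using ne by (subst (asm) mult_le_cancel_left) auto
  qed
  define p where "p = cmv_comb a c N l"
  define q where "q = cmv_comb a d N l"
  \<comment> \<open>A unit vector annihilating the values at \<open>l\<close>. \<open>p\<close> and
    \<open>q\<close> are formed with the original parameters \<open>a\<close>, whereas
    \<open>f\<close> and \<open>g\<close> belong to \<open>a'\<close>.\<close>
  obtain x y where xy: "x * p + y * q = 0" "(cmod x)\<^sup>2 + (cmod y)\<^sup>2 = 1"
  proof (cases "p = 0 \<and> q = 0")
    case True
    then show ?thesis using that[of 1 0] by simp
  next
    case False
    define k where "k = sqrt ((cmod p)\<^sup>2 + (cmod q)\<^sup>2)"
    have k: "k\<^sup>2 = (cmod p)\<^sup>2 + (cmod q)\<^sup>2" by (simp add: k_def)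
    have k0: "k \<noteq> 0" using False by (auto simp: k_def add_nonneg_eq_0_iff)
    show ?thesis
    proof (rule that[of "q / of_real k" "- p / of_real k"])
      have "(cmod (q / of_real k))\<^sup>2 + (cmod (- p / of_real k))\<^sup>2 = ((cmod p)\<^sup>2 + (cmod q)\<^sup>2) / k\<^sup>2"
        by (simp add: norm_divide power_divide add_divide_distrib)
      then show "(cmod (q / of_real k))\<^sup>2 + (cmod (- p / of_real k))\<^sup>2 = 1"
        using k0 by (simp flip: k)
    qed simp
  qed
  define e where "e n = x * c n + y * d n" for n
  have e0: "e n = 0" if "n \<ge> 2 * N" for n using c0 d0 that by (simp add: e_def)
  have comb_e: "cmv_comb b e N z = x * cmv_comb b c N z + y * cmv_comb b d N z" for b z
    by (simp add: cmv_comb_def e_def sum_distrib_left sum.distrib algebra_simps)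
  define H where "H = coeff_sq e N"
  \<comment> \<open>\<open>cmod x * cmod y\<close> and the inner product are both at most
    \<open>1 / 2\<close>, so the cross term costs at most half of the norm.\<close>
  have H_ge: "H \<ge> 1 / 2"
  proof -
    have "H = (\<integral>z. (cmod (x * f z + y * g z))\<^sup>2 \<partial>M')"
      unfolding H_def M'.integral_norm_comb[symmetric] comb_e f_def g_def ..
    also have "\<dots> = (\<integral>z. (cmod x)\<^sup>2 * (cmod (f z))\<^sup>2 + (cmod y)\<^sup>2 * (cmod (g z))\<^sup>2
        + 2 * Re (x * cnj y * (f z * cnj (g z))) \<partial>M')"
    proof (rule Bochner_Integration.integral_cong[OF refl])
      fix z
      have "(cmod (u + v))\<^sup>2 = (cmod u)\<^sup>2 + (cmod v)\<^sup>2 + 2 * Re (u * cnj v)" for u v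
        unfolding cmod_power2 by (simp add: power2_eq_square algebra_simps)
      from this[of "x * f z" "y * g z"]
      show "(cmod (x * f z + y * g z))\<^sup>2 = (cmod x)\<^sup>2 * (cmod (f z))\<^sup>2 + (cmod y)\<^sup>2 * (cmod (g z))\<^sup>2
        + 2 * Re (x * cnj y * (f z * cnj (g z)))"
        by (simp only: norm_mult power_mult_distrib complex_cnj_mult mult_ac)
    qed
    also have "\<dots> = (cmod x)\<^sup>2 * integral_sq M' f + (cmod y)\<^sup>2 * integral_sq M' g
        + 2 * Re (x * cnj y * (\<integral>z. f z * cnj (g z) \<partial>M'))"
    proof -
      have i: "integrable M' (\<lambda>z. x * cnj y * (f z * cnj (g z)))" by (intro M'.integrable ci)
      have "(\<integral>z. Re (x * cnj y * (f z * cnj (g z))) \<partial>M') = Re (x * cnj y * (\<integral>z. f z * cnj (g z) \<partial>M'))"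
        unfolding integral_Re[OF i] by simp
      moreover have "integrable M' (\<lambda>z. (cmod x)\<^sup>2 * (cmod (f z))\<^sup>2)" "integrable M' (\<lambda>z. (cmod y)\<^sup>2 * (cmod (g z))\<^sup>2)"
        "integrable M' (\<lambda>z. 2 * Re (x * cnj y * (f z * cnj (g z))))"
        by (intro M'.integrable ci)+
      ultimately show ?thesis
        by (simp only: Bochner_Integration.integral_add Bochner_Integration.integrable_add integral_mult_right_zero)
    qed
    also have "\<dots> = 1 + 2 * Re (x * cnj y * (\<integral>z. f z * cnj (g z) \<partial>M'))"
      using xy(2) f(1) g(1) by simp
    also have "\<dots> \<ge> 1 / 2"
    proof -
      have "\<bar>Re (x * cnj y * (\<integral>z. f z * cnj (g z) \<partial>M'))\<bar> \<le> (cmod x * cmod y) * cmod (\<integral>z. f z * cnj (g z) \<partial>M')"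
        using abs_Re_le_cmod[of "x * cnj y * (\<integral>z. f z * cnj (g z) \<partial>M')"] by (simp add: norm_mult)
      also have "\<dots> \<le> (1 / 2) * (1 / 2)"
      proof (intro mult_mono ortho)
        show "cmod x * cmod y \<le> 1 / 2" using sum_squares_bound[of "cmod x" "cmod y"] xy(2) by simp
      qed auto
      finally show ?thesis by linarith
    qed
    finally show ?thesis .
  qed
  \<comment> \<open>Moving the centre from \<open>v\<close> to \<open>l\<close> doubles the energy
    and adds \<open>2 * (\<delta> / 8)\<^sup>2 = \<delta>\<^sup>2 / 32\<close>.\<close>
  have near: "energy M' l h \<le> 2 * \<epsilon>\<^sup>2 + \<delta>\<^sup>2 / 32"
    if h: "continuous_on UNIV h" "integral_sq M' h = 1"
      "energy M' v h \<le> \<epsilon>\<^sup>2" and v: "v \<in> ball l (\<delta> / 8)" for h v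
  proof -
    have "cmod (v - l) \<le> \<delta> / 8" using v by (simp add: dist_norm norm_minus_commute)
    then have vl: "(cmod (v - l))\<^sup>2 \<le> (\<delta> / 8)\<^sup>2" by (intro power_mono) auto
    have "energy M' l h
        \<le> (\<integral>z. 2 * ((cmod (z - v))\<^sup>2 * (cmod (h z))\<^sup>2) + \<delta>\<^sup>2 / 32 * (cmod (h z))\<^sup>2 \<partial>M')"
    proof (rule integral_mono)
      fix z
      have "(cmod (z - l))\<^sup>2 \<le> 2 * (cmod (z - v))\<^sup>2 + 2 * (cmod (v - l))\<^sup>2"
        using norm_add_squared_le[of "z - v" "v - l"] by simp
      then have "(cmod (z - l))\<^sup>2 \<le> 2 * (cmod (z - v))\<^sup>2 + \<delta>\<^sup>2 / 32"
        using vl by (simp add: power_divide)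
      then have "(cmod (z - l))\<^sup>2 * (cmod (h z))\<^sup>2 \<le> (2 * (cmod (z - v))\<^sup>2 + \<delta>\<^sup>2 / 32) * (cmod (h z))\<^sup>2"
        by (rule mult_right_mono) simp
      then show "(cmod (z - l))\<^sup>2 * (cmod (h z))\<^sup>2
          \<le> 2 * ((cmod (z - v))\<^sup>2 * (cmod (h z))\<^sup>2) + \<delta>\<^sup>2 / 32 * (cmod (h z))\<^sup>2"
        by (simp only: distrib_right mult.assoc)
    qed (intro M'.integrable ci h(1); simp)+
    also have "\<dots> = 2 * energy M' v h + \<delta>\<^sup>2 / 32 * integral_sq M' h"
      by (intro M'.integral_lincomb ci h(1))
    also have "\<dots> \<le> 2 * \<epsilon>\<^sup>2 + \<delta>\<^sup>2 / 32" using h by simp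
    finally show ?thesis .
  qed
  have "energy M' l (cmv_comb a' e N)
      \<le> (\<integral>z. 2 * (cmod x)\<^sup>2 * ((cmod (z - l))\<^sup>2 * (cmod (f z))\<^sup>2) + 2 * (cmod y)\<^sup>2 * ((cmod (z - l))\<^sup>2 * (cmod (g z))\<^sup>2) \<partial>M')"
  proof (rule integral_mono)
    fix z
    have "(cmod (x * f z + y * g z))\<^sup>2 \<le> 2 * ((cmod x)\<^sup>2 * (cmod (f z))\<^sup>2) + 2 * ((cmod y)\<^sup>2 * (cmod (g z))\<^sup>2)"
      using norm_add_squared_le[of "x * f z" "y * g z"] by (simp only: norm_mult power_mult_distrib)
    then have "(cmod (z - l))\<^sup>2 * (cmod (cmv_comb a' e N z))\<^sup>2
      \<le> (cmod (z - l))\<^sup>2 * (2 * ((cmod x)\<^sup>2 * (cmod (f z))\<^sup>2) + 2 * ((cmod y)\<^sup>2 * (cmod (g z))\<^sup>2))"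
      unfolding comb_e f_def[symmetric] g_def[symmetric] by (intro mult_left_mono) auto
    then show "(cmod (z - l))\<^sup>2 * (cmod (cmv_comb a' e N z))\<^sup>2
      \<le> 2 * (cmod x)\<^sup>2 * ((cmod (z - l))\<^sup>2 * (cmod (f z))\<^sup>2) + 2 * (cmod y)\<^sup>2 * ((cmod (z - l))\<^sup>2 * (cmod (g z))\<^sup>2)"
      by (simp add: algebra_simps)
  qed (intro M'.integrable ci M'.cont_comb; simp)+
  also have "\<dots> = 2 * (cmod x)\<^sup>2 * energy M' l f
      + 2 * (cmod y)\<^sup>2 * energy M' l g"
    by (intro M'.integral_lincomb ci)
  also have "\<dots> \<le> 2 * (cmod x)\<^sup>2 * (2 * \<epsilon>\<^sup>2 + \<delta>\<^sup>2 / 32) + 2 * (cmod y)\<^sup>2 * (2 * \<epsilon>\<^sup>2 + \<delta>\<^sup>2 / 32)"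
    using w w' by (intro add_mono mult_left_mono near[OF cont(1) f] near[OF cont(2) g]) auto
  also have "\<dots> = 2 * (2 * \<epsilon>\<^sup>2 + \<delta>\<^sup>2 / 32) * ((cmod x)\<^sup>2 + (cmod y)\<^sup>2)" by (simp add: algebra_simps)
  also have "\<dots> = 4 * \<epsilon>\<^sup>2 + \<delta>\<^sup>2 / 16" by (simp add: xy(2))
  also have "\<dots> \<le> \<delta>\<^sup>2 / 8"
  proof -
    have "\<epsilon>\<^sup>2 \<le> (\<delta> / 8)\<^sup>2" using \<epsilon> by (intro power_mono) (auto simp: \<epsilon>_def)
    then show ?thesis by (simp add: power_divide)
  qed
  \<comment> \<open>For the original measure the energy at \<open>l\<close> is at least
    \<open>\<delta>\<^sup>2 * H\<close>: the combination vanishes at \<open>l\<close>, and the rest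
    of the support has distance at least \<open>\<delta>\<close>. The two energies differ by at most
    \<open>\<delta>\<^sup>2 * H / 4\<close>, so \<open>H \<le> 1 / 6\<close>, against
    \<open>H_ge\<close>.\<close>
  finally have up': "energy M' l (cmv_comb a' e N) \<le> \<delta>\<^sup>2 / 8" .
  have "\<delta>\<^sup>2 * H = (\<integral>z. \<delta>\<^sup>2 * (cmod (cmv_comb a e N z))\<^sup>2 \<partial>M)"
    by (simp only: integral_mult_right_zero M.integral_norm_comb H_def)
  also have "\<dots> \<le> energy M l (cmv_comb a e N)"
  proof (rule integral_mono_AE)
    show "AE z in M. \<delta>\<^sup>2 * (cmod (cmv_comb a e N z))\<^sup>2 \<le> (cmod (z - l))\<^sup>2 * (cmod (cmv_comb a e N z))\<^sup>2"
      using M.AE_support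
    proof eventually_elim
      case (elim z)
      show ?case
      proof (cases "z = l")
        case True
        then show ?thesis using xy(1) by (simp add: comb_e p_def q_def)
      next
        case False
        then have "\<delta> \<le> cmod (z - l)" using elim \<delta> by (force simp: dist_norm norm_minus_commute)
        then show ?thesis using \<delta> by (intro mult_right_mono power_mono) auto
      qed
    qed
  qed (intro M.integrable continuous_intros M.cont_comb)+
  also have "\<dots> \<le> \<delta>\<^sup>2 / 8 + 48 * (\<delta>\<^sup>2 / 192) * H"
  proof -
    have "\<bar>energy M l (cmv_comb a e N)
        - energy M' l (cmv_comb a' e N)\<bar> \<le> 48 * (\<delta>\<^sup>2 / 192) * H"
      unfolding H_def by (rule integral_dist_comb_diff[OF M M' close e0 l])
    then show ?thesis using up' by linarith
  qed
  finally have "\<delta>\<^sup>2 * (3 / 4 * H) \<le> \<delta>\<^sup>2 * (1 / 8)" by (simp add: algebra_simps)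
  then have "3 / 4 * H \<le> 1 / 8" using \<delta>(1) by (subst (asm) mult_le_cancel_left) auto
  then show False using H_ge by simp
qed

text \<open>This yields the lower semicontinuity of the mass of an isolated point.\<close>

lemma mass_lower_bound_nearby:
  assumes M: "cmv_measure M a" and l: "cmod l = 1" and e: "e > 0" and \<gamma>: "\<gamma> > 0"
  obtains N c where "cmv_comb a c N l = 1"
    and "\<And>M' a' \<eta> l'. cmv_measure M' a' \<Longrightarrow> params_close \<eta> a a' \<Longrightarrow> \<eta> \<ge> 0 \<Longrightarrow>
        measure_support M' \<inter> ball l \<gamma> \<subseteq> {l'} \<Longrightarrow>
        measure M {l} - (e + 48 * \<eta> * (measure M {l} + e)) / \<gamma>\<^sup>2 \<le> measure M' {l'} * (cmod (cmv_comb a' c N l'))\<^sup>2"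
proof -
  interpret M: cmv_measure M a by (rule M)
  obtain N c where c: "\<And>n. n \<ge> 2 * N \<Longrightarrow> c n = 0" "cmv_comb a c N l = 1"
    "measure M {l} \<le> coeff_sq c N" "coeff_sq c N \<le> measure M {l} + e"
    "energy M l (cmv_comb a c N) \<le> e"
    using M.exists_peak_comb[OF l e] by blast
  show ?thesis
  proof (rule that[OF c(2)])
    fix M' a' \<eta> l' assume M': "cmv_measure M' a'" and close: "params_close \<eta> a a'" and \<eta>: "\<eta> \<ge> (0::real)"
      and iso: "measure_support M' \<inter> ball l \<gamma> \<subseteq> {l'}"
    interpret M': cmv_measure M' a' by (rule M')
    let ?f = "cmv_comb a' c N"
    have i1: "integrable M' (\<lambda>z. indicator {l'} z * (cmod (?f l'))\<^sup>2)"
      using M'.sets_borel by (intro integrable_mult_left integrable_real_indicator) (auto simp: M'.emeasure_eq_measure)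
    have i2: "integrable M' (\<lambda>z. (cmod (z - l))\<^sup>2 * (cmod (?f z))\<^sup>2 / \<gamma>\<^sup>2)"
      using \<gamma> by (intro M'.integrable continuous_intros M'.cont_comb) auto
    have "measure M {l} \<le> integral_sq M' ?f" unfolding M'.integral_norm_comb by (rule c(3))
    \<comment> \<open>Inside the ball only \<open>l'\<close> belongs to the support; outside it
      \<open>(cmod (z - l))\<^sup>2 / \<gamma>\<^sup>2\<close> is at least 1.\<close>
    also have "\<dots> \<le> (\<integral>z. indicator {l'} z * (cmod (?f l'))\<^sup>2 + (cmod (z - l))\<^sup>2 * (cmod (?f z))\<^sup>2 / \<gamma>\<^sup>2 \<partial>M')"
    proof (rule integral_mono_AE)
      show "AE z in M'. (cmod (?f z))\<^sup>2 \<le> indicator {l'} z * (cmod (?f l'))\<^sup>2 + (cmod (z - l))\<^sup>2 * (cmod (?f z))\<^sup>2 / \<gamma>\<^sup>2"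
        using M'.AE_support
      proof eventually_elim
        case (elim z)
        show ?case
        proof (cases "z = l'")
          case False
          then have "\<gamma> \<le> cmod (z - l)" using elim iso by (force simp: dist_norm norm_minus_commute)
          then have "\<gamma>\<^sup>2 * (cmod (?f z))\<^sup>2 \<le> (cmod (z - l))\<^sup>2 * (cmod (?f z))\<^sup>2"
            using \<gamma> by (intro mult_right_mono power_mono) auto
          then show ?thesis using \<gamma> False by (simp add: pos_le_divide_eq mult.commute)
        qed simp
      qed
    qed (use i1 i2 in \<open>auto intro!: M'.integrable continuous_intros M'.cont_comb\<close>)
    also have "\<dots> = measure M' {l'} * (cmod (?f l'))\<^sup>2 + energy M' l ?f / \<gamma>\<^sup>2"
      using i1 i2 M'.sets_borel by simp
    also have "energy M' l ?f / \<gamma>\<^sup>2 \<le> (e + 48 * \<eta> * (measure M {l} + e)) / \<gamma>\<^sup>2"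
    proof (rule divide_right_mono)
      have D: "\<bar>energy M l (cmv_comb a c N)
          - energy M' l ?f\<bar> \<le> 48 * \<eta> * coeff_sq c N"
        by (rule integral_dist_comb_diff[OF M M' close c(1) l])
      have "48 * \<eta> * coeff_sq c N \<le> 48 * \<eta> * (measure M {l} + e)"
        using \<eta> by (intro mult_left_mono c(4)) auto
      then show "energy M' l ?f \<le> e + 48 * \<eta> * (measure M {l} + e)"
        using D c(5) by linarith
    qed simp
    finally show "measure M {l} - (e + 48 * \<eta> * (measure M {l} + e)) / \<gamma>\<^sup>2 \<le> measure M' {l'} * (cmod (?f l'))\<^sup>2"
      by simp
  qed
qed

section \<open>Continuity of the values, the isolated point and its mass\<close>

lemma tendsto_rho: "(f \<longlongrightarrow> x) F \<Longrightarrow> ((\<lambda>t. rho (f t)) \<longlongrightarrow> rho x) F"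
  unfolding rho_def by (intro tendsto_intros)

lemma tendsto_szego_val:
  assumes "\<And>m. m \<ge> 1 \<Longrightarrow> m \<le> n \<Longrightarrow> ((\<lambda>t. A t m) \<longlongrightarrow> a m) F" "(z \<longlongrightarrow> w) F"
    and "\<And>m. m \<ge> 1 \<Longrightarrow> m \<le> n \<Longrightarrow> cmod (a m) < 1"
  shows "((\<lambda>t. szego_val (A t) n (z t)) \<longlongrightarrow> szego_val a n w) F"
  using assms
proof (induction n)
  case (Suc n)
  have "rho (a (Suc n)) \<noteq> 0" using rho_pos[of "a (Suc n)"] Suc.prems(3)[of "Suc n"] by simp
  then show ?case
    unfolding szego_val.simps
    by (intro tendsto_intros tendsto_rho Suc) (use Suc.prems in auto)
qed simp

lemma tendsto_cmv:
  assumes "(z \<longlongrightarrow> w) F" "((\<lambda>t. b t n) \<longlongrightarrow> b' n) F"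
  shows "((\<lambda>t. cmv (z t) (b t) n) \<longlongrightarrow> cmv w b' n) F"
  unfolding cmv_def by (cases "even n") (auto intro!: tendsto_intros assms)

lemma tendsto_cmv_val:
  assumes "\<And>m. m \<ge> 1 \<Longrightarrow> ((\<lambda>t. A t m) \<longlongrightarrow> a m) F" "(z \<longlongrightarrow> w) F"
    and "\<And>m. m \<ge> 1 \<Longrightarrow> cmod (a m) < 1"
  shows "((\<lambda>t. cmv_val (A t) n (z t)) \<longlongrightarrow> cmv_val a n w) F"
  unfolding cmv_val_def by (intro tendsto_cmv tendsto_szego_val assms)

text \<open>\<open>close\<close> is continuity of the parameters, uniform in the index. Of
  \<open>l\<close> nothing is asked but that it be the only support point in the fixed open set
  \<open>B\<close>; its continuity is derived.\<close>

locale cmv_family =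
  fixes J :: "real set" and \<mu> :: "real \<Rightarrow> complex measure" and A :: "real \<Rightarrow> nat \<Rightarrow> complex"
    and B :: "complex set" and l :: "real \<Rightarrow> complex"
  assumes cmv: "\<And>t. t \<in> J \<Longrightarrow> cmv_measure (\<mu> t) (A t)"
    and close: "\<And>s \<eta>. s \<in> J \<Longrightarrow> \<eta> > 0 \<Longrightarrow> \<forall>\<^sub>F t in at s within J. params_close \<eta> (A s) (A t)"
    and B: "open B" and iso: "\<And>t. t \<in> J \<Longrightarrow> measure_support (\<mu> t) \<inter> B = {l t}"
begin

lemma eventually_in_J: "\<forall>\<^sub>F t in at s within J. t \<in> J"
  by (simp add: eventually_at_filter)

lemma l_in: "t \<in> J \<Longrightarrow> l t \<in> measure_support (\<mu> t)" "t \<in> J \<Longrightarrow> l t \<in> B"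
  using iso by blast+

lemma norm_l: "t \<in> J \<Longrightarrow> cmod (l t) = 1"
  using measure_support_subset_circle[OF cmv_measure.circle[OF cmv]] l_in(1) by fastforce

text \<open>Support persists in every small ball around \<open>l s\<close>; as soon as the ball lies
  in \<open>B\<close>, the support point found there can only be \<open>l t\<close>.\<close>

lemma l_tendsto:
  assumes s: "s \<in> J"
  shows "(l \<longlongrightarrow> l s) (at s within J)"
proof (rule tendstoI)
  fix \<epsilon> :: real assume \<epsilon>: "\<epsilon> > 0"
  obtain \<epsilon>' where \<epsilon>': "\<epsilon>' > 0" "ball (l s) \<epsilon>' \<subseteq> B" 
    using B l_in(2)[OF s] openE by blast
  obtain \<eta> where \<eta>: "\<eta> > 0" and m: "\<And>M' a'. cmv_measure M' a' \<Longrightarrow> params_close \<eta> (A s) a' \<Longrightarrow>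
      measure_support M' \<inter> ball (l s) (min \<epsilon> \<epsilon>') \<noteq> {}"
    using support_meets_ball[OF cmv[OF s] l_in(1)[OF s], of "min \<epsilon> \<epsilon>'"] \<epsilon> \<epsilon>'(1) by (metis min_less_iff_conj)
  show "\<forall>\<^sub>F t in at s within J. dist (l t) (l s) < \<epsilon>"
    using close[OF s \<eta>] eventually_in_J
  proof eventually_elim
    case (elim t)
    from m[OF cmv[OF elim(2)] elim(1)] have "\<exists>v. v \<in> measure_support (\<mu> t) \<and> dist (l s) v < min \<epsilon> \<epsilon>'"
      unfolding ball_def by blast
    then obtain v where v: "v \<in> measure_support (\<mu> t)" "dist (l s) v < min \<epsilon> \<epsilon>'"
      by blast
    then have "v \<in> B" using \<epsilon>'(2) by auto
    then have "v = l t" using v(1) iso[OF elim(2)] by blast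
    then show ?case using v(2) by (simp add: dist_commute)
  qed
qed

lemma A_tendsto:
  assumes s: "s \<in> J" and n: "n \<ge> 1"
  shows "((\<lambda>t. A t n) \<longlongrightarrow> A s n) (at s within J)"
proof (rule tendstoI)
  fix \<epsilon> :: real assume "\<epsilon> > 0"
  then have "\<forall>\<^sub>F t in at s within J. params_close (\<epsilon> / 2) (A s) (A t)" by (intro close[OF s]) simp
  then show "\<forall>\<^sub>F t in at s within J. dist (A t n) (A s n) < \<epsilon>"
  proof eventually_elim
    case (elim t)
    then have "cmod (A s n - A t n) \<le> \<epsilon> / 2" using n by (simp add: params_close_def)
    then show ?case using \<open>\<epsilon> > 0\<close> by (simp add: dist_norm norm_minus_commute)
  qed
qed

lemma val_tendsto:
  assumes s: "s \<in> J"
  shows "((\<lambda>t. cmv_val (A t) n (l t)) \<longlongrightarrow> cmv_val (A s) n (l s)) (at s within J)"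
  by (rule tendsto_cmv_val[OF A_tendsto[OF s] l_tendsto[OF s] cmv_measure.params[OF cmv[OF s]]])

lemma mass_pos:
  assumes t: "t \<in> J"
  shows "measure (\<mu> t) {l t} > 0"
proof -
  interpret cmv_measure "\<mu> t" "A t" by (rule cmv[OF t])
  show ?thesis
    by (rule isolated_support_point_mass_pos[OF _ sets_borel B iso[OF t]]) unfold_locales
qed

lemma sums_mass:
  assumes t: "t \<in> J"
  shows "(\<lambda>n. (cmod (cmv_val (A t) n (l t)))\<^sup>2) sums (1 / measure (\<mu> t) {l t})"
  by (rule cmv_measure.sums_inverse_mass[OF cmv[OF t] norm_l[OF t] mass_pos[OF t]])

text \<open>From below, a test vector peaking at \<open>l s\<close> keeps almost all of its norm at
  \<open>l t\<close>. From above, the reciprocal mass is a supremum of partial sums, each of which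
  is continuous in \<open>t\<close>.\<close>

lemma mass_tendsto:
  assumes s: "s \<in> J"
  shows "((\<lambda>t. measure (\<mu> t) {l t}) \<longlongrightarrow> measure (\<mu> s) {l s}) (at s within J)"
proof (rule order_tendstoI)
  let ?F = "at s within J"
  let ?m = "\<lambda>t. measure (\<mu> t) {l t}"
  fix y assume y: "y < ?m s"
  \<comment> \<open>A quarter of the gap: the energy \<open>e\<close> and the perturbation by
    \<open>\<eta>\<close> cost \<open>\<kappa>\<close> each after division by
    \<open>\<gamma>0\<^sup>2\<close>, the factor \<open>1 + \<kappa>\<close> costs another one, and
    one remains for strictness.\<close>
  define \<kappa> where "\<kappa> = (?m s - y) / 4"
  have \<kappa>: "\<kappa> > 0" using y by (simp add: \<kappa>_def)
  obtain \<gamma>0 where \<gamma>0: "\<gamma>0 > 0" "ball (l s) \<gamma>0 \<subseteq> B" using B l_in(2)[OF s] openE by blast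
  define e where "e = \<gamma>0\<^sup>2 * \<kappa>"
  have e: "e > 0" using \<gamma>0 \<kappa> by (simp add: e_def)
  obtain N c where c: "cmv_comb (A s) c N (l s) = 1"
    and bnd: "\<And>M' a' \<eta> l'. cmv_measure M' a' \<Longrightarrow> params_close \<eta> (A s) a' \<Longrightarrow> \<eta> \<ge> 0 \<Longrightarrow>
        measure_support M' \<inter> ball (l s) \<gamma>0 \<subseteq> {l'} \<Longrightarrow>
        ?m s - (e + 48 * \<eta> * (?m s + e)) / \<gamma>0\<^sup>2 \<le> measure M' {l'} * (cmod (cmv_comb a' c N l'))\<^sup>2"
    by (rule mass_lower_bound_nearby[OF cmv[OF s] norm_l[OF s] e \<gamma>0(1)], rule that)
  define X where "X = ?m s + e"
  define \<eta> where "\<eta> = e / (48 * X)"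
  have X: "X > 0" using e by (simp add: X_def add_nonneg_pos)
  then have "48 * \<eta> * X = e" by (simp add: \<eta>_def)
  then have \<eta>: "\<eta> > 0" "48 * \<eta> * (?m s + e) = e" using e X by (simp_all only: X_def[symmetric]) (simp add: \<eta>_def)
  have "((\<lambda>t. cmv_comb (A t) c N (l t)) \<longlongrightarrow> cmv_comb (A s) c N (l s)) ?F"
    unfolding cmv_comb_def by (intro tendsto_intros val_tendsto s)
  then have "((\<lambda>t. (cmod (cmv_comb (A t) c N (l t)))\<^sup>2) \<longlongrightarrow> (cmod (cmv_comb (A s) c N (l s)))\<^sup>2) ?F"
    by (intro tendsto_intros)
  then have "\<forall>\<^sub>F t in ?F. (cmod (cmv_comb (A t) c N (l t)))\<^sup>2 < 1 + \<kappa>"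
    by (rule order_tendstoD(2)) (use \<kappa> c in simp)
  then show "\<forall>\<^sub>F t in ?F. y < ?m t"
    using close[OF s \<eta>(1)] eventually_in_J
  proof eventually_elim
    case (elim t)
    interpret cmv_measure "\<mu> t" "A t" by (rule cmv[OF elim(3)])
    have "measure_support (\<mu> t) \<inter> ball (l s) \<gamma>0 \<subseteq> {l t}" using \<gamma>0(2) iso[OF elim(3)] by blast
    then have "?m s - (e + e) / \<gamma>0\<^sup>2 \<le> ?m t * (cmod (cmv_comb (A t) c N (l t)))\<^sup>2"
      using bnd[OF cmv[OF elim(3)] elim(2), of "l t"] \<eta> by simp
    also have "\<dots> \<le> ?m t * (1 + \<kappa>)" using elim(1) by (intro mult_left_mono) auto
    also have "\<dots> \<le> ?m t + \<kappa>"
      using mult_right_mono[OF prob_le_1[of "{l t}"], of \<kappa>] \<kappa> by (simp add: algebra_simps)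
    finally have "?m s - 2 * \<kappa> \<le> ?m t + \<kappa>" using \<gamma>0(1) by (simp add: e_def field_simps)
    then show ?case using \<kappa> by (simp add: \<kappa>_def field_simps)
  qed
next
  let ?F = "at s within J"
  let ?m = "\<lambda>t. measure (\<mu> t) {l t}"
  fix y assume y: "?m s < y"
  have ms: "?m s > 0" by (rule mass_pos[OF s])
  have y0: "y > 0" using ms y by linarith
  have "1 / y < 1 / ?m s" using ms y by (simp add: frac_less2)
  then have "\<forall>\<^sub>F N in sequentially. 1 / y < (\<Sum>n<N. (cmod (cmv_val (A s) n (l s)))\<^sup>2)"
    using sums_mass[OF s] unfolding sums_def by (intro order_tendstoD(1))
  then obtain N where N: "1 / y < (\<Sum>n<N. (cmod (cmv_val (A s) n (l s)))\<^sup>2)"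
    using eventually_happens sequentially_bot by blast
  have "((\<lambda>t. \<Sum>n<N. (cmod (cmv_val (A t) n (l t)))\<^sup>2) \<longlongrightarrow> (\<Sum>n<N. (cmod (cmv_val (A s) n (l s)))\<^sup>2)) ?F"
    by (intro tendsto_intros val_tendsto s)
  then have "\<forall>\<^sub>F t in ?F. 1 / y < (\<Sum>n<N. (cmod (cmv_val (A t) n (l t)))\<^sup>2)"
    using N by (rule order_tendstoD(1))
  then show "\<forall>\<^sub>F t in ?F. ?m t < y"
    using eventually_in_J
  proof eventually_elim
    case (elim t)
    have "(\<Sum>n<N. (cmod (cmv_val (A t) n (l t)))\<^sup>2) \<le> 1 / ?m t"
      unfolding sums_unique[OF sums_mass[OF elim(2)]]
      by (rule sum_le_suminf[OF sums_summable[OF sums_mass[OF elim(2)]]]) auto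
    then have "1 / y < 1 / ?m t" using elim(1) by simp
    then show ?case using y0 mass_pos[OF elim(2)] by (simp add: field_simps)
  qed
qed

end

section \<open>Phases of the orthonormal polynomials\<close>

text \<open>A lift to the line of the circle map
  \<open>u \<mapsto> (u + a) / (1 + cnj a * u)\<close>, which is \<open>u\<close> times a number
  over its conjugate. For \<open>cmod a < 1\<close> this number has positive real part, so the
  principal argument is continuous there.\<close>

definition moebius_phase :: "complex \<Rightarrow> real \<Rightarrow> real" where
  "moebius_phase a x = x + 2 * Arg (1 + a * cis (- x))"

text \<open>A continuous argument of \<open>z\<close> times the \<open>n\<close>-th polynomial over
  its reversed polynomial at \<open>z = cis \<theta>\<close>. The closing equation of a finite
  family prescribes it modulo \<open>2 * pi\<close>.\<close>

primrec phase :: "(nat \<Rightarrow> complex) \<Rightarrow> nat \<Rightarrow> real \<Rightarrow> real" where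
  "phase a 0 \<theta> = \<theta>"
| "phase a (Suc n) \<theta> = \<theta> + moebius_phase (a (Suc n)) (phase a n \<theta>)"

lemma one_plus_Re_pos:
  assumes "cmod a < 1"
  shows "Re (1 + a * cis x) > 0"
proof -
  have "\<bar>Re (a * cis x)\<bar> \<le> cmod a" using abs_Re_le_cmod[of "a * cis x"] by (simp add: norm_mult)
  then have "- Re (a * cis x) < 1" using assms by linarith
  then show ?thesis by simp
qed

lemma Re_pos_not_nonpos_Reals: "Re z > 0 \<Longrightarrow> z \<notin> \<real>\<^sub>\<le>\<^sub>0"
  by (auto simp: complex_nonpos_Reals_iff)

lemma cis_moebius_phase:
  assumes a: "cmod a < 1"
  shows "cis (moebius_phase a x) * (1 + cnj a * cis x) = cis x + a"
proof -
  define w where "w = 1 + a * cis (- x)"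
  have "Re w > 0" unfolding w_def by (rule one_plus_Re_pos[OF a])
  then have w0: "w \<noteq> 0" by auto
  have cw: "cnj w = 1 + cnj a * cis x" by (simp add: w_def cis_cnj)
  have "cis (2 * Arg w) = cis (Arg w) * cis (Arg w)" by (simp add: cis_mult)
  also have "\<dots> = (w * w) / (of_real (cmod w) * of_real (cmod w))"
    using w0 by (simp add: cis_Arg sgn_eq)
  also have "of_real (cmod w) * of_real (cmod w) = w * cnj w"
    using complex_norm_square[of w] by (simp add: power2_eq_square)
  finally have "cis (2 * Arg w) * cnj w = w" using w0 by simp
  then have "cis (moebius_phase a x) * cnj w = cis x * w"
    by (simp add: moebius_phase_def w_def[symmetric] cis_mult[symmetric] mult.assoc)
  also have "\<dots> = cis x + a" by (simp add: w_def distrib_left mult.left_commute[of _ a] cis_mult)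
  finally show ?thesis by (simp add: cw)
qed

lemma tendsto_moebius_phase:
  assumes "(A \<longlongrightarrow> a) F" "(x \<longlongrightarrow> x0) F" "cmod a < 1"
  shows "((\<lambda>t. moebius_phase (A t) (x t)) \<longlongrightarrow> moebius_phase a x0) F"
proof -
  have "((\<lambda>t. 1 + A t * cis (- x t)) \<longlongrightarrow> 1 + a * cis (- x0)) F"
    unfolding cis_conv_exp by (intro tendsto_intros assms)
  moreover have "isCont Arg (1 + a * cis (- x0))"
    by (intro continuous_at_Arg Re_pos_not_nonpos_Reals one_plus_Re_pos assms(3))
  ultimately have "((\<lambda>t. Arg (1 + A t * cis (- x t))) \<longlongrightarrow> Arg (1 + a * cis (- x0))) F"
    using isCont_tendsto_compose by blast
  then show ?thesis unfolding moebius_phase_def by (intro tendsto_add assms tendsto_mult_left)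
qed

lemma moebius_phase_periodic:
  "moebius_phase a (x + 2 * pi * of_int k) = moebius_phase a x + 2 * pi * of_int k"
proof -
  have "cis (2 * pi * of_int (- k)) = 1" by (rule cis_multiple_2pi) simp
  then have "cis (- (x + 2 * pi * of_int k)) = cis (- x)"
    using cis_mult[of "- x" "2 * pi * of_int (- k)"] by simp
  then show ?thesis by (simp add: moebius_phase_def)
qed

lemma cis_eq_iff_int: "cis x = cis y \<longleftrightarrow> (\<exists>k::int. x = y + 2 * pi * of_int k)"
proof -
  have "cis x = cis y \<longleftrightarrow> sin x = sin y \<and> cos x = cos y" by (auto simp: complex_eq_iff)
  then show ?thesis unfolding sin_cos_eq_iff by (auto simp: mult_ac)
qed

text \<open>Monotonicity comes for free: the Moebius map is injective on the circle, so its lift is a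
  continuous injection of the line.\<close>

lemma strict_mono_moebius_phase:
  assumes a: "cmod a < 1"
  shows "strict_mono (moebius_phase a)"
proof -
  let ?f = "moebius_phase a"
  have cont: "continuous_on UNIV ?f"
    unfolding continuous_on_def by (auto intro!: tendsto_moebius_phase a tendsto_intros)
  have "inj_on ?f UNIV"
  proof (rule inj_onI)
    fix x y assume e: "?f x = ?f y"
    define u where "u = cis (?f x)"
    have u1: "cmod u = 1" by (simp add: u_def)
    have u: "u * (1 + cnj a * cis x) = cis x + a" "u * (1 + cnj a * cis y) = cis y + a"
      using cis_moebius_phase[OF a, of x] cis_moebius_phase[OF a, of y] e by (simp_all add: u_def)
    have "(1 - u * cnj a) * (cis x - cis y)
        = (cis x - cis y) - (u * (1 + cnj a * cis x) - u * (1 + cnj a * cis y))"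
      by (simp add: algebra_simps)
    also have "\<dots> = 0" unfolding u by simp
    finally have "(1 - u * cnj a) * (cis x - cis y) = 0" .
    moreover have "cmod (u * cnj a) < 1" using a by (simp add: norm_mult u1)
    then have "1 - u * cnj a \<noteq> 0" by auto
    ultimately have "cis x = cis y" by simp
    then obtain k :: int where k: "x = y + 2 * pi * of_int k" unfolding cis_eq_iff_int by blast
    then show "x = y" using e moebius_phase_periodic[of a y k] by simp
  qed
  then have "strict_mono_on UNIV ?f \<or> strict_antimono_on UNIV ?f"
    using injective_eq_monotone_map[OF is_interval_univ cont] by simp
  \<comment> \<open>A shift by a full period raises the value, which rules out a decreasing
    lift.\<close>
  moreover have "\<not> strict_antimono_on UNIV ?f"
  proof
    assume *: "strict_antimono_on UNIV ?f"
    have "(0::real) < 2 * pi" by simp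
    then have "?f (2 * pi) < ?f 0" using monotone_onD[OF *, of 0 "2 * pi"] by simp
    then show False using moebius_phase_periodic[of a 0 1] by simp
  qed
  ultimately show ?thesis by simp
qed

context
  fixes a :: "nat \<Rightarrow> complex" and n :: nat
  assumes a: "\<And>m. m \<ge> 1 \<Longrightarrow> m \<le> n \<Longrightarrow> cmod (a m) < 1"
begin

lemma phase_strict_mono: "strict_mono (phase a n)"
  using a
proof (induction n)
  case (Suc n)
  have "strict_mono (phase a n)" using Suc by auto
  moreover have "strict_mono (moebius_phase (a (Suc n)))"
    using Suc.prems[of "Suc n"] by (intro strict_mono_moebius_phase) auto
  ultimately show ?case by (auto simp: strict_mono_def add_strict_mono)
qed (simp add: strict_mono_def)

text \<open>Every recursion step adds one winding. The \<open>n + 1\<close> windings account for the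
  \<open>n + 1\<close> mass points of a family closed after \<open>n\<close> parameters.\<close>

lemma phase_periodic: "phase a n (\<theta> + 2 * pi * of_int k) = phase a n \<theta> + 2 * pi * of_int k * (real n + 1)"
proof (induction n)
  case (Suc n)
  have "phase a n (\<theta> + 2 * pi * of_int k) = phase a n \<theta> + 2 * pi * of_int (k * (int n + 1))"
    using Suc by simp
  then show ?case
    unfolding phase.simps(2) by (simp only: moebius_phase_periodic) (simp add: algebra_simps)
qed simp

lemma tendsto_phase:
  assumes "\<And>m. m \<ge> 1 \<Longrightarrow> m \<le> n \<Longrightarrow> ((\<lambda>t. A t m) \<longlongrightarrow> a m) F" "(\<theta> \<longlongrightarrow> \<theta>0) F"
  shows "((\<lambda>t. phase (A t) n (\<theta> t)) \<longlongrightarrow> phase a n \<theta>0) F"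
  using assms a
proof (induction n)
  case (Suc n)
  then show ?case unfolding phase.simps
    by (intro tendsto_intros tendsto_moebius_phase) auto
qed simp

lemma phase_surj: "\<exists>\<theta>. phase a n \<theta> = y"
proof -
  let ?f = "phase a n"
  have cont: "continuous_on UNIV ?f"
    unfolding continuous_on_def by (auto intro!: tendsto_phase tendsto_intros)
  define k where "k = \<lceil>\<bar>y - ?f 0\<bar>\<rceil>"
  have k: "\<bar>y - ?f 0\<bar> \<le> of_int k" by (simp add: k_def)
  have "1 * of_int k \<le> (2 * pi * (real n + 1)) * of_int k"
  proof (rule mult_right_mono)
    have "1 * 1 \<le> (2 * pi) * (real n + 1)" using pi_gt3 by (intro mult_mono) auto
    then show "1 \<le> 2 * pi * (real n + 1)" by simp
    show "0 \<le> (of_int k :: real)" using k by linarith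
  qed
  then have "?f (2 * pi * of_int (- k)) \<le> y" "y \<le> ?f (2 * pi * of_int k)"
    using k phase_periodic[of 0 k] phase_periodic[of 0 "- k"] by (simp_all add: mult_ac abs_le_iff)
  moreover have "2 * pi * of_int (- k) \<le> 2 * pi * of_int k" using k by simp
  ultimately show ?thesis
    using IVT'[of ?f "2 * pi * of_int (- k)" y "2 * pi * of_int k"] continuous_on_subset[OF cont] by blast
qed

text \<open>Dividing the Szego recursion by its reversed form shows that the quotient undergoes the
  Moebius map and then a multiplication by \<open>z\<close>; the induction does this without
  division.\<close>

lemma cis_phase:
  assumes "z = cis \<theta>"
  shows "cis (phase a n \<theta>) * (z ^ n * cnj (szego_val a n z)) = z * szego_val a n z"
  using a
proof (induction n)
  case (Suc n)
  have z1: "cmod z = 1" by (simp add: assms)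
  define b where "b = szego_val a n z"
  define x where "x = phase a n \<theta>"
  define R :: complex where "R = of_real (rho (a (Suc n)))"
  have aS: "cmod (a (Suc n)) < 1" using Suc.prems[of "Suc n"] by simp
  have R0: "R \<noteq> 0" using rho_pos[OF aS] by (simp add: R_def)
  have IH: "z * b = cis x * (z ^ n * cnj b)" using Suc by (simp add: b_def x_def)
  have val: "R * szego_val a (Suc n) z = z * b + a (Suc n) * z ^ n * cnj b"
    using R0 by (simp add: b_def R_def)
  have "R * cnj (szego_val a (Suc n) z) = cnj (R * szego_val a (Suc n) z)" by (simp add: R_def)
  also have "\<dots> = cnj z * cnj b + cnj (a (Suc n)) * cnj z ^ n * b"
    by (simp only: val) simp
  finally have cval: "R * cnj (szego_val a (Suc n) z) = cnj z * cnj b + cnj (a (Suc n)) * cnj z ^ n * b" .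
  have "R * (z ^ Suc n * cnj (szego_val a (Suc n) z)) = z ^ Suc n * (R * cnj (szego_val a (Suc n) z))"
    by simp
  also have "\<dots> = z ^ n * (z * cnj z) * cnj b + cnj (a (Suc n)) * z * (z ^ n * cnj z ^ n) * b"
    unfolding cval by (simp add: algebra_simps)
  also have "\<dots> = z ^ n * cnj b + cnj (a (Suc n)) * (z * b)"
    by (simp add: unimodular_mult_cnj[OF z1] unimodular_power_cnj[OF z1])
  also have "\<dots> = (1 + cnj (a (Suc n)) * cis x) * (z ^ n * cnj b)"
    unfolding IH by (simp add: algebra_simps)
  finally have e1: "R * (z ^ Suc n * cnj (szego_val a (Suc n) z)) = (1 + cnj (a (Suc n)) * cis x) * (z ^ n * cnj b)" .
  have e2: "R * (z * szego_val a (Suc n) z) = z * ((cis x + a (Suc n)) * (z ^ n * cnj b))"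
  proof -
    have "R * (z * szego_val a (Suc n) z) = z * (R * szego_val a (Suc n) z)" by simp
    also have "\<dots> = z * (z * b + a (Suc n) * z ^ n * cnj b)" by (simp only: val)
    finally show ?thesis unfolding IH by (simp add: algebra_simps)
  qed
  have cp: "cis (phase a (Suc n) \<theta>) = z * cis (moebius_phase (a (Suc n)) x)"
    by (simp add: assms cis_mult x_def)
  have "R * (cis (phase a (Suc n) \<theta>) * (z ^ Suc n * cnj (szego_val a (Suc n) z)))
      = z * cis (moebius_phase (a (Suc n)) x) * (R * (z ^ Suc n * cnj (szego_val a (Suc n) z)))"
    unfolding cp by (simp only: mult_ac)
  also have "\<dots> = z * ((cis (moebius_phase (a (Suc n)) x) * (1 + cnj (a (Suc n)) * cis x)) * (z ^ n * cnj b))"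
    unfolding e1 by (simp only: mult.assoc)
  also have "\<dots> = R * (z * szego_val a (Suc n) z)"
    unfolding cis_moebius_phase[OF aS] e2 ..
  finally show ?case using R0 by simp
qed (simp add: assms)

end

text \<open>Monotonicity replaces the implicit function theorem: for fixed \<open>x\<close> the sign
  of \<open>phase (A t) n x - y t\<close> tells on which side of \<open>x\<close> the solution lies,
  and a strict sign at \<open>s\<close> persists nearby.\<close>

lemma tendsto_phase_solution:
  assumes s: "s \<in> I" and a: "\<And>t m. t \<in> I \<Longrightarrow> m \<ge> 1 \<Longrightarrow> m \<le> n \<Longrightarrow> cmod (A t m) < 1"
    and A: "\<And>m. m \<ge> 1 \<Longrightarrow> m \<le> n \<Longrightarrow> ((\<lambda>t. A t m) \<longlongrightarrow> A s m) (at s within I)"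
    and y: "(y \<longlongrightarrow> y s) (at s within I)"
    and \<theta>: "\<And>t. t \<in> I \<Longrightarrow> phase (A t) n (\<theta> t) = y t"
  shows "(\<theta> \<longlongrightarrow> \<theta> s) (at s within I)"
proof (rule order_tendstoI)
  have mono: "strict_mono (phase (A t) n)" if "t \<in> I" for t
    using a[OF that] by (rule phase_strict_mono)
  have lim: "((\<lambda>t. phase (A t) n x) \<longlongrightarrow> phase (A s) n x) (at s within I)" for x
    using a[OF s] A by (rule tendsto_phase) auto
  have inI: "\<forall>\<^sub>F t in at s within I. t \<in> I" by (simp add: eventually_at_filter)
  fix x
  {
    assume "x < \<theta> s"
    then have "phase (A s) n x - y s < 0" using strict_monoD[OF mono[OF s]] \<theta>[OF s] by force
    then have "\<forall>\<^sub>F t in at s within I. phase (A t) n x - y t < 0"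
      by (intro order_tendstoD(2)[OF tendsto_diff[OF lim y]])
    then show "\<forall>\<^sub>F t in at s within I. x < \<theta> t"
      using inI by eventually_elim (metis \<theta> diff_less_0_iff_less mono strict_mono_less)
  next
    assume "\<theta> s < x"
    then have "0 < phase (A s) n x - y s" using strict_monoD[OF mono[OF s]] \<theta>[OF s] by force
    then have "\<forall>\<^sub>F t in at s within I. 0 < phase (A t) n x - y t"
      by (intro order_tendstoD(1)[OF tendsto_diff[OF lim y]])
    then show "\<forall>\<^sub>F t in at s within I. \<theta> t < x"
      using inI by eventually_elim (metis \<theta> diff_gt_0_iff_gt mono strict_mono_less)
  }
qed

lemma szego_val_cong:
  assumes "\<And>m. m \<ge> 1 \<Longrightarrow> m \<le> n \<Longrightarrow> a m = a' m"
  shows "szego_val a n z = szego_val a' n z"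
  using assms by (induction n) auto

section \<open>Mass points of a differentiable family\<close>

lemma tendsto_polar_quotient:
  assumes "(r has_real_derivative r') (at s within I)" "(\<alpha> has_real_derivative \<alpha>') (at s within I)"
  shows "((\<lambda>t. (of_real (r t) * cis (\<alpha> t) - of_real (r s) * cis (\<alpha> s)) / of_real (t - s))
    \<longlongrightarrow> (of_real r' + \<i> * of_real (r s * \<alpha>')) * cis (\<alpha> s)) (at s within I)"
proof -
  have "((\<lambda>t. r t * cos (\<alpha> t)) has_real_derivative r' * cos (\<alpha> s) - r s * \<alpha>' * sin (\<alpha> s)) (at s within I)"
    "((\<lambda>t. r t * sin (\<alpha> t)) has_real_derivative r' * sin (\<alpha> s) + r s * \<alpha>' * cos (\<alpha> s)) (at s within I)"
    by (auto intro!: derivative_eq_intros assms)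
  then show ?thesis
    unfolding tendsto_complex_iff has_field_derivative_iff
    by (simp add: Re_divide_of_real Im_divide_of_real del: of_real_diff)
qed

lemma has_real_derivative_sqrt_one_minus_square:
  assumes "(r has_real_derivative r') (at s within I)" "\<bar>r s\<bar> < 1"
  shows "((\<lambda>t. sqrt (1 - (r t)\<^sup>2)) has_real_derivative (- r s * r' / sqrt (1 - (r s)\<^sup>2))) (at s within I)"
proof -
  have "1 - (r s)\<^sup>2 > 0" using assms(2) by (simp add: abs_square_less_1)
  then show ?thesis
    by (auto intro!: derivative_eq_intros assms(1) simp: field_simps)
qed

lemma rho_polar: "rho (of_real r * cis x) = sqrt (1 - r\<^sup>2)"
  by (simp add: rho_def norm_mult)

locale szego_flow =
  fixes I :: "real set"
    and r r' \<alpha> \<alpha>' :: "nat \<Rightarrow> real \<Rightarrow> real"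
    and \<mu> :: "real \<Rightarrow> complex measure"
    and \<phi> :: "real \<Rightarrow> nat \<Rightarrow> complex poly"
  assumes interval: "is_interval I"
    and r_range: "\<And>n t. n \<ge> 1 \<Longrightarrow> t \<in> I \<Longrightarrow> r n t \<in> {-1<..<1}"
    and r_deriv: "\<And>n t. n \<ge> 1 \<Longrightarrow> t \<in> I \<Longrightarrow> (r n has_real_derivative r' n t) (at t within I)"
    and \<alpha>_deriv: "\<And>n t. n \<ge> 1 \<Longrightarrow> t \<in> I \<Longrightarrow> (\<alpha> n has_real_derivative \<alpha>' n t) (at t within I)"
    and \<mu>: "\<And>t. t \<in> I \<Longrightarrow> has_schur_parameters (\<mu> t) (\<lambda>n. of_real (r n t) * exp (\<i> * of_real (\<alpha> n t)))"
    and \<phi>: "\<And>t. t \<in> I \<Longrightarrow> orthonormal_polynomials (\<mu> t) UNIV (\<phi> t)"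
begin

definition A :: "real \<Rightarrow> nat \<Rightarrow> complex" where
  "A t n = of_real (r n t) * cis (\<alpha> n t)"

definition A' :: "real \<Rightarrow> nat \<Rightarrow> complex" where
  "A' t n = (of_real (r' n t) + \<i> * of_real (r n t * \<alpha>' n t)) * cis (\<alpha> n t)"

definition R' :: "real \<Rightarrow> nat \<Rightarrow> real" where
  "R' t n = - r n t * r' n t / sqrt (1 - (r n t)\<^sup>2)"

definition speed :: "real \<Rightarrow> complex \<Rightarrow> nat \<Rightarrow> real" where
  "speed t z n = r' n t * Gamma_term r \<alpha> \<phi> n t z + \<alpha>' n t * Delta_term \<phi> n t z"

lemma r_less: "n \<ge> 1 \<Longrightarrow> t \<in> I \<Longrightarrow> \<bar>r n t\<bar> < 1"
  using r_range[of n t] by auto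

lemma norm_A: "cmod (A t n) = \<bar>r n t\<bar>"
  by (simp add: A_def norm_mult)

lemma A_less: "n \<ge> 1 \<Longrightarrow> t \<in> I \<Longrightarrow> cmod (A t n) < 1"
  by (simp add: norm_A r_less)

lemma rho_A: "rho (A t n) = sqrt (1 - (r n t)\<^sup>2)"
  by (simp add: A_def rho_polar)

lemma schur_A: "t \<in> I \<Longrightarrow> has_schur_parameters (\<mu> t) (A t)"
  using \<mu>[of t] by (simp add: A_def[abs_def] cis_conv_exp)

lemma cmv_measure_A: "t \<in> I \<Longrightarrow> cmv_measure (\<mu> t) (A t)"
  using schur_A[of t] cmv_val_orthonormal[OF schur_A[of t]]
  by (intro cmv_measure.intro) (auto simp: has_schur_parameters_def)

lemma poly_phi:
  assumes t: "t \<in> I" and z: "cmod z = 1"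
  shows "poly (\<phi> t n) z = szego_val (A t) n z"
proof -
  obtain \<psi> where \<psi>: "orthonormal_polynomials (\<mu> t) UNIV \<psi>" "\<And>n. n \<ge> 1 \<Longrightarrow> szego_recurrence \<psi> (A t) n"
    and C: "circle_measure (\<mu> t)"
    using schur_A[OF t] by (auto simp: has_schur_parameters_def)
  have "\<phi> t n = \<psi> n" by (rule orthonormal_polynomials_unique[OF C \<phi>[OF t] \<psi>(1)])
  then show ?thesis using poly_eq_szego_val[OF C \<psi>(1), of n "A t" z] \<psi>(2) A_less t z by simp
qed

lemma A_quotient:
  assumes "n \<ge> 1" "s \<in> I" "J \<subseteq> I"
  shows "((\<lambda>t. (A t n - A s n) / of_real (t - s)) \<longlongrightarrow> A' s n) (at s within J)"
  unfolding A_def A'_def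
  by (rule tendsto_mono[OF at_le[OF assms(3)] tendsto_polar_quotient]) (intro r_deriv \<alpha>_deriv assms)+

lemma rho_quotient:
  assumes "n \<ge> 1" "s \<in> I" "J \<subseteq> I"
  shows "((\<lambda>t. (rho (A t n) - rho (A s n)) / (t - s)) \<longlongrightarrow> R' s n) (at s within J)"
  using has_real_derivative_sqrt_one_minus_square[OF r_deriv[OF assms(1,2)] r_less[OF assms(1,2)]]
  unfolding rho_A R'_def has_field_derivative_iff by (rule tendsto_mono[OF at_le[OF assms(3)]])

lemma A_tendsto:
  assumes "n \<ge> 1" "s \<in> I"
  shows "((\<lambda>t. A t n) \<longlongrightarrow> A s n) (at s within I)"
proof -
  have "(r n \<longlongrightarrow> r n s) (at s within I)" "(\<alpha> n \<longlongrightarrow> \<alpha> n s) (at s within I)"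
    using DERIV_continuous[OF r_deriv[OF assms]] DERIV_continuous[OF \<alpha>_deriv[OF assms]]
    by (simp_all add: continuous_within)
  then show ?thesis unfolding A_def cis_conv_exp by (intro tendsto_intros)
qed

lemma block_speed:
  assumes t: "t \<in> I" and z: "cmod z = 1"
  shows "cmv_block (A' t (Suc n)) (R' t (Suc n)) n (cmv_val (A t) n z) (cmv_val (A t) (Suc n) z) z
      (cmv_val (A t) n z) (cmv_val (A t) (Suc n) z) = \<i> * of_real (speed t z (Suc n))"
proof -
  have step: "cmv_step (A t (Suc n)) (rho (A t (Suc n))) z n (cmv_val (A t) n z) (cmv_val (A t) (Suc n) z)"
    using cmv_val_step[OF z, of "A t" n] A_less t by simp
  have "exp (- \<i> * of_real (\<alpha> (Suc n) t)) = cnj (cis (\<alpha> (Suc n) t))"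
    unfolding cis_cnj by (simp add: cis_conv_exp)
  then show ?thesis
    using cmv_block_derivative[OF z step[unfolded cmv_val_def], of "r (Suc n) t" "cis (\<alpha> (Suc n) t)"
        "r' (Suc n) t" "\<alpha>' (Suc n) t"] r_less[of "Suc n" t] t
    by (simp add: A_def rho_polar A'_def R'_def cmv_val_def speed_def Gamma_term_def Delta_term_def poly_phi[OF t z])
qed

text \<open>Each mass point is a solution of a phase equation on a fixed branch, hence continuous in
  \<open>t\<close>. The derivative then comes from the general eigenvalue lemma, applied to the
  sequence truncated at the unimodular parameter.\<close>

lemma finite_case:
  fixes N :: nat and \<beta> \<beta>' :: "real \<Rightarrow> real" and \<mu>N :: "real \<Rightarrow> complex measure"
  assumes N: "N \<ge> 1" and \<beta>: "\<And>t. t \<in> I \<Longrightarrow> (\<beta> has_real_derivative \<beta>' t) (at t within I)"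
    and fin: "\<And>t. t \<in> I \<Longrightarrow> has_finite_schur_parameters (\<mu>N t) N
           (\<lambda>n. if n < N then of_real (r n t) * exp (\<i> * of_real (\<alpha> n t)) else exp (\<i> * of_real (\<beta> t)))"
  obtains \<theta> :: "nat \<Rightarrow> real \<Rightarrow> real"
  where "\<And>t. t \<in> I \<Longrightarrow> bij_betw (\<lambda>k. cis (\<theta> k t)) {..<N} (mass_points (\<mu>N t))"
    and "\<And>k t. k < N \<Longrightarrow> t \<in> I \<Longrightarrow> (\<theta> k has_real_derivative
           measure (\<mu>N t) {cis (\<theta> k t)} * ((\<Sum>n=1..N-1. speed t (cis (\<theta> k t)) n)
             + \<beta>' t * (cmod (poly (\<phi> t (N - 1)) (cis (\<theta> k t))))\<^sup>2)) (at t within I)"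
proof -
  obtain n where Nn: "N = Suc n" using N by (cases N) auto
  define AN where "AN t m = (if m < N then A t m else cis (\<beta> t))" for t m
  have finA: "has_finite_schur_parameters (\<mu>N t) N (AN t)" if "t \<in> I" for t
    using fin[OF that] unfolding AN_def[abs_def] A_def cis_conv_exp .
  have val: "szego_val (AN t) m z = szego_val (A t) m z" if "m < N" for t m z
    using that by (intro szego_val_cong) (auto simp: AN_def)
  have less: "cmod (A t m) < 1" if "t \<in> I" "m \<ge> 1" "m \<le> n" for t m
    using A_less that by simp
  \<comment> \<open>The summand \<open>pi\<close> is the minus sign in the closing equation. The
    index \<open>k\<close> fixes the branch, on which strict monotonicity makes the solution
    unique.\<close>
  define \<theta> where "\<theta> k t = (SOME x. phase (A t) n x = \<beta> t + pi + 2 * pi * real k)" for k t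
  have \<theta>: "phase (A t) n (\<theta> k t) = \<beta> t + pi + 2 * pi * real k" if "t \<in> I" for k t
    unfolding \<theta>_def by (rule someI_ex[OF phase_surj]) (use less that in auto)
  have mass: "cis (\<theta> k t) \<in> mass_points (\<mu>N t)"
    and zero: "cis (\<theta> k t) * szego_val (A t) n (cis (\<theta> k t))
        = - cis (\<beta> t) * cis (\<theta> k t) ^ n * cnj (szego_val (A t) n (cis (\<theta> k t)))" if t: "t \<in> I" for k t
  proof -
    let ?z = "cis (\<theta> k t)"
    have "cis (\<beta> t + pi + 2 * pi * real k) = - cis (\<beta> t)"
      using cis_multiple_2pi[of "real k"] by (simp flip: cis_mult)
    then show z: "?z * szego_val (A t) n ?z = - cis (\<beta> t) * ?z ^ n * cnj (szego_val (A t) n ?z)"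
      using cis_phase[of n "A t", OF less[OF t] refl, of "\<theta> k t"] \<theta>[OF t, of k]
      by (simp add: mult.assoc)
    show "?z \<in> mass_points (\<mu>N t)"
      by (rule has_finite_schur_parametersD(6)[OF finA[OF t]]) (use z in \<open>simp_all add: Nn val AN_def\<close>)
  qed
  have bij: "bij_betw (\<lambda>k. cis (\<theta> k t)) {..<N} (mass_points (\<mu>N t))" if t: "t \<in> I" for t
  proof -
    have inj: "inj_on (\<lambda>k. cis (\<theta> k t)) {..<N}"
    proof (rule inj_onI)
      fix j k assume jk: "j \<in> {..<N}" "k \<in> {..<N}" and eq: "cis (\<theta> j t) = cis (\<theta> k t)"
      then obtain i :: int where "\<theta> j t = \<theta> k t + 2 * pi * of_int i" unfolding cis_eq_iff_int by blast
      then have "phase (A t) n (\<theta> j t) = phase (A t) n (\<theta> k t) + 2 * pi * of_int i * (real n + 1)"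
        using phase_periodic[of n "A t", OF less[OF t]] by simp
      then have "2 * pi * real j = 2 * pi * (real k + of_int i * real N)"
        unfolding \<theta>[OF t] by (simp add: Nn algebra_simps)
      then have "real j = real k + of_int i * real N" by simp
      then have "real_of_int (int j) = real_of_int (int k + i * int N)" by simp
      then have i: "int j = int k + i * int N" by (simp only: of_int_eq_iff)
      \<comment> \<open>Shifting the angle by \<open>i\<close> periods moves the branch index by
        \<open>i * N\<close>, whereas two indices below \<open>N\<close> differ by less than
        \<open>N\<close>.\<close>
      have "i = 0"
      proof (rule ccontr)
        assume "i \<noteq> 0"
        then have "i \<ge> 1 \<or> i \<le> - 1" by linarith
        then have "i * int N \<ge> 1 * int N \<or> i * int N \<le> - 1 * int N"
          by (meson mult_right_mono of_nat_0_le_iff)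
        moreover have "int j < int N" "int k < int N" using jk by auto
        ultimately show False using i by (elim disjE) linarith+
      qed
      then show "j = k" using i by simp
    qed
    \<comment> \<open>\<open>N\<close> distinct mass points have been found and there are exactly
      \<open>N\<close>.\<close>
    have "(\<lambda>k. cis (\<theta> k t)) ` {..<N} = mass_points (\<mu>N t)"
    proof (rule card_subset_eq)
      show "finite (mass_points (\<mu>N t))" by (rule has_finite_schur_parametersD(3)[OF finA[OF t]])
      show "(\<lambda>k. cis (\<theta> k t)) ` {..<N} \<subseteq> mass_points (\<mu>N t)" using mass[OF t] by blast
      show "card ((\<lambda>k. cis (\<theta> k t)) ` {..<N}) = card (mass_points (\<mu>N t))"
        using card_image[OF inj] has_finite_schur_parametersD(4)[OF finA[OF t]] by simp
    qed
    then show ?thesis using inj by (simp add: bij_betw_def)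
  qed
  have \<theta>_tendsto: "(\<theta> k \<longlongrightarrow> \<theta> k s) (at s within I)" if s: "s \<in> I" for k s
  proof (rule tendsto_phase_solution[where n = n and A = A and y = "\<lambda>t. \<beta> t + pi + 2 * pi * real k", OF s])
    show "cmod (A t m) < 1" if "t \<in> I" "m \<ge> 1" "m \<le> n" for t m by (rule less[OF that])
    show "((\<lambda>t. A t m) \<longlongrightarrow> A s m) (at s within I)" if "1 \<le> m" for m by (rule A_tendsto[OF that s])
    have "(\<beta> \<longlongrightarrow> \<beta> s) (at s within I)"
      using DERIV_continuous[OF \<beta>[OF s]] by (simp add: continuous_within)
    then show "((\<lambda>t. \<beta> t + pi + 2 * pi * real k) \<longlongrightarrow> \<beta> s + pi + 2 * pi * real k) (at s within I)"
      by (intro tendsto_intros)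
  qed (rule \<theta>)
  have deriv: "(\<theta> k has_real_derivative measure (\<mu>N s) {cis (\<theta> k s)} * ((\<Sum>m=1..N-1. speed s (cis (\<theta> k s)) m)
       + \<beta>' s * (cmod (poly (\<phi> s (N - 1)) (cis (\<theta> k s))))\<^sup>2)) (at s within I)" if s: "s \<in> I" for k s
  proof -
    let ?z = "\<lambda>t. cis (\<theta> k t)"
    \<comment> \<open>The unimodular last parameter decouples the first \<open>N\<close> coordinates, so all others vanish.\<close>
    define a where "a m t = (if m < N then A t m else if m = N then cis (\<beta> t) else 0)" for m t
    \<comment> \<open>The value 1 beyond \<open>N\<close>, together with the parameter 0 there,
      keeps the blocks unitary.\<close>
    define \<rho> where "\<rho> m t = (if m < N then rho (A t m) else if m = N then 0 else 1)" for m t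
    define a' where "a' m t = (if m < N then A' t m else if m = N then \<i> * of_real (\<beta>' t) * cis (\<beta> t) else 0)" for m t
    define \<rho>' where "\<rho>' m t = (if m < N then R' t m else 0)" for m t
    define b where "b t m = (if m < N then szego_val (A t) m (?z t) else 0)" for t m
    define y where "y t = cmv (?z t) (b t)" for t
    define e where "e m = (if Suc m < N then speed s (?z s) (Suc m) else if Suc m = N
      then \<beta>' s * (cmod (szego_val (A s) n (?z s)))\<^sup>2 else 0)" for m
    \<comment> \<open>The summand 1 makes the bounds strict, so the difference quotients are
      eventually below \<open>C\<close> too. Finitely many indices suffice because beyond
      \<open>N\<close> the entries are constant.\<close>
    define C where "C = (\<Sum>m\<le>N. 1 + cmod (a' m s) + \<bar>\<rho>' m s\<bar>)"
    have C: "cmod (a' (Suc m) s) < C" "\<bar>\<rho>' (Suc m) s\<bar> < C" if "Suc m \<le> N" for m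
    proof -
      have "1 + cmod (a' (Suc m) s) + \<bar>\<rho>' (Suc m) s\<bar> \<le> C"
        unfolding C_def using that
        by (intro member_le_sum[of "Suc m" "{..N}" "\<lambda>m. 1 + cmod (a' m s) + \<bar>\<rho>' m s\<bar>"]) auto
      then show "cmod (a' (Suc m) s) < C" "\<bar>\<rho>' (Suc m) s\<bar> < C"
        using norm_ge_zero[of "a' (Suc m) s"] by linarith+
    qed
    have C0: "C \<ge> 0" unfolding C_def by (intro sum_nonneg) auto
    have aq: "((\<lambda>t. (a (Suc m) t - a (Suc m) s) / of_real (t - s)) \<longlongrightarrow> a' (Suc m) s) (at s within I)" for m
    proof -
      consider "Suc m < N" | "Suc m = N" | "Suc m > N" by linarith
      then show ?thesis
      proof cases
        case 2
        then show ?thesis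
          using tendsto_polar_quotient[OF DERIV_const[of 1] \<beta>[OF s]] by (simp add: a_def a'_def)
      qed (auto simp: a_def a'_def intro!: A_quotient[OF _ s order_refl, simplified])
    qed
    have \<rho>q: "((\<lambda>t. (\<rho> (Suc m) t - \<rho> (Suc m) s) / (t - s)) \<longlongrightarrow> \<rho>' (Suc m) s) (at s within I)" for m
      using rho_quotient[of "Suc m", OF _ s order_refl] by (auto simp: \<rho>_def \<rho>'_def)
    have step: "cmv_step (a (Suc m) t) (\<rho> (Suc m) t) (?z t) m (y t m) (y t (Suc m))" if t: "t \<in> I" for t m
      unfolding y_def
    proof (rule cmv_stepI)
      consider "Suc m < N" | "Suc m = N" | "Suc m > N" by linarith
      note cases = this
      show "(cmod (a (Suc m) t))\<^sup>2 + (\<rho> (Suc m) t)\<^sup>2 = 1"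
        using rho_sq[OF less_imp_le[OF A_less[of "Suc m" t]]] t by (auto simp: a_def \<rho>_def)
      show "of_real (\<rho> (Suc m) t) * b t (Suc m) = ?z t * b t m + a (Suc m) t * ?z t ^ m * cnj (b t m)"
        using cases
      proof cases
        case 1
        then show ?thesis using rho_pos[OF A_less[of "Suc m" t]] t by (simp add: a_def \<rho>_def b_def)
      next
        case 2
        then show ?thesis using zero[OF t, of k] by (simp add: a_def \<rho>_def b_def Nn)
      qed (simp add: a_def \<rho>_def b_def)
      show "b t (Suc m) = 0" if "\<rho> (Suc m) t = 0"
        using that rho_pos[OF A_less[of "Suc m" t]] t by (auto simp: \<rho>_def b_def split: if_splits)
    qed simp
    have lip: "\<forall>\<^sub>F t in at s within I. \<forall>m. cmod (a (Suc m) t - a (Suc m) s) \<le> C * \<bar>t - s\<bar>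
        \<and> \<bar>\<rho> (Suc m) t - \<rho> (Suc m) s\<bar> \<le> C * \<bar>t - s\<bar>"
    proof -
      have ev: "\<forall>\<^sub>F t in at s within I. cmod ((a (Suc m) t - a (Suc m) s) / of_real (t - s)) < C
          \<and> \<bar>(\<rho> (Suc m) t - \<rho> (Suc m) s) / (t - s)\<bar> < C" if "m \<in> {..<N}" for m
        using order_tendstoD(2)[OF tendsto_norm[OF aq] C(1)] order_tendstoD(2)[OF tendsto_rabs[OF \<rho>q] C(2)] that
        by (intro eventually_conj) auto
      have "\<forall>\<^sub>F t in at s within I. \<forall>m\<in>{..<N}. cmod ((a (Suc m) t - a (Suc m) s) / of_real (t - s)) < C
          \<and> \<bar>(\<rho> (Suc m) t - \<rho> (Suc m) s) / (t - s)\<bar> < C"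
        using ev by (intro eventually_ball_finite) auto
      moreover have "\<forall>\<^sub>F t in at s within I. t \<noteq> s" by (simp add: eventually_at_filter)
      ultimately show ?thesis
      proof eventually_elim
        case (elim t)
        show ?case
        proof
          fix m
          show "cmod (a (Suc m) t - a (Suc m) s) \<le> C * \<bar>t - s\<bar> \<and> \<bar>\<rho> (Suc m) t - \<rho> (Suc m) s\<bar> \<le> C * \<bar>t - s\<bar>"
          proof (cases "m < N")
            case True
            then have "cmod (a (Suc m) t - a (Suc m) s) / \<bar>t - s\<bar> < C" "\<bar>\<rho> (Suc m) t - \<rho> (Suc m) s\<bar> / \<bar>t - s\<bar> < C"
              using elim by (auto simp: norm_divide abs_divide simp flip: of_real_diff)
            then show ?thesis using elim(2) by (simp add: pos_divide_less_eq)
          next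
            case False
            then show ?thesis using C0 by (simp add: a_def \<rho>_def)
          qed
        qed
      qed
    qed
    have ylim: "((\<lambda>t. y t m) \<longlongrightarrow> y s m) (at s within I)" for m
    proof -
      have z: "(?z \<longlongrightarrow> ?z s) (at s within I)"
        unfolding cis_conv_exp by (intro tendsto_intros \<theta>_tendsto[OF s])
      have "((\<lambda>t. b t m) \<longlongrightarrow> b s m) (at s within I)"
        unfolding b_def by (cases "m < N") (auto intro!: tendsto_szego_val A_tendsto z A_less s)
      then show ?thesis unfolding y_def by (rule tendsto_cmv[OF z])
    qed
    have norm_y: "(cmod (y t m))\<^sup>2 = (if m < N then (cmod (szego_val (A t) m (?z t)))\<^sup>2 else 0)" for t m
      by (simp add: y_def norm_cmv b_def)
    have sums_y: "(\<lambda>m. (cmod (y t m))\<^sup>2) sums (\<Sum>m<N. (cmod (y t m))\<^sup>2)" for t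
      by (rule sums_finite) (auto simp: norm_y)
    have block: "cmv_block (a' (Suc m) s) (\<rho>' (Suc m) s) m (y s m) (y s (Suc m)) (?z s) (y s m) (y s (Suc m))
        = \<i> * of_real (e m)" for m
    proof -
      consider "Suc m < N" | "Suc m = N" | "Suc m > N" by linarith
      then show ?thesis
      proof cases
        case 1
        then have "y s m = cmv_val (A s) m (?z s)" "y s (Suc m) = cmv_val (A s) (Suc m) (?z s)"
          by (simp_all add: y_def b_def cmv_val_def cmv_def)
        then show ?thesis using 1 block_speed[OF s, of "?z s" m] by (simp add: a'_def \<rho>'_def e_def)
      next
        case 2
        \<comment> \<open>At the closing parameter only the first entry of the pair survives; with
          the step equation the block becomes \<open>\<i> * \<beta>'\<close> times the squared
          modulus of that entry, the last term of the formula.\<close>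
        have y0: "y s (Suc m) = 0" using 2 by (simp add: y_def b_def cmv_def)
        have yy: "y s m * cnj (y s m) = of_real ((cmod (szego_val (A s) n (?z s)))\<^sup>2)"
          using norm_y[of s m] 2 complex_norm_square[of "y s m"] by (simp add: Nn)
        have a: "a' (Suc m) s = \<i> * of_real (\<beta>' s) * cis (\<beta> s)" "\<rho>' (Suc m) s = 0" "a (Suc m) s = cis (\<beta> s)"
          "\<rho> (Suc m) s = 0" "e m = \<beta>' s * (cmod (szego_val (A s) n (?z s)))\<^sup>2"
          using 2 by (auto simp: a'_def \<rho>'_def a_def \<rho>_def e_def)
        show ?thesis
        proof (cases "even m")
          case True
          have zy: "?z s * y s m = - cis (\<beta> s) * cnj (y s m)"
            using step[OF s, of m] True by (simp add: cmv_step_def a y0)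
          have "cmv_block (a' (Suc m) s) (\<rho>' (Suc m) s) m (y s m) (y s (Suc m)) (?z s) (y s m) (y s (Suc m))
              = \<i> * of_real (\<beta>' s) * (- cis (\<beta> s) * cnj (y s m)) * cnj (?z s * y s m)"
            using True by (simp add: cmv_block_def block_form_def a y0)
          also have "\<dots> = \<i> * of_real (\<beta>' s) * ((?z s * cnj (?z s)) * (y s m * cnj (y s m)))"
            unfolding zy[symmetric] by (simp add: mult_ac)
          also have "\<dots> = \<i> * of_real (e m)"
            unfolding unimodular_mult_cnj[OF norm_cis] yy a by simp
          finally show ?thesis .
        next
          case False
          have zy: "cnj (y s m) = - cis (\<beta> s) * y s m"
            using step[OF s, of m] False by (simp add: cmv_step_def a y0)
          have "cmv_block (a' (Suc m) s) (\<rho>' (Suc m) s) m (y s m) (y s (Suc m)) (?z s) (y s m) (y s (Suc m))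
              = \<i> * of_real (\<beta>' s) * ((- cis (\<beta> s) * y s m) * y s m)"
            using False by (simp add: cmv_block_def block_form_def a y0)
          also have "\<dots> = \<i> * of_real (\<beta>' s) * (y s m * cnj (y s m))"
            unfolding zy[symmetric] by (simp add: mult_ac)
          also have "\<dots> = \<i> * of_real (e m)" unfolding yy a by simp
          finally show ?thesis .
        qed
      next
        case 3
        then show ?thesis by (simp add: a'_def \<rho>'_def e_def cmv_block_def block_form_def)
      qed
    qed
    have "(\<theta> k has_real_derivative (suminf e / (\<Sum>m. (cmod (y s m))\<^sup>2))) (at s within I)"
    proof (rule has_real_derivative_eigenvalue_angle(2)[where a = a and \<rho> = \<rho> and a' = a' and \<rho>' = \<rho>' and C = C])
      show "y t 0 = 1" if "t \<in> I" for t using N by (simp add: y_def b_def cmv_def)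
      show "cmod (a' (Suc m) s) \<le> C" for m
        using C(1)[of m] C0 by (cases "Suc m \<le> N") (auto simp: a'_def)
      show "\<bar>\<rho>' (Suc m) s\<bar> \<le> C" for m
        using C(2)[of m] C0 by (cases "Suc m \<le> N") (auto simp: \<rho>'_def)
      show "summable (\<lambda>m. (cmod (y t m))\<^sup>2)" for t by (rule sums_summable[OF sums_y])
      have "((\<lambda>t. \<Sum>m<N. (cmod (y t m))\<^sup>2) \<longlongrightarrow> (\<Sum>m<N. (cmod (y s m))\<^sup>2)) (at s within I)"
        by (intro tendsto_intros ylim)
      then show "((\<lambda>t. \<Sum>m. (cmod (y t m))\<^sup>2) \<longlongrightarrow> (\<Sum>m. (cmod (y s m))\<^sup>2)) (at s within I)"
        by (simp only: sums_unique[OF sums_y, symmetric])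
    qed (fact s step \<theta>_tendsto[OF s] lip aq \<rho>q ylim block)+
    moreover have "measure (\<mu>N s) {?z s} * (\<Sum>m. (cmod (y s m))\<^sup>2) = 1"
    proof -
      have "(\<Sum>m. (cmod (y s m))\<^sup>2) = (\<Sum>m<N. (cmod (szego_val (AN s) m (?z s)))\<^sup>2)"
        unfolding sums_unique[OF sums_y, symmetric] by (intro sum.cong) (auto simp: norm_y val)
      then show ?thesis using has_finite_schur_parametersD(5)[OF finA[OF s] mass[OF s]] by simp
    qed
    then have "1 / (\<Sum>m. (cmod (y s m))\<^sup>2) = measure (\<mu>N s) {?z s}"
      by (metis div_0 mult_eq_0_iff nonzero_eq_divide_eq zero_neq_one)
    moreover have "suminf e = (\<Sum>m=1..N-1. speed s (?z s) m) + \<beta>' s * (cmod (poly (\<phi> s (N - 1)) (?z s)))\<^sup>2"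
    proof -
      have "suminf e = (\<Sum>m<N. e m)" by (rule suminf_finite) (auto simp: e_def)
      also have "\<dots> = (\<Sum>m<n. speed s (?z s) (Suc m)) + \<beta>' s * (cmod (szego_val (A s) n (?z s)))\<^sup>2"
        by (simp add: Nn e_def)
      also have "(\<Sum>m<n. speed s (?z s) (Suc m)) = (\<Sum>m=1..n. speed s (?z s) m)"
        by (rule sum.reindex_bij_witness[of _ "\<lambda>m. m - 1" Suc]) auto
      finally show ?thesis by (simp add: Nn poly_phi[OF s])
    qed
    ultimately show ?thesis by (metis mult.commute times_divide_eq_right mult.right_neutral)
  qed
  show ?thesis by (rule that[of \<theta>]) (use bij deriv in auto)
qed

end

section \<open>Local bounds uniform in the index\<close>

lemma locally_bounded_on_SUP_bound:
  fixes f :: "nat \<Rightarrow> real \<Rightarrow> real"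
  assumes "locally_bounded_on I (\<lambda>t. SUP n\<in>{1..}. ereal \<bar>f n t\<bar>)" "s \<in> I"
  obtains d C where "d > 0" "\<And>t n. t \<in> I \<Longrightarrow> dist s t < d \<Longrightarrow> n \<ge> 1 \<Longrightarrow> \<bar>f n t\<bar> \<le> C"
proof -
  from bspec[OF assms(1)[unfolded locally_bounded_on_def] assms(2)]
  obtain U C where U: "openin (top_of_set I) U" "s \<in> U"
    and C: "\<forall>t\<in>U. \<bar>SUP n\<in>{1..}. ereal \<bar>f n t\<bar>\<bar> \<le> ereal C"
    by (elim exE conjE) (rule that)
  obtain d where d: "d > 0" "ball s d \<inter> I \<subseteq> U" using U unfolding openin_contains_ball by blast
  show ?thesis
  proof (rule that[OF d(1)])
    fix t n assume t: "t \<in> I" "dist s t < d" and n: "n \<ge> (1::nat)"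
    have "ereal \<bar>f n t\<bar> \<le> (SUP n\<in>{1..}. ereal \<bar>f n t\<bar>)" using n by (intro SUP_upper) auto
    also have "\<dots> \<le> \<bar>SUP n\<in>{1..}. ereal \<bar>f n t\<bar>\<bar>" by (cases "SUP n\<in>{1..}. ereal \<bar>f n t\<bar>") auto
    also have "\<dots> \<le> ereal C" using t d(2) by (intro bspec[OF C]) auto
    finally show "\<bar>f n t\<bar> \<le> C" by simp
  qed
qed

context szego_flow
begin

text \<open>The mean value inequality on an interval around \<open>s\<close>. The derivative of
  \<open>rho\<close> has \<open>sqrt (1 - (r n t)\<^sup>2)\<close> in the denominator; it is bounded
  because the numerator contains \<open>r'\<close>, and wherever that is nonzero \<open>r\<close>
  stays away from 1.\<close>

lemma local_lipschitz:
  assumes s: "s \<in> I"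
    and bdr: "locally_bounded_on I (\<lambda>t. SUP n\<in>{1..}. ereal \<bar>r' n t\<bar>)"
    and bda: "locally_bounded_on I (\<lambda>t. SUP n\<in>{1..}. ereal \<bar>\<alpha>' n t\<bar>)"
    and R: "R < 1" "\<And>n t. n \<ge> 1 \<Longrightarrow> t \<in> I \<Longrightarrow> r' n t \<noteq> 0 \<Longrightarrow> \<bar>r n t\<bar> < R"
  obtains d C where "d > 0" "C \<ge> 0"
    and "\<And>n t u. n \<ge> 1 \<Longrightarrow> t \<in> I \<inter> ball s d \<Longrightarrow> u \<in> I \<inter> ball s d \<Longrightarrow>
          cmod (A t n - A u n) \<le> C * \<bar>t - u\<bar> \<and> \<bar>rho (A t n) - rho (A u n)\<bar> \<le> C * \<bar>t - u\<bar>"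
    and "\<And>n t. n \<ge> 1 \<Longrightarrow> t \<in> I \<inter> ball s d \<Longrightarrow> cmod (A' t n) \<le> C \<and> \<bar>R' t n\<bar> \<le> C"
proof -
  obtain d1 C1 where d1: "d1 > 0" and C1: "\<And>t n. t \<in> I \<Longrightarrow> dist s t < d1 \<Longrightarrow> n \<ge> 1 \<Longrightarrow> \<bar>r' n t\<bar> \<le> C1"
    using locally_bounded_on_SUP_bound[OF bdr s] by blast
  obtain d2 C2 where d2: "d2 > 0" and C2: "\<And>t n. t \<in> I \<Longrightarrow> dist s t < d2 \<Longrightarrow> n \<ge> 1 \<Longrightarrow> \<bar>\<alpha>' n t\<bar> \<le> C2"
    using locally_bounded_on_SUP_bound[OF bda s] by blast
  define d where "d = min d1 d2"
  define S where "S = I \<inter> ball s d"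
  have d: "d > 0" using d1 d2 by (simp add: d_def)
  have S: "convex S" unfolding S_def by (intro convex_Int convex_ball is_interval_convex interval)
  have SI: "S \<subseteq> I" by (simp add: S_def)
  have sS: "s \<in> S" using s d by (simp add: S_def)
  have b1: "\<bar>r' n t\<bar> \<le> C1" and b2: "\<bar>\<alpha>' n t\<bar> \<le> C2" if "n \<ge> 1" "t \<in> S" for n t
    using C1[of t n] C2[of t n] that by (auto simp: S_def d_def)
  have C12: "C1 \<ge> 0" "C2 \<ge> 0" using b1[of 1 s] b2[of 1 s] sS by auto
  \<comment> \<open>\<open>R\<close> may be negative, and then its square would say nothing about
    \<open>r\<close>.\<close>
  define R0 where "R0 = max R 0"
  define q where "q = sqrt (1 - R0\<^sup>2)"
  have R0: "0 \<le> R0" "R0 < 1" using R(1) by (auto simp: R0_def)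
  have q: "q > 0" using R0 by (simp add: q_def abs_square_less_1)
  \<comment> \<open>Real and imaginary parts are estimated separately, hence the factor 2; the last
    summand belongs to \<open>rho\<close>.\<close>
  define C where "C = 2 * (C1 + C2) + C1 / q"
  have Cq: "C1 / q \<ge> 0" using C12 q by simp
  have A'_bound: "cmod (A' t n) \<le> C1 + C2" if n: "n \<ge> 1" and t: "t \<in> S" for n t
  proof -
    have "\<bar>r n t\<bar> * \<bar>\<alpha>' n t\<bar> \<le> 1 * C2"
      using r_less[OF n, of t] b2[OF n t] t SI by (intro mult_mono) auto
    moreover have "cmod (A' t n) \<le> \<bar>r' n t\<bar> + \<bar>r n t\<bar> * \<bar>\<alpha>' n t\<bar>"
      using norm_triangle_ineq[of "complex_of_real (r' n t)" "\<i> * of_real (r n t * \<alpha>' n t)"]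
      by (simp add: A'_def norm_mult abs_mult)
    ultimately show ?thesis using b1[OF n t] by linarith
  qed
  have R'_bound: "\<bar>R' t n\<bar> \<le> C1 / q" if n: "n \<ge> 1" and t: "t \<in> S" for n t
  proof (cases "r' n t = 0")
    case True
    then show ?thesis using Cq by (simp add: R'_def)
  next
    case False
    then have "\<bar>r n t\<bar> < R" using R(2) n t SI by blast
    then have "\<bar>r n t\<bar> \<le> R0" by (simp add: R0_def)
    then have "(r n t)\<^sup>2 \<le> R0\<^sup>2" by (rule abs_le_square_iff[THEN iffD1, of "r n t" R0, simplified abs_of_nonneg[OF R0(1)]])
    then have q': "q \<le> sqrt (1 - (r n t)\<^sup>2)" by (simp add: q_def)
    have "\<bar>r n t * r' n t\<bar> \<le> 1 * C1"
      unfolding abs_mult using r_less[OF n, of t] b1[OF n t] t SI by (intro mult_mono) auto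
    then have "\<bar>r n t * r' n t\<bar> / sqrt (1 - (r n t)\<^sup>2) \<le> C1 / q"
      using q q' C12 by (intro frac_le) auto
    then show ?thesis using q q' by (simp add: R'_def abs_divide)
  qed
  have re: "((\<lambda>t. Re (A t n)) has_real_derivative Re (A' t n)) (at t within S)"
    and im: "((\<lambda>t. Im (A t n)) has_real_derivative Im (A' t n)) (at t within S)"
    and rh: "((\<lambda>t. rho (A t n)) has_real_derivative R' t n) (at t within S)"
    if n: "n \<ge> 1" and t: "t \<in> S" for n t
  proof -
    have tI: "t \<in> I" using t SI by blast
    note D = DERIV_subset[OF r_deriv[OF n tI] SI] DERIV_subset[OF \<alpha>_deriv[OF n tI] SI]
    show "((\<lambda>t. Re (A t n)) has_real_derivative Re (A' t n)) (at t within S)"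
      "((\<lambda>t. Im (A t n)) has_real_derivative Im (A' t n)) (at t within S)"
      unfolding A_def A'_def by (auto intro!: derivative_eq_intros D)
    show "((\<lambda>t. rho (A t n)) has_real_derivative R' t n) (at t within S)"
      unfolding rho_A R'_def by (rule has_real_derivative_sqrt_one_minus_square[OF D(1) r_less[OF n tI]])
  qed
  show ?thesis
  proof (rule that[of d C])
    show "d > 0" by (rule d)
    show "C \<ge> 0" using C12 Cq by (simp add: C_def)
    fix n t assume n: "n \<ge> (1::nat)" and t: "t \<in> I \<inter> ball s d"
    then have tS: "t \<in> S" by (simp add: S_def)
    show "cmod (A' t n) \<le> C \<and> \<bar>R' t n\<bar> \<le> C"
      using A'_bound[OF n tS] R'_bound[OF n tS] C12 Cq by (auto simp: C_def)
    fix u assume u: "u \<in> I \<inter> ball s d"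
    then have uS: "u \<in> S" by (simp add: S_def)
    have "norm (Re (A t n) - Re (A u n)) \<le> (C1 + C2) * norm (t - u)"
      by (rule field_differentiable_bound[OF S re[OF n] _ tS uS])
        (simp_all add: order_trans[OF abs_Re_le_cmod A'_bound[OF n]])
    moreover have "norm (Im (A t n) - Im (A u n)) \<le> (C1 + C2) * norm (t - u)"
      by (rule field_differentiable_bound[OF S im[OF n] _ tS uS])
        (simp_all add: order_trans[OF abs_Im_le_cmod A'_bound[OF n]])
    moreover have rr: "norm (rho (A t n) - rho (A u n)) \<le> C1 / q * norm (t - u)"
      by (rule field_differentiable_bound[OF S rh[OF n] _ tS uS]) (simp_all add: R'_bound[OF n])
    moreover have "cmod (A t n - A u n) \<le> \<bar>Re (A t n - A u n)\<bar> + \<bar>Im (A t n - A u n)\<bar>"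
      by (rule cmod_le)
    moreover have "C * \<bar>t - u\<bar> = 2 * ((C1 + C2) * \<bar>t - u\<bar>) + C1 / q * \<bar>t - u\<bar>"
      by (simp add: C_def algebra_simps)
    moreover have "(C1 + C2) * \<bar>t - u\<bar> \<ge> 0" using C12 by simp
    moreover have "C1 / q * \<bar>t - u\<bar> \<ge> 0" by (rule mult_nonneg_nonneg[OF Cq abs_ge_zero])
    ultimately show "cmod (A t n - A u n) \<le> C * \<bar>t - u\<bar> \<and> \<bar>rho (A t n) - rho (A u n)\<bar> \<le> C * \<bar>t - u\<bar>"
      by simp
  qed
qed

text \<open>For \<open>t\<close> near \<open>t\<^sub>0\<close>, persistence gives at least one
  support point in a small ball around \<open>l\<^sub>0\<close> and non-splitting at most one. This
  ball serves as the window \<open>B\<close> for all such \<open>t\<close>.\<close>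

lemma infinite_case:
  assumes bdr: "locally_bounded_on I (\<lambda>t. SUP n\<in>{1..}. ereal \<bar>r' n t\<bar>)"
    and bda: "locally_bounded_on I (\<lambda>t. SUP n\<in>{1..}. ereal \<bar>\<alpha>' n t\<bar>)"
    and R: "R < 1" "\<And>n t. n \<ge> 1 \<Longrightarrow> t \<in> I \<Longrightarrow> r' n t \<noteq> 0 \<Longrightarrow> \<bar>r n t\<bar> < R"
    and t0: "t\<^sub>0 \<in> I" and l0: "isolated_mass_point (\<mu> t\<^sub>0) l\<^sub>0"
  obtains J :: "real set" and \<theta> :: "real \<Rightarrow> real"
  where "openin (top_of_set I) J" "t\<^sub>0 \<in> J" "cis (\<theta> t\<^sub>0) = l\<^sub>0"
    and "\<And>t. t \<in> J \<Longrightarrow> isolated_mass_point (\<mu> t) (cis (\<theta> t))"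
    and "\<And>t. t \<in> J \<Longrightarrow> summable (\<lambda>n. speed t (cis (\<theta> t)) (Suc n))"
    and "\<And>t. t \<in> J \<Longrightarrow> (\<theta> has_real_derivative
           measure (\<mu> t) {cis (\<theta> t)} * (\<Sum>n. speed t (cis (\<theta> t)) (Suc n))) (at t within J)"
proof -
  have close: "\<exists>d>0. \<forall>t\<in>I \<inter> ball s d. params_close \<eta> (A s) (A t)" if s: "s \<in> I" and \<eta>: "\<eta> > 0" for s \<eta>
  proof -
    obtain d C where d: "d > 0" "C \<ge> 0"
      and L: "\<And>n t u. n \<ge> 1 \<Longrightarrow> t \<in> I \<inter> ball s d \<Longrightarrow> u \<in> I \<inter> ball s d \<Longrightarrow>
          cmod (A t n - A u n) \<le> C * \<bar>t - u\<bar> \<and> \<bar>rho (A t n) - rho (A u n)\<bar> \<le> C * \<bar>t - u\<bar>"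
      by (rule local_lipschitz[OF s bdr bda R(1)], erule (2) R(2), rule that)
    \<comment> \<open>The denominator \<open>C + 1\<close> allows \<open>C = 0\<close>.\<close>
    define d' where "d' = min d (\<eta> / (C + 1))"
    have "d' > 0" using d \<eta> by (simp add: d'_def)
    moreover have "params_close \<eta> (A s) (A t)" if t: "t \<in> I \<inter> ball s d'" for t
    proof -
      have "C * \<bar>s - t\<bar> \<le> C * (\<eta> / (C + 1))"
        using t d by (intro mult_left_mono) (auto simp: d'_def dist_real_def)
      also have "\<dots> \<le> \<eta>" using d(2) \<eta> by (simp add: field_simps)
      finally have Ct: "C * \<bar>s - t\<bar> \<le> \<eta>" .
      have ts: "t \<in> I \<inter> ball s d" "s \<in> I \<inter> ball s d" using t s d by (auto simp: d'_def)
      show ?thesis unfolding params_close_def using L[OF _ ts(2,1)] Ct order_trans by blast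
    qed
    ultimately show ?thesis by blast
  qed
  interpret M0: cmv_measure "\<mu> t\<^sub>0" "A t\<^sub>0" by (rule cmv_measure_A[OF t0])
  have l0S: "l\<^sub>0 \<in> measure_support (\<mu> t\<^sub>0)" and "\<exists>T. open T \<and> T \<inter> measure_support (\<mu> t\<^sub>0) = {l\<^sub>0}"
    using l0 by (auto simp: isolated_mass_point_def isolated_in_def)
  then obtain T where T: "open T" "T \<inter> measure_support (\<mu> t\<^sub>0) = {l\<^sub>0}" by blast
  then obtain \<delta>0 where \<delta>0: "\<delta>0 > 0" "ball l\<^sub>0 \<delta>0 \<subseteq> T" using openE by blast
  \<comment> \<open>The bound 1 keeps the points in the window less than 1 away from
    \<open>l\<^sub>0\<close>, as needed for the choice of the angle.\<close>
  define \<delta> where "\<delta> = min \<delta>0 1"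
  have \<delta>: "\<delta> > 0" "\<delta> \<le> 1" using \<delta>0 by (auto simp: \<delta>_def)
  have iso0: "measure_support (\<mu> t\<^sub>0) \<inter> ball l\<^sub>0 \<delta> \<subseteq> {l\<^sub>0}"
    using T(2) \<delta>0(2) by (auto simp: \<delta>_def)
  have l1: "cmod l\<^sub>0 = 1" using measure_support_subset_circle[OF M0.circle] l0S by auto
  have \<delta>8: "\<delta> / 8 > 0" using \<delta> by simp
  obtain \<eta> where \<eta>: "\<eta> > 0"
    and meet: "\<And>M' a'. cmv_measure M' a' \<Longrightarrow> params_close \<eta> (A t\<^sub>0) a' \<Longrightarrow> measure_support M' \<inter> ball l\<^sub>0 (\<delta> / 8) \<noteq> {}"
    by (rule support_meets_ball[OF cmv_measure_A[OF t0] l0S \<delta>8], rule that)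
  define \<eta>' where "\<eta>' = min \<eta> (\<delta>\<^sup>2 / 192)"
  have \<eta>': "\<eta>' > 0" using \<eta> \<delta> by (simp add: \<eta>'_def)
  obtain d where d: "d > 0" and cl: "\<And>t. t \<in> I \<inter> ball t\<^sub>0 d \<Longrightarrow> params_close \<eta>' (A t\<^sub>0) (A t)"
    using close[OF t0 \<eta>'] by blast
  define J where "J = I \<inter> ball t\<^sub>0 d"
  define B where "B = ball l\<^sub>0 (\<delta> / 8)"
  have JI: "J \<subseteq> I" by (simp add: J_def)
  have t0J: "t\<^sub>0 \<in> J" using t0 d by (simp add: J_def)
  have ex: "\<exists>l. measure_support (\<mu> t) \<inter> B = {l}" if t: "t \<in> J" for t
  proof -
    have tI: "t \<in> I" using t JI by blast
    have "params_close \<eta> (A t\<^sub>0) (A t)" "params_close (\<delta>\<^sup>2 / 192) (A t\<^sub>0) (A t)"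
      using cl[of t] t by (auto simp: params_close_def J_def \<eta>'_def)
    with meet[OF cmv_measure_A[OF tI]] support_point_near_isolated_unique[OF cmv_measure_A[OF t0] l1 \<delta>(1) iso0 cmv_measure_A[OF tI]]
    have "measure_support (\<mu> t) \<inter> B \<noteq> {}" "\<And>w w'. w \<in> measure_support (\<mu> t) \<inter> B \<Longrightarrow> w' \<in> measure_support (\<mu> t) \<inter> B \<Longrightarrow> w = w'"
      unfolding B_def by blast+
    then show ?thesis by blast
  qed
  define l where "l t = (THE l. measure_support (\<mu> t) \<inter> B = {l})" for t
  have l: "measure_support (\<mu> t) \<inter> B = {l t}" if "t \<in> J" for t
    using ex[OF that] unfolding l_def by (metis (mono_tags, lifting) singleton_inject the_equality)
  interpret fam: cmv_family J \<mu> A B l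
  proof (rule cmv_family.intro)
    show "cmv_measure (\<mu> t) (A t)" if "t \<in> J" for t using that JI by (intro cmv_measure_A) blast
    show "\<forall>\<^sub>F t in at s within J. params_close \<eta> (A s) (A t)" if s: "s \<in> J" and "\<eta> > 0" for s \<eta>
    proof -
      obtain d where d: "d > 0" "\<forall>t\<in>I \<inter> ball s d. params_close \<eta> (A s) (A t)"
        using close[of s \<eta>] s JI \<open>\<eta> > 0\<close> by blast
      then show ?thesis unfolding eventually_at
        using JI by (intro exI[of _ d]) (auto simp: dist_commute)
    qed
  qed (auto simp: B_def l[unfolded B_def])
  \<comment> \<open>\<open>Arg (l t)\<close> could jump at the negative axis. The quotient
    \<open>l t / l\<^sub>0\<close> stays in the right half-plane, where \<open>Arg\<close> is
    continuous.\<close>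
  define \<theta> where "\<theta> t = Arg l\<^sub>0 + Arg (l t / l\<^sub>0)" for t
  have l00: "l\<^sub>0 \<noteq> 0" using l1 by auto
  have quot_pos: "Re (l t / l\<^sub>0) > 0" if t: "t \<in> J" for t
  proof -
    have "cmod (l t - l\<^sub>0) < 1"
      using fam.l_in(2)[OF t] \<delta> by (simp add: B_def dist_norm norm_minus_commute)
    then have "cmod (l t / l\<^sub>0 - 1) < 1"
      using l1 l00 by (simp add: diff_divide_distrib[symmetric] norm_divide divide_diff_eq_iff)
    then show ?thesis using abs_Re_le_cmod[of "l t / l\<^sub>0 - 1"] by (simp del: Re_divide)
  qed
  have cis\<theta>: "cis (\<theta> t) = l t" if t: "t \<in> J" for t
  proof -
    have "cis (Arg l\<^sub>0) = l\<^sub>0" using l00 l1 by (simp add: cis_Arg sgn_eq)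
    moreover have "cis (Arg (l t / l\<^sub>0)) = l t / l\<^sub>0"
      using quot_pos[OF t] fam.norm_l[OF t] l1 by (subst cis_Arg) (auto simp: sgn_eq norm_divide)
    ultimately show ?thesis using l00 by (simp add: \<theta>_def cis_mult[symmetric])
  qed
  have \<theta>_tendsto: "(\<theta> \<longlongrightarrow> \<theta> s) (at s within J)" if s: "s \<in> J" for s
  proof -
    have "((\<lambda>t. l t / l\<^sub>0) \<longlongrightarrow> l s / l\<^sub>0) (at s within J)"
      using l00 by (intro tendsto_intros fam.l_tendsto s)
    moreover have "isCont Arg (l s / l\<^sub>0)"
      by (intro continuous_at_Arg Re_pos_not_nonpos_Reals quot_pos s)
    ultimately have "((\<lambda>t. Arg (l t / l\<^sub>0)) \<longlongrightarrow> Arg (l s / l\<^sub>0)) (at s within J)"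
      using isCont_tendsto_compose by blast
    then show ?thesis unfolding \<theta>_def by (intro tendsto_add tendsto_const)
  qed
  have main: "summable (\<lambda>n. speed s (cis (\<theta> s)) (Suc n)) \<and>
      (\<theta> has_real_derivative (\<Sum>n. speed s (cis (\<theta> s)) (Suc n)) / (\<Sum>n. (cmod (cmv_val (A s) n (l s)))\<^sup>2)) (at s within J)"
    if s: "s \<in> J" for s
  proof -
    have sI: "s \<in> I" using s JI by blast
    obtain d C where d: "d > 0" "C \<ge> 0"
      and L: "\<And>n t u. n \<ge> 1 \<Longrightarrow> t \<in> I \<inter> ball s d \<Longrightarrow> u \<in> I \<inter> ball s d \<Longrightarrow>
          cmod (A t n - A u n) \<le> C * \<bar>t - u\<bar> \<and> \<bar>rho (A t n) - rho (A u n)\<bar> \<le> C * \<bar>t - u\<bar>"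
      and bnd: "\<And>n t. n \<ge> 1 \<Longrightarrow> t \<in> I \<inter> ball s d \<Longrightarrow> cmod (A' t n) \<le> C \<and> \<bar>R' t n\<bar> \<le> C"
      by (rule local_lipschitz[OF sI bdr bda R(1)], erule (2) R(2), rule that)
    have sd: "s \<in> I \<inter> ball s d" using sI d by simp
    have y0: "cmv_val (A t) 0 (l t) = 1" if "t \<in> J" for t by (simp add: cmv_val_def cmv_def)
    have step: "cmv_step (A t (Suc n)) (rho (A t (Suc n))) (cis (\<theta> t)) n (cmv_val (A t) n (l t)) (cmv_val (A t) (Suc n) (l t))"
      if t: "t \<in> J" for t n
      unfolding cis\<theta>[OF t] using t JI by (intro cmv_val_step fam.norm_l A_less) auto
    have lip: "\<forall>\<^sub>F t in at s within J. \<forall>n. cmod (A t (Suc n) - A s (Suc n)) \<le> C * \<bar>t - s\<bar>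
        \<and> \<bar>rho (A t (Suc n)) - rho (A s (Suc n))\<bar> \<le> C * \<bar>t - s\<bar>"
      unfolding eventually_at
      using d JI L[OF _ _ sd] by (intro exI[of _ d]) (auto simp: dist_commute subset_iff)
    \<comment> \<open>The sums of squares are reciprocal masses, so their convergence is the
      continuity of the mass.\<close>
    have Klim: "((\<lambda>t. \<Sum>n. (cmod (cmv_val (A t) n (l t)))\<^sup>2) \<longlongrightarrow> (\<Sum>n. (cmod (cmv_val (A s) n (l s)))\<^sup>2)) (at s within J)"
    proof -
      have "((\<lambda>t. 1 / measure (\<mu> t) {l t}) \<longlongrightarrow> 1 / measure (\<mu> s) {l s}) (at s within J)"
        using fam.mass_pos[OF s] by (intro tendsto_intros fam.mass_tendsto s) simp
      then show ?thesis unfolding sums_unique[OF fam.sums_mass[OF s], symmetric]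
        by (rule Lim_transform_eventually)
          (use fam.eventually_in_J in eventually_elim, simp add: sums_unique[OF fam.sums_mass])
    qed
    have q: "((\<lambda>t. (A t (Suc n) - A s (Suc n)) / of_real (t - s)) \<longlongrightarrow> A' s (Suc n)) (at s within J)"
      "((\<lambda>t. (rho (A t (Suc n)) - rho (A s (Suc n))) / (t - s)) \<longlongrightarrow> R' s (Suc n)) (at s within J)" for n
      using A_quotient[OF _ sI JI, of "Suc n"] rho_quotient[OF _ sI JI, of "Suc n"] by auto
    have bnd': "cmod (A' s (Suc n)) \<le> C" "\<bar>R' s (Suc n)\<bar> \<le> C" for n using bnd[OF _ sd, of "Suc n"] by auto
    have block: "cmv_block (A' s (Suc n)) (R' s (Suc n)) n (cmv_val (A s) n (l s)) (cmv_val (A s) (Suc n) (l s)) (cis (\<theta> s))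
        (cmv_val (A s) n (l s)) (cmv_val (A s) (Suc n) (l s)) = \<i> * of_real (speed s (cis (\<theta> s)) (Suc n))" for n
      unfolding cis\<theta>[OF s] by (rule block_speed[OF sI fam.norm_l[OF s]])
    have summ: "summable (\<lambda>n. (cmod (cmv_val (A t) n (l t)))\<^sup>2)" if "t \<in> J" for t
      by (rule sums_summable[OF fam.sums_mass[OF that]])
    note facts = s y0 step \<theta>_tendsto[OF s] lip q bnd' fam.val_tendsto[OF s] summ Klim block
    note deriv = has_real_derivative_eigenvalue_angle[where y = "\<lambda>t n. cmv_val (A t) n (l t)"
            and a = "\<lambda>n t. A t n" and \<rho> = "\<lambda>n t. rho (A t n)" and a' = "\<lambda>n t. A' t n"
            and \<rho>' = "\<lambda>n t. R' t n" and C = C and \<theta> = \<theta> and J = J and s = s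
            and e = "\<lambda>n. speed s (cis (\<theta> s)) (Suc n)"]
    show ?thesis
      by (intro conjI deriv) (fact facts)+
  qed
  show ?thesis
  proof (rule that[of J \<theta>])
    show "openin (top_of_set I) J" unfolding J_def by (intro openin_open_Int open_ball)
    show "t\<^sub>0 \<in> J" by (rule t0J)
    have "measure_support (\<mu> t\<^sub>0) \<inter> B = {l\<^sub>0}" using iso0 l0S \<delta> by (auto simp: B_def subset_iff)
    then show "cis (\<theta> t\<^sub>0) = l\<^sub>0" using l[OF t0J] cis\<theta>[OF t0J] by simp
    fix t assume t: "t \<in> J"
    show "isolated_mass_point (\<mu> t) (cis (\<theta> t))"
      unfolding isolated_mass_point_def isolated_in_def cis\<theta>[OF t]
      using l[OF t] fam.l_in[OF t] by (intro conjI exI[of _ B]) (auto simp: B_def)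
    show "summable (\<lambda>n. speed t (cis (\<theta> t)) (Suc n))" using main[OF t] by blast
    show "(\<theta> has_real_derivative
           measure (\<mu> t) {cis (\<theta> t)} * (\<Sum>n. speed t (cis (\<theta> t)) (Suc n))) (at t within J)"
      using main[OF t] unfolding sums_unique[OF fam.sums_mass[OF t], symmetric] 
      by (simp add: cis\<theta>[OF t] mult.commute)
  qed
qed

end

theorem theorem5p3:
  fixes I :: "real set"
    and r r' \<alpha> \<alpha>' :: "nat \<Rightarrow> real \<Rightarrow> real"
    and \<mu> :: "real \<Rightarrow> complex measure"
    and \<phi> :: "real \<Rightarrow> nat \<Rightarrow> complex poly"
  assumes interval: "is_interval I"
    and r_range: "\<And>n t. n \<ge> 1 \<Longrightarrow> t \<in> I \<Longrightarrow> r n t \<in> {-1<..<1}"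
    and r_deriv: "\<And>n t. n \<ge> 1 \<Longrightarrow> t \<in> I \<Longrightarrow> (r n has_real_derivative r' n t) (at t within I)"
    and \<alpha>_deriv: "\<And>n t. n \<ge> 1 \<Longrightarrow> t \<in> I \<Longrightarrow> (\<alpha> n has_real_derivative \<alpha>' n t) (at t within I)"
    and \<mu>: "\<And>t. t \<in> I \<Longrightarrow>
      has_schur_parameters (\<mu> t) (\<lambda>n. of_real (r n t) * exp (\<i> * of_real (\<alpha> n t)))"
    and \<phi>: "\<And>t. t \<in> I \<Longrightarrow> orthonormal_polynomials (\<mu> t) UNIV (\<phi> t)"
  shows
    "(\<forall>(N::nat) (\<beta>::real \<Rightarrow> real) (\<beta>'::real \<Rightarrow> real) (\<mu>N::real \<Rightarrow> complex measure).
        N \<ge> 1 \<and>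
        (\<forall>t\<in>I. (\<beta> has_real_derivative \<beta>' t) (at t within I)) \<and>
        (\<forall>t\<in>I. has_finite_schur_parameters (\<mu>N t) N
           (\<lambda>n. if n < N then of_real (r n t) * exp (\<i> * of_real (\<alpha> n t))
                else exp (\<i> * of_real (\<beta> t))))
      \<longrightarrow>
        (\<exists>\<theta>::nat \<Rightarrow> real \<Rightarrow> real.
          (\<forall>t\<in>I. bij_betw (\<lambda>k. exp (\<i> * of_real (\<theta> k t))) {..<N} (mass_points (\<mu>N t))) \<and>
          (\<forall>k<N. \<forall>t\<in>I.
             let z = exp (\<i> * of_real (\<theta> k t)) in
             (\<theta> k has_real_derivative
               measure (\<mu>N t) {z} *
                 ((\<Sum>n=1..N-1. r' n t * Gamma_term r \<alpha> \<phi> n t z + \<alpha>' n t * Delta_term \<phi> n t z)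
                  + \<beta>' t * (cmod (poly (\<phi> t (N - 1)) z))\<^sup>2))
             (at t within I))))
     \<and>
     (\<forall>(r''::nat \<Rightarrow> real \<Rightarrow> real) (\<alpha>''::nat \<Rightarrow> real \<Rightarrow> real) (t\<^sub>0::real) (l\<^sub>0::complex).
        (\<forall>n\<ge>1. \<forall>t\<in>I. (r' n has_real_derivative r'' n t) (at t within I)) \<and>
        (\<forall>n\<ge>1. \<forall>t\<in>I. (\<alpha>' n has_real_derivative \<alpha>'' n t) (at t within I)) \<and>
        locally_bounded_on I (\<lambda>t. SUP n\<in>{1..}. ereal \<bar>r' n t\<bar>) \<and>
        locally_bounded_on I (\<lambda>t. SUP n\<in>{1..}. ereal \<bar>r'' n t\<bar>) \<and>
        locally_bounded_on I (\<lambda>t. SUP n\<in>{1..}. ereal \<bar>\<alpha>' n t\<bar>) \<and>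
        locally_bounded_on I (\<lambda>t. SUP n\<in>{1..}. ereal \<bar>\<alpha>'' n t\<bar>) \<and>
        (\<exists>R<1. \<forall>n\<ge>1. \<forall>t\<in>I. r' n t \<noteq> 0 \<longrightarrow> \<bar>r n t\<bar> < R) \<and>
        t\<^sub>0 \<in> I \<and> isolated_mass_point (\<mu> t\<^sub>0) l\<^sub>0
      \<longrightarrow>
        (\<exists>(J::real set) (l::real \<Rightarrow> complex).
          openin (top_of_set I) J \<and> t\<^sub>0 \<in> J \<and>
          (\<forall>t\<in>J. l t \<in> sphere 0 1) \<and> l differentiable_on J \<and>
          (\<forall>t\<in>J. isolated_mass_point (\<mu> t) (l t)) \<and> l t\<^sub>0 = l\<^sub>0 \<and>
          (\<exists>\<theta>::real \<Rightarrow> real.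
            (\<forall>t\<in>J. l t = exp (\<i> * of_real (\<theta> t))) \<and>
            (\<forall>t\<in>J. \<exists>S.
               (\<lambda>n. r' (Suc n) t * Gamma_term r \<alpha> \<phi> (Suc n) t (l t)
                     + \<alpha>' (Suc n) t * Delta_term \<phi> (Suc n) t (l t)) sums S \<and>
               (\<theta> has_real_derivative measure (\<mu> t) {l t} * S) (at t within J)))))"
proof -
  interpret szego_flow I r r' \<alpha> \<alpha>' \<mu> \<phi>
    by (rule szego_flow.intro[OF assms])
  show ?thesis
  proof (intro conjI allI impI, goal_cases)
    case (1 N \<beta> \<beta>' \<mu>N)
    obtain \<theta> :: "nat \<Rightarrow> real \<Rightarrow> real"
      where \<theta>: "\<And>t. t \<in> I \<Longrightarrow> bij_betw (\<lambda>k. cis (\<theta> k t)) {..<N} (mass_points (\<mu>N t))"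
        "\<And>k t. k < N \<Longrightarrow> t \<in> I \<Longrightarrow> (\<theta> k has_real_derivative
           measure (\<mu>N t) {cis (\<theta> k t)} * ((\<Sum>n=1..N-1. speed t (cis (\<theta> k t)) n)
             + \<beta>' t * (cmod (poly (\<phi> t (N - 1)) (cis (\<theta> k t))))\<^sup>2)) (at t within I)"
      by (rule finite_case[of N \<beta> \<beta>' \<mu>N]) (use 1 in blast)+
    show ?case
      unfolding Let_def cis_conv_exp[symmetric] speed_def[symmetric] using \<theta> by blast
  next
    case H: (2 r'' \<alpha>'' t\<^sub>0 l\<^sub>0)
    have bdr: "locally_bounded_on I (\<lambda>t. SUP n\<in>{1..}. ereal \<bar>r' n t\<bar>)"
      and bda: "locally_bounded_on I (\<lambda>t. SUP n\<in>{1..}. ereal \<bar>\<alpha>' n t\<bar>)"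
      and t0: "t\<^sub>0 \<in> I" and l0: "isolated_mass_point (\<mu> t\<^sub>0) l\<^sub>0"
      using H by - (elim conjE, assumption)+
    obtain R where R: "R < 1" "\<forall>n\<ge>1. \<forall>t\<in>I. r' n t \<noteq> 0 \<longrightarrow> \<bar>r n t\<bar> < R"
      using H by (elim conjE exE) (rule that)
    obtain J :: "real set" and \<theta> :: "real \<Rightarrow> real"
      where J: "openin (top_of_set I) J" "t\<^sub>0 \<in> J" "cis (\<theta> t\<^sub>0) = l\<^sub>0"
        and iso: "\<And>t. t \<in> J \<Longrightarrow> isolated_mass_point (\<mu> t) (cis (\<theta> t))"
        and summ: "\<And>t. t \<in> J \<Longrightarrow> summable (\<lambda>n. speed t (cis (\<theta> t)) (Suc n))"
        and deriv: "\<And>t. t \<in> J \<Longrightarrow> (\<theta> has_real_derivative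
           measure (\<mu> t) {cis (\<theta> t)} * (\<Sum>n. speed t (cis (\<theta> t)) (Suc n))) (at t within J)"
      by (rule infinite_case[OF bdr bda R(1) _ t0 l0]) (use R(2) in blast, rule that)
    have diff: "(\<lambda>t. cis (\<theta> t)) differentiable_on J"
      unfolding differentiable_on_def
    proof
      fix t assume t: "t \<in> J"
      have "((\<lambda>x. complex_of_real (\<theta> x)) has_vector_derivative
          of_real (measure (\<mu> t) {cis (\<theta> t)} * (\<Sum>n. speed t (cis (\<theta> t)) (Suc n)))) (at t within J)"
        using deriv[OF t]
        by (intro has_vector_derivative_of_real) (simp add: has_real_derivative_iff_has_vector_derivative)
      then have "((\<lambda>x. exp (\<i> * x)) \<circ> (\<lambda>x. complex_of_real (\<theta> x)) has_vector_derivative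
          of_real (measure (\<mu> t) {cis (\<theta> t)} * (\<Sum>n. speed t (cis (\<theta> t)) (Suc n)))
            * (\<i> * exp (\<i> * complex_of_real (\<theta> t)))) (at t within J)"
        by (rule field_vector_diff_chain_within) (auto intro!: derivative_eq_intros)
      then show "(\<lambda>t. cis (\<theta> t)) differentiable (at t within J)"
        unfolding o_def cis_conv_exp by (rule differentiableI_vector)
    qed
    show ?case
      unfolding cis_conv_exp[symmetric] speed_def[symmetric]
    proof (intro exI conjI ballI)
      show "(\<lambda>n. speed t (cis (\<theta> t)) (Suc n)) sums (\<Sum>n. speed t (cis (\<theta> t)) (Suc n))" if "t \<in> J" for t
        using summ[OF that] by (rule summable_sums)
    qed (use J iso diff deriv in auto)
  qed
qed

end
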